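(* Suppose that the characteristic of $k$ is different from $p$. Then $Z_m=0$ for any $m\ge1$, and the functor $\mathfrak t:\mathrm{Mod}(H)\to\mathrm{Mod}^I(G)$ is fully faithful.
   Context: Setting. $\mathfrak F$ is a locally compact nonarchimedean field of any characteristic, with ring of integers $\mathfrak O$, prime element $\pi$ and residue field $\mathbb F_q$ of characteristic $p$; $\mathbf G$ is a connected reductive $\mathfrak F$-split group over $\mathfrak F$, $G=\mathbf G(\mathfrak F)$. Fix a chamber $C$ of the semisimple Bruhat–Tits building of $G$ and a hyperspecial vertex $x_0$ of $C$. Let $\mathbf G_{x_0}$ be the Bruhat–Tits group scheme over $\mathfrak O$ attached to $x_0$ (generic fibre $\mathbf G$; special fibre $\overline{\mathbf G}_{x_0}$ connected reductive and $\mathbb F_q$-split) and $K=\mathbf G_{x_0}(\mathfrak O)$. The pointwise stabilizer $J\subseteq K$ of $C$ is an Iwahori subgroup; it corresponds to a Borel subgroup $\overline{\mathbf B}$ of $\overline{\mathbf G}_{x_0}$ with unipotent radical $\overline{\mathbf N}$. Let $I$ be the preimage of $\overline{\mathbf N}(\mathbb F_q)$ in $K$ (the pro-$p$-Iwahori subgroup), and $K_m=\ker(K\to\mathbf G_{x_0}(\mathfrak O/\pi^m\mathfrak O))$ for $m\ge1$. $k$ is a field. $\mathbf X=\mathrm{ind}_I^G(1)$ is the space of compactly supported $k$-valued functions on $G/I$ with the left translation action of $G$, and $H=\mathrm{End}_{k[G]}(\mathbf X)^{\mathrm{op}}$, so $\mathbf X$ is a $(G,H)$-bimodule. $H$ is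 identified, as a right $H$-module, with $\mathbf X^I$ via $h\mapsto(\mathrm{char}_I)h$. $\mathrm{Mod}(H)$ is the category of left $H$-modules, $\mathrm{Mod}^I(G)$ the category of smooth $k$-representations $V$ of $G$ generated by $V^I$. For a right $H$-module $Y$, $Y^*=\mathrm{Hom}_H(Y,H)$, a left $H$-module. $G$ acts on $\mathbf X^*$ by $(\lambda g)(x)=\lambda(gx)$ and hence on $\mathrm{Hom}_H(\mathbf X^*,M)$. For $M\in\mathrm{Mod}(H)$ let $\tau_M:\mathbf X\otimes_HM\to\mathrm{Hom}_H(\mathbf X^*,M)$, $x\otimes m\mapsto[\lambda\mapsto\lambda(x)m]$, and $\mathfrak t(M)=\mathrm{im}(\tau_M)$. Let $\mathbf Z_m=\mathrm{im}(\mathbf X^*\to(\mathbf X^{K_m})^* )$, which carries commuting actions of $H$ and $I$, and, with $(\,\cdot\,)_I$ denoting $I$-coinvariants, $Z_m=\ker\big((\mathbf Z_m)_I\to((\mathbf X^{K_m})^* )_I\to(\mathbf X^I)^*=H\big)$, the second map being restriction to $\mathbf X^I$. *)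

theory Defs
  imports
    "HOL-Analysis.Analysis"
    "HOL-Algebra.Algebraic_Closure_Type"
    "HOL-Algebra.Solvable_Groups"
    "HOL-Algebra.Free_Abelian_Groups"
    "HOL-Algebra.Left_Coset"
    "HOL-Algebra.Module"
    "HOL-Library.Poly_Mapping"
begin

section \<open>Linear algebraic groups\<close>

text \<open>
  Algebraic groups are treated in the classical language of Borel and Springer: an affine algebraic
  group over a field is a Zariski closed subgroup of \<open>GL\<^sub>n\<close> over the algebraic closure.
  A polynomial in the matrix entries is a finitely supported function on monomials.
\<close>

type_synonym ('a, 'n) mat = "'a^'n^'n"
type_synonym ('n, 'a) mpol = "(('n \<times> 'n) \<Rightarrow>\<^sub>0 nat) \<Rightarrow>\<^sub>0 'a"

definition pev :: "('n::finite, 'a::comm_ring_1) mpol \<Rightarrow> ('a, 'n) mat \<Rightarrow> 'a" where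
  "pev f g = (\<Sum>m\<in>Poly_Mapping.keys f. Poly_Mapping.lookup f m *
      (\<Prod>(i, j)\<in>Poly_Mapping.keys m. (g $ i $ j) ^ Poly_Mapping.lookup m (i, j)))"

definition det_poly :: "('n::finite, 'a::comm_ring_1) mpol" where
  "det_poly = det (\<chi> i j. Poly_Mapping.single (Poly_Mapping.single (i, j) 1) 1)"

definition GLn :: "('a::field, 'n::finite) mat monoid" where
  "GLn = \<lparr>carrier = {g. invertible g}, monoid.mult = (**), one = mat 1\<rparr>"

definition vanishing :: "('a::field, 'n::finite) mat set \<Rightarrow> ('n, 'a) mpol set" where
  "vanishing S = {f. \<forall>g\<in>S. pev f g = 0}"

text \<open>Every closed subset of \<open>GL\<^sub>n\<close> is cut out by polynomials in the entries alone (clear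
  denominators), so \<open>1/det\<close> need not occur in the equations.\<close>

definition zclosed :: "('a::field, 'n::finite) mat set \<Rightarrow> bool" where
  "zclosed S \<longleftrightarrow> (\<exists>P. S = {g. invertible g \<and> (\<forall>f\<in>P. pev f g = 0)})"

definition zconnected :: "('a::field, 'n::finite) mat set \<Rightarrow> bool" where
  "zconnected S \<longleftrightarrow> S \<noteq> {} \<and>
     \<not> (\<exists>A B. zclosed A \<and> zclosed B \<and> A \<union> B = S \<and> A \<inter> B = {} \<and> A \<noteq> {} \<and> B \<noteq> {})"

definition alg_group :: "('a::field, 'n::finite) mat set \<Rightarrow> bool" where
  "alg_group S \<longleftrightarrow> zclosed S \<and> subgroup S GLn"

definition conn_alg_group :: "('a::field, 'n::finite) mat set \<Rightarrow> bool" where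
  "conn_alg_group S \<longleftrightarrow> alg_group S \<and> zconnected S"

definition unipotent_set :: "('a::field, 'n::finite) mat set \<Rightarrow> bool" where
  "unipotent_set S \<longleftrightarrow> (\<forall>u\<in>S. \<exists>k. (((**) (u - mat 1)) ^^ k) (mat 1) = 0)"

definition unipotent_radical :: "('a::field, 'n::finite) mat set \<Rightarrow> ('a, 'n) mat set \<Rightarrow> bool" where
  "unipotent_radical N S \<longleftrightarrow>
     (let P = (\<lambda>U. conn_alg_group U \<and> unipotent_set U \<and> U \<lhd> GLn\<lparr>carrier := S\<rparr>)
      in P N \<and> (\<forall>U. P U \<longrightarrow> U \<subseteq> N))"

definition connected_reductive :: "('a::field, 'n::finite) mat set \<Rightarrow> bool" where
  "connected_reductive S \<longleftrightarrow> conn_alg_group S \<and> unipotent_radical {mat 1} S"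

definition borel_subgroup :: "('a::field, 'n::finite) mat set \<Rightarrow> ('a, 'n) mat set \<Rightarrow> bool" where
  "borel_subgroup B S \<longleftrightarrow>
     (let P = (\<lambda>H. conn_alg_group H \<and> solvable (GLn\<lparr>carrier := H\<rparr>) \<and> H \<subseteq> S)
      in P B \<and> (\<forall>H. P H \<and> B \<subseteq> H \<longrightarrow> H = B))"

definition torus :: "('a::field, 'n::finite) mat set \<Rightarrow> bool" where
  "torus T \<longleftrightarrow> conn_alg_group T \<and>
     (\<exists>a :: ('a, 'n) mat. invertible a \<and> (\<forall>t\<in>T. \<forall>i j. i \<noteq> j \<longrightarrow> (a ** t ** matrix_inv a) $ i $ j = 0))"

definition maximal_torus :: "('a::field, 'n::finite) mat set \<Rightarrow> ('a, 'n) mat set \<Rightarrow> bool" where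
  "maximal_torus T S \<longleftrightarrow> torus T \<and> T \<subseteq> S \<and> (\<forall>T'. torus T' \<and> T \<subseteq> T' \<and> T' \<subseteq> S \<longrightarrow> T' = T)"

type_synonym ('a, 'n) character = "('a, 'n) mat \<Rightarrow> 'a"

text \<open>The algebraic group homomorphisms \<open>S \<rightarrow> GL\<^sub>1\<close>, as functions extensional on \<open>S\<close>.\<close>

definition characters :: "('a::field, 'n::finite) mat set \<Rightarrow> ('a, 'n) character set" where
  "characters S = {\<eta> \<in> extensional S.
     (\<exists>p (k::nat). \<forall>g\<in>S. \<eta> g = pev p g / det g ^ k) \<and>
     (\<forall>g\<in>S. \<eta> g \<noteq> 0) \<and> (\<forall>g\<in>S. \<forall>h\<in>S. \<eta> (g ** h) = \<eta> g * \<eta> h)}"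

definition char_mult :: "('a::field, 'n::finite) mat set \<Rightarrow> ('a, 'n) character \<Rightarrow> ('a, 'n) character \<Rightarrow> ('a, 'n) character" where
  "char_mult T \<eta> \<psi> = (\<lambda>t\<in>T. \<eta> t * \<psi> t)"
definition char_inv :: "('a::field, 'n::finite) mat set \<Rightarrow> ('a, 'n) character \<Rightarrow> ('a, 'n) character" where
  "char_inv T \<eta> = (\<lambda>t\<in>T. inverse (\<eta> t))"

text \<open>Rationality over the ground field \<open>'a\<close> (Borel): the vanishing ideal over the algebraic closure
  is generated by polynomials with coefficients in \<open>'a\<close>.\<close>

definition defined_over_base :: "('a::field alg_closure, 'n::finite) mat set \<Rightarrow> bool" where
  "defined_over_base S \<longleftrightarrow>
     vanishing S = Modules.module.span (*)
       {Poly_Mapping.map to_ac p | p. Poly_Mapping.map to_ac p \<in> vanishing S}"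

definition rational_points :: "('a::field alg_closure, 'n::finite) mat set \<Rightarrow> ('a, 'n) mat set" where
  "rational_points S = {g. map_matrix to_ac g \<in> S}"

definition characters_over_base ::
  "('a::field alg_closure, 'n::finite) mat set \<Rightarrow> ('a alg_closure, 'n) character set" where
  "characters_over_base S = {\<eta> \<in> characters S.
     \<exists>(p :: ('n, 'a) mpol) (k::nat). \<forall>g\<in>S. \<eta> g = pev (Poly_Mapping.map to_ac p) g / det g ^ k}"

definition split_maximal_torus ::
  "('a::field alg_closure, 'n::finite) mat set \<Rightarrow> ('a alg_closure, 'n) mat set \<Rightarrow> bool" where
  "split_maximal_torus T S \<longleftrightarrow>
     maximal_torus T S \<and> defined_over_base T \<and> characters T = characters_over_base T"

definition split_connected_reductive :: "('a::field alg_closure, 'n::finite) mat set \<Rightarrow> bool" where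
  "split_connected_reductive S \<longleftrightarrow>
     connected_reductive S \<and> defined_over_base S \<and> (\<exists>T. split_maximal_torus T S)"

text \<open>The Lie algebra as tangent space at 1: the coefficient of \<open>\<epsilon>\<close> in \<open>f (1 + \<epsilon> Y)\<close> vanishes for
  every \<open>f\<close> in the ideal.\<close>

definition lie_algebra :: "('a::field, 'n::finite) mat set \<Rightarrow> ('a, 'n) mat set" where
  "lie_algebra S = {Y. \<forall>f\<in>vanishing S. Polynomial.coeff
     (pev (Poly_Mapping.map (\<lambda>c. [:c:]) f) (\<chi> i j. [:(mat 1 :: ('a, 'n) mat) $ i $ j, Y $ i $ j:])) 1 = 0}"

definition roots ::
  "('a::field, 'n::finite) mat set \<Rightarrow> ('a, 'n) mat set \<Rightarrow> ('a, 'n) character set" where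
  "roots S T = {\<alpha> \<in> characters T. (\<exists>t\<in>T. \<alpha> t \<noteq> 1) \<and>
     (\<exists>Y\<in>lie_algebra S. Y \<noteq> 0 \<and>
        (\<forall>t\<in>T. t ** Y ** matrix_inv t = map_matrix ((*) (\<alpha> t)) Y))}"

text \<open>\<open>u\<close> is an isomorphism of the additive group onto a closed subgroup of \<open>S\<close> on which the torus acts
  through \<open>\<alpha>\<close>. It is unique up to rescaling the argument, so the union in \<open>root_subgroup\<close> is a
  single group.\<close>

definition root_hom ::
  "('a::field, 'n::finite) mat set \<Rightarrow> ('a, 'n) mat set \<Rightarrow> ('a, 'n) character \<Rightarrow> ('a \<Rightarrow> ('a, 'n) mat) \<Rightarrow> bool" where
  "root_hom S T \<alpha> u \<longleftrightarrow>
     range u \<subseteq> S \<and> (\<forall>a b. u (a + b) = u a ** u b) \<and>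
     (\<exists>P :: ('a Polynomial.poly, 'n) mat. \<forall>a. u a = map_matrix (\<lambda>p. Polynomial.poly p a) P) \<and>
     (\<exists>q (k::nat). \<forall>a. pev q (u a) / det (u a) ^ k = a) \<and>
     (\<forall>t\<in>T. \<forall>a. t ** u a ** matrix_inv t = u (\<alpha> t * a))"

definition root_subgroup ::
  "('a::field, 'n::finite) mat set \<Rightarrow> ('a, 'n) mat set \<Rightarrow> ('a, 'n) character \<Rightarrow> ('a, 'n) mat set" where
  "root_subgroup S T \<alpha> = (\<Union>u\<in>{u. root_hom S T \<alpha> u}. range u)"


section \<open>Locally compact nonarchimedean fields\<close>

locale nonarch_local_field =
  fixes absv :: "'f::field \<Rightarrow> real" and \<pi> :: 'f and res :: "'f \<Rightarrow> 'r::{field, finite}"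
  assumes absv_nonneg: "absv x \<ge> 0"
    and absv_eq_0_iff: "absv x = 0 \<longleftrightarrow> x = 0"
    and absv_mult: "absv (x * y) = absv x * absv y"
    and absv_add: "absv (x + y) \<le> max (absv x) (absv y)"
    and locally_compact:
      "locally_compact_space (Metric_space.mtopology UNIV (\<lambda>x y. absv (x - y)))"
    and prime_element: "0 < absv \<pi>" "absv \<pi> < 1" "absv x < 1 \<Longrightarrow> absv x \<le> absv \<pi>"
    \<comment> \<open>\<open>res\<close> identifies the residue field with \<open>'r\<close>; its values outside the valuation ring are junk.\<close>
    and res_add: "absv x \<le> 1 \<Longrightarrow> absv y \<le> 1 \<Longrightarrow> res (x + y) = res x + res y"
    and res_mult: "absv x \<le> 1 \<Longrightarrow> absv y \<le> 1 \<Longrightarrow> res (x * y) = res x * res y"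
    and res_1: "res 1 = 1"
    and res_eq_0_iff: "absv x \<le> 1 \<Longrightarrow> res x = 0 \<longleftrightarrow> absv x < 1"
    and res_surj: "res ` {x. absv x \<le> 1} = UNIV"

definition val :: "('f \<Rightarrow> real) \<Rightarrow> 'f \<Rightarrow> 'f \<Rightarrow> real" where
  "val absv \<pi> c = ln (absv c) / ln (absv \<pi>)"

definition mat_topology :: "('f::field \<Rightarrow> real) \<Rightarrow> ('f, 'n::finite) mat set \<Rightarrow> ('f, 'n) mat topology" where
  "mat_topology absv S = Metric_space.mtopology S
     (\<lambda>g h. Max (range (\<lambda>(i, j). absv (g $ i $ j - h $ i $ j))))"


section \<open>The semisimple Bruhat--Tits building of a split group\<close>

text \<open>
  The construction follows Tits (Corvallis). Let \<open>T\<close> be a split maximal torus of \<open>GG\<close>. A point of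
  the real vector space \<open>X\<^sub>*(T) \<otimes> \<real>\<close> modulo the common kernel of the roots is recorded by the
  values of the roots on it. The standard apartment is this space with an affine action \<open>\<nu>\<close>
  of the normalizer of the torus; \<open>\<nu>\<close> is unique up to a unique translation.
\<close>

type_synonym ('f, 'n) apt_point = "('f alg_closure, 'n) character \<Rightarrow> real"
type_synonym ('f, 'n) apt_action = "('f, 'n) mat \<Rightarrow> ('f, 'n) apt_point \<Rightarrow> ('f, 'n) apt_point"

definition apartment ::
  "('f::field alg_closure, 'n::finite) mat set \<Rightarrow> ('f alg_closure, 'n) mat set \<Rightarrow> ('f, 'n) apt_point set" where
  "apartment GG T = {x \<in> extensional (roots GG T). \<exists>\<xi> :: _ \<Rightarrow> real.
     (\<forall>\<eta>\<in>characters T. \<forall>\<psi>\<in>characters T. \<xi> (char_mult T \<eta> \<psi>) = \<xi> \<eta> + \<xi> \<psi>) \<and>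
     (\<forall>\<alpha>\<in>roots GG T. x \<alpha> = \<xi> \<alpha>)}"

definition torus_normalizer ::
  "('f::field alg_closure, 'n::finite) mat set \<Rightarrow> ('f alg_closure, 'n) mat set \<Rightarrow> ('f, 'n) mat set" where
  "torus_normalizer GG T = {n \<in> rational_points GG.
     (\<lambda>t. map_matrix to_ac n ** t ** matrix_inv (map_matrix to_ac n)) ` T = T}"

definition conj_char ::
  "('f::field alg_closure, 'n::finite) mat set \<Rightarrow> ('f, 'n) mat \<Rightarrow> ('f alg_closure, 'n) character \<Rightarrow> ('f alg_closure, 'n) character" where
  "conj_char T n \<alpha> =
     (\<lambda>t\<in>T. \<alpha> (matrix_inv (map_matrix to_ac n) ** t ** map_matrix to_ac n))"

text \<open>The linear part of \<open>\<nu> n\<close> is the Weyl group action, and the rational points of the torus act by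
  the translations \<open>\<nu>(t)\<close> with \<open>\<eta>(\<nu>(t)) = - val (\<eta> t)\<close>.\<close>

definition apartment_action ::
  "('f \<Rightarrow> real) \<Rightarrow> 'f \<Rightarrow> ('f::field alg_closure, 'n::finite) mat set \<Rightarrow> ('f alg_closure, 'n) mat set \<Rightarrow> ('f, 'n) apt_action \<Rightarrow> bool" where
  "apartment_action absv \<pi> GG T \<nu> \<longleftrightarrow>
     (\<forall>n\<in>torus_normalizer GG T. \<forall>x\<in>apartment GG T. \<nu> n x \<in> apartment GG T) \<and>
     (\<forall>x\<in>apartment GG T. \<nu> (mat 1) x = x) \<and>
     (\<forall>n\<in>torus_normalizer GG T. \<forall>n'\<in>torus_normalizer GG T. \<forall>x\<in>apartment GG T.
        \<nu> (n ** n') x = \<nu> n (\<nu> n' x)) \<and>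
     (\<forall>n\<in>torus_normalizer GG T. \<forall>x\<in>apartment GG T. \<forall>y\<in>apartment GG T. \<forall>\<alpha>\<in>roots GG T.
        \<nu> n x (conj_char T n \<alpha>) - \<nu> n y (conj_char T n \<alpha>) = x \<alpha> - y \<alpha>) \<and>
     (\<forall>t\<in>rational_points T. \<forall>x\<in>apartment GG T. \<forall>\<alpha>\<in>roots GG T. \<forall>c.
        \<alpha> (map_matrix to_ac t) = to_ac c \<longrightarrow> \<nu> t x \<alpha> = x \<alpha> - val absv \<pi> c)"

definition root_group ::
  "('f::field alg_closure, 'n::finite) mat set \<Rightarrow> ('f alg_closure, 'n) mat set \<Rightarrow> ('f alg_closure, 'n) character \<Rightarrow> ('f, 'n) mat set" where
  "root_group GG T \<alpha> = rational_points (root_subgroup GG T \<alpha>)"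

text \<open>For \<open>u \<noteq> 1\<close> in the root group of \<open>\<alpha>\<close> there is a unique \<open>m\<close> in the normalizer of the torus
  of the form \<open>u' u u''\<close> with \<open>u', u''\<close> in the root group of \<open>-\<alpha>\<close>; it acts on the apartment as a
  reflection. The affine root attached to \<open>u\<close> has gradient \<open>\<alpha>\<close> and vanishes on the fixed
  hyperplane of that reflection.\<close>

definition affine_root ::
  "('f::field alg_closure, 'n::finite) mat set \<Rightarrow> ('f alg_closure, 'n) mat set \<Rightarrow> ('f, 'n) apt_action \<Rightarrow>
     ('f alg_closure, 'n) character \<Rightarrow> ('f, 'n) mat \<Rightarrow> ('f, 'n) apt_point \<Rightarrow> real" where
  "affine_root GG T \<nu> \<alpha> u x = (THE r :: real. \<exists>u'\<in>root_group GG T (char_inv T \<alpha>).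
     \<exists>u''\<in>root_group GG T (char_inv T \<alpha>). \<exists>y\<in>apartment GG T.
       u' ** u ** u'' \<in> torus_normalizer GG T \<and> \<nu> (u' ** u ** u'') y = y \<and> r = x \<alpha> - y \<alpha>)"

definition affine_roots ::
  "('f::field alg_closure, 'n::finite) mat set \<Rightarrow> ('f alg_closure, 'n) mat set \<Rightarrow> ('f, 'n) apt_action \<Rightarrow> ('f alg_closure, 'n) character set \<Rightarrow>
     (('f, 'n) apt_point \<Rightarrow> real) set" where
  "affine_roots GG T \<nu> A =
     {affine_root GG T \<nu> \<alpha> u | \<alpha> u. \<alpha> \<in> A \<and> u \<in> root_group GG T \<alpha> - {mat 1}}"

text \<open>The group generated by the \<open>u\<close> whose affine root is nonnegative at \<open>x\<close>.\<close>

definition point_group ::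
  "('f::field alg_closure, 'n::finite) mat set \<Rightarrow> ('f alg_closure, 'n) mat set \<Rightarrow> ('f, 'n) apt_action \<Rightarrow> ('f, 'n) apt_point \<Rightarrow> ('f, 'n) mat set" where
  "point_group GG T \<nu> x = generate GLn
     {u. \<exists>\<alpha>\<in>roots GG T. u \<in> root_group GG T \<alpha> - {mat 1} \<and> affine_root GG T \<nu> \<alpha> u x \<ge> 0}"

definition building_rel ::
  "('f::field alg_closure, 'n::finite) mat set \<Rightarrow> ('f alg_closure, 'n) mat set \<Rightarrow> ('f, 'n) apt_action \<Rightarrow>
     ((('f, 'n) mat \<times> ('f, 'n) apt_point) \<times> (('f, 'n) mat \<times> ('f, 'n) apt_point)) set" where
  "building_rel GG T \<nu> = {((g, x), (h, y)).
     g \<in> rational_points GG \<and> h \<in> rational_points GG \<and> x \<in> apartment GG T \<and> y \<in> apartment GG T \<and>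
     (\<exists>n\<in>torus_normalizer GG T. y = \<nu> n x \<and> matrix_inv g ** h ** n \<in> point_group GG T \<nu> x)}"

text \<open>The point of the building, a class of pairs, represented by \<open>(g, x)\<close>.\<close>

definition building_point ::
  "('f::field alg_closure, 'n::finite) mat set \<Rightarrow> ('f alg_closure, 'n) mat set \<Rightarrow> ('f, 'n) apt_action \<Rightarrow>
     ('f, 'n) mat \<Rightarrow> ('f, 'n) apt_point \<Rightarrow> (('f, 'n) mat \<times> ('f, 'n) apt_point) set" where
  "building_point GG T \<nu> g x = building_rel GG T \<nu> `` {(g, x)}"

definition building_act :: "('f::field, 'n::finite) mat \<Rightarrow> (('f, 'n) mat \<times> 'x) set \<Rightarrow> (('f, 'n) mat \<times> 'x) set" where
  "building_act g b = (\<lambda>(h, x). (g ** h, x)) ` b"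

definition apartment_chamber ::
  "('f::field alg_closure, 'n::finite) mat set \<Rightarrow> ('f alg_closure, 'n) mat set \<Rightarrow> ('f, 'n) apt_action \<Rightarrow> ('f, 'n) apt_point set \<Rightarrow> bool" where
  "apartment_chamber GG T \<nu> D \<longleftrightarrow> (\<exists>x\<in>apartment GG T.
     (\<forall>\<psi>\<in>affine_roots GG T \<nu> (roots GG T). \<psi> x \<noteq> 0) \<and>
     D = {y \<in> apartment GG T. \<forall>\<psi>\<in>affine_roots GG T \<nu> (roots GG T). sgn (\<psi> y) = sgn (\<psi> x)})"

definition chamber_closure ::
  "('f::field alg_closure, 'n::finite) mat set \<Rightarrow> ('f alg_closure, 'n) mat set \<Rightarrow> ('f, 'n) apt_action \<Rightarrow> ('f, 'n) apt_point set \<Rightarrow> ('f, 'n) apt_point set" where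
  "chamber_closure GG T \<nu> D = {y \<in> apartment GG T.
     \<forall>\<psi>\<in>affine_roots GG T \<nu> (roots GG T). (\<forall>x\<in>D. \<psi> x > 0) \<longrightarrow> \<psi> y \<ge> 0}"

text \<open>Special points: through \<open>x\<close> there passes a wall in each root direction. Since the group is
  split, the affine roots in the direction \<open>\<alpha>\<close> do not change under unramified extensions, so special
  and hyperspecial points coincide; they are vertices of the semisimple building.\<close>

definition hyperspecial_in_apartment ::
  "('f::field alg_closure, 'n::finite) mat set \<Rightarrow> ('f alg_closure, 'n) mat set \<Rightarrow> ('f, 'n) apt_action \<Rightarrow> ('f, 'n) apt_point \<Rightarrow> bool" where
  "hyperspecial_in_apartment GG T \<nu> x \<longleftrightarrow> x \<in> apartment GG T \<and>
     (\<forall>\<alpha>\<in>roots GG T. \<exists>\<psi>\<in>affine_roots GG T \<nu> {\<alpha>}. \<psi> x = 0)"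

text \<open>\<open>C\<close> is a chamber of the building and \<open>x0\<close> a hyperspecial vertex of \<open>C\<close>.\<close>

definition chamber_with_hyperspecial_vertex ::
  "('f::field alg_closure, 'n::finite) mat set \<Rightarrow> ('f alg_closure, 'n) mat set \<Rightarrow> ('f, 'n) apt_action \<Rightarrow>
     (('f, 'n) mat \<times> ('f, 'n) apt_point) set set \<Rightarrow> (('f, 'n) mat \<times> ('f, 'n) apt_point) set \<Rightarrow> bool" where
  "chamber_with_hyperspecial_vertex GG T \<nu> C x0 \<longleftrightarrow>
     (\<exists>g\<in>rational_points GG. \<exists>D y. apartment_chamber GG T \<nu> D \<and>
        C = building_point GG T \<nu> g ` D \<and>
        hyperspecial_in_apartment GG T \<nu> y \<and> y \<in> chamber_closure GG T \<nu> D \<and>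
        x0 = building_point GG T \<nu> g y)"


section \<open>Integral models, the pro-p-Iwahori subgroup and its congruence subgroups\<close>

text \<open>
  A flat closed subgroup scheme of \<open>GL\<^sub>n\<close> over the valuation ring is the schematic closure of its
  generic fibre \<open>GG\<close>: its equations are the integral polynomials vanishing on \<open>GG\<close>. Every flat affine
  group scheme of finite type over a discrete valuation ring arises in this way.
\<close>

definition integral_equations ::
  "('f \<Rightarrow> real) \<Rightarrow> ('f::field alg_closure, 'n::finite) mat set \<Rightarrow> ('n, 'f) mpol set" where
  "integral_equations absv GG = {f. (\<forall>m. absv (Poly_Mapping.lookup f m) \<le> 1) \<and>
     Poly_Mapping.map to_ac f \<in> vanishing GG}"

definition special_equations ::
  "('f \<Rightarrow> real) \<Rightarrow> ('f \<Rightarrow> 'r::field) \<Rightarrow> ('f::field alg_closure, 'n::finite) mat set \<Rightarrow> ('n, 'r alg_closure) mpol set" where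
  "special_equations absv res GG =
     (\<lambda>f. Poly_Mapping.map (\<lambda>c. to_ac (res c)) f) ` integral_equations absv GG"

definition special_fibre ::
  "('f \<Rightarrow> real) \<Rightarrow> ('f \<Rightarrow> 'r::field) \<Rightarrow> ('f::field alg_closure, 'n::finite) mat set \<Rightarrow>
     ('r alg_closure, 'n) mat set" where
  "special_fibre absv res GG = {g. invertible g \<and> (\<forall>f\<in>special_equations absv res GG. pev f g = 0)}"

text \<open>Smoothness of the model: the scheme-theoretic special fibre is geometrically reduced, i.e. after
  inverting \<open>det\<close> the reduced equations generate the full vanishing ideal of its points.\<close>

definition smooth_model ::
  "('f \<Rightarrow> real) \<Rightarrow> ('f \<Rightarrow> 'r::field) \<Rightarrow> ('f::field alg_closure, 'n::finite) mat set \<Rightarrow> bool" where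
  "smooth_model absv res GG \<longleftrightarrow> (\<forall>f\<in>vanishing (special_fibre absv res GG). \<exists>k::nat.
     f * det_poly ^ k \<in> Modules.module.span (*) (special_equations absv res GG))"

definition integral_points ::
  "('f \<Rightarrow> real) \<Rightarrow> ('f::field alg_closure, 'n::finite) mat set \<Rightarrow> ('f, 'n) mat set" where
  "integral_points absv GG = {g \<in> rational_points GG.
     \<forall>i j. absv (g $ i $ j) \<le> 1 \<and> absv (matrix_inv g $ i $ j) \<le> 1}"

definition reduction_preimage ::
  "('f \<Rightarrow> real) \<Rightarrow> ('f \<Rightarrow> 'r::field) \<Rightarrow> ('f::field alg_closure, 'n::finite) mat set \<Rightarrow>
     ('r alg_closure, 'n) mat set \<Rightarrow> ('f, 'n) mat set" where
  "reduction_preimage absv res GG S =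
     {g \<in> integral_points absv GG. map_matrix res g \<in> rational_points S}"

text \<open>The kernel of reduction modulo \<open>\<pi>\<^sup>m\<close>.\<close>

definition congruence_subgroup ::
  "('f \<Rightarrow> real) \<Rightarrow> 'f \<Rightarrow> ('f::field alg_closure, 'n::finite) mat set \<Rightarrow> nat \<Rightarrow> ('f, 'n) mat set" where
  "congruence_subgroup absv \<pi> GG m = {g \<in> integral_points absv GG.
     \<forall>i j. absv (g $ i $ j - (mat 1 :: ('f, 'n) mat) $ i $ j) \<le> absv (\<pi> ^ m)}"

text \<open>The elements on which all rational characters of the group take unit values. The stabilizer of a
  point of the semisimple building also contains the center, so it has to be cut down by this group
  to become bounded.\<close>

definition norm_one_points ::
  "('f \<Rightarrow> real) \<Rightarrow> ('f::field alg_closure, 'n::finite) mat set \<Rightarrow> ('f, 'n) mat set" where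
  "norm_one_points absv GG = {g \<in> rational_points GG. \<forall>\<eta>\<in>characters_over_base GG. \<forall>c.
     \<eta> (map_matrix to_ac g) = to_ac c \<longrightarrow> absv c = 1}"

text \<open>
  The locale fixes the field, the split group \<open>GG\<close>, a split maximal torus with its apartment
  (used to construct the building), a chamber \<open>C\<close>, a hyperspecial vertex \<open>x0\<close> of \<open>C\<close>, and the
  Borel subgroup \<open>BB\<close> (with unipotent radical \<open>NN\<close>) of the special fibre. The embedding
  \<open>GG \<subseteq> GL\<^sub>n\<close> is chosen to extend to a closed embedding over the valuation ring of the Bruhat--Tits
  group scheme of \<open>x0\<close>. That scheme is the smooth model with connected special fibre whose group of
  integral points is the stabilizer of \<open>x0\<close> among the norm one points.
\<close>

locale pro_p_iwahori_setting = nonarch_local_field absv \<pi> res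
  for absv :: "'f::field \<Rightarrow> real" and \<pi> :: 'f and res :: "'f \<Rightarrow> 'r::{field, finite}" +
  fixes GG T :: "('f alg_closure, 'n::finite) mat set"
    and \<nu> :: "('f, 'n) apt_action"
    and C :: "(('f, 'n) mat \<times> ('f, 'n) apt_point) set set" and x0 :: "(('f, 'n) mat \<times> ('f, 'n) apt_point) set"
    and BB NN :: "('r alg_closure, 'n) mat set"
  assumes reductive: "connected_reductive GG" "defined_over_base GG"
    and split: "split_maximal_torus T GG"
    and action: "apartment_action absv \<pi> GG T \<nu>"
    and chamber_vertex: "chamber_with_hyperspecial_vertex GG T \<nu> C x0"
    and model: "smooth_model absv res GG" "split_connected_reductive (special_fibre absv res GG)"
    and model_x0: "integral_points absv GG = {g \<in> norm_one_points absv GG. building_act g x0 = x0}"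
    and borel: "borel_subgroup BB (special_fibre absv res GG)" "defined_over_base BB"
    and iwahori: "{g \<in> integral_points absv GG. \<forall>c\<in>C. building_act g c = c} =
      reduction_preimage absv res GG BB"
    and radical: "unipotent_radical NN BB"

definition rational_group :: "('f::field alg_closure, 'n::finite) mat set \<Rightarrow> ('f, 'n) mat monoid" where
  "rational_group GG = GLn\<lparr>carrier := rational_points GG\<rparr>"


section \<open>The universal module and the Hecke algebra\<close>

text \<open>\<open>I\<close> is open in the applications, so \<open>G/I\<close> is discrete and compact support is finite support.
  Functions on \<open>G/I\<close> are extended by zero.\<close>

definition univ_mod :: "('g, 's) monoid_scheme \<Rightarrow> 'g set \<Rightarrow> ('g set \<Rightarrow> 'k::field) set" where
  "univ_mod G I = {x. {c. x c \<noteq> 0} \<subseteq> lcosets\<^bsub>G\<^esub> I \<and> finite {c. x c \<noteq> 0}}"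

definition translate :: "('g, 's) monoid_scheme \<Rightarrow> 'g \<Rightarrow> ('g set \<Rightarrow> 'k::field) \<Rightarrow> ('g set \<Rightarrow> 'k)" where
  "translate G g x = (\<lambda>c. x (inv\<^bsub>G\<^esub> g <#\<^bsub>G\<^esub> c))"

definition fixed_vectors :: "('g, 's) monoid_scheme \<Rightarrow> 'g set \<Rightarrow> 'g set \<Rightarrow> ('g set \<Rightarrow> 'k::field) set" where
  "fixed_vectors G I L = {x \<in> univ_mod G I. \<forall>g\<in>L. translate G g x = x}"

type_synonym ('g, 'k) hecke = "('g set \<Rightarrow> 'k) \<Rightarrow> ('g set \<Rightarrow> 'k)"

text \<open>The opposite of the endomorphism ring: \<open>h h'\<close> is \<open>h' \<circ> h\<close>, so that \<open>x h = h x\<close> defines the right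
  action on the universal module. Endomorphisms are extensional functions.\<close>

definition hecke_algebra :: "('g, 's) monoid_scheme \<Rightarrow> 'g set \<Rightarrow> ('g, 'k::field) hecke ring" where
  "hecke_algebra G I = \<lparr>
     carrier = {h \<in> univ_mod G I \<rightarrow>\<^sub>E univ_mod G I.
       (\<forall>x\<in>univ_mod G I. \<forall>y\<in>univ_mod G I. h (\<lambda>c. x c + y c) = (\<lambda>c. h x c + h y c)) \<and>
       (\<forall>a. \<forall>x\<in>univ_mod G I. h (\<lambda>c. a * x c) = (\<lambda>c. a * h x c)) \<and>
       (\<forall>g\<in>carrier G. \<forall>x\<in>univ_mod G I. h (translate G g x) = translate G g (h x))},
     monoid.mult = (\<lambda>h h'. \<lambda>x\<in>univ_mod G I. h' (h x)),
     one = (\<lambda>x\<in>univ_mod G I. x),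
     ring.zero = (\<lambda>x\<in>univ_mod G I. \<lambda>c. 0),
     add = (\<lambda>h h'. \<lambda>x\<in>univ_mod G I. \<lambda>c. h x c + h' x c)\<rparr>"

definition hecke_scalar :: "('g, 's) monoid_scheme \<Rightarrow> 'g set \<Rightarrow> 'k::field \<Rightarrow> ('g, 'k) hecke" where
  "hecke_scalar G I a = (\<lambda>x\<in>univ_mod G I. \<lambda>c. a * x c)"

text \<open>The library locale \<open>module\<close> requires a commutative ring; only its record type is used here. The
  ring fields \<open>mult\<close> and \<open>one\<close> of the record play no role for modules.\<close>

locale left_module = R: ring R + M: abelian_group M
  for R :: "('a, 's) ring_scheme" (structure) and M :: "('a, 'b, 't) module_scheme" +
  assumes smult_closed: "a \<in> carrier R \<Longrightarrow> x \<in> carrier M \<Longrightarrow> a \<odot>\<^bsub>M\<^esub> x \<in> carrier M"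
    and smult_l_distr: "a \<in> carrier R \<Longrightarrow> b \<in> carrier R \<Longrightarrow> x \<in> carrier M \<Longrightarrow>
      (a \<oplus> b) \<odot>\<^bsub>M\<^esub> x = a \<odot>\<^bsub>M\<^esub> x \<oplus>\<^bsub>M\<^esub> b \<odot>\<^bsub>M\<^esub> x"
    and smult_r_distr: "a \<in> carrier R \<Longrightarrow> x \<in> carrier M \<Longrightarrow> y \<in> carrier M \<Longrightarrow>
      a \<odot>\<^bsub>M\<^esub> (x \<oplus>\<^bsub>M\<^esub> y) = a \<odot>\<^bsub>M\<^esub> x \<oplus>\<^bsub>M\<^esub> a \<odot>\<^bsub>M\<^esub> y"
    and smult_assoc: "a \<in> carrier R \<Longrightarrow> b \<in> carrier R \<Longrightarrow> x \<in> carrier M \<Longrightarrow>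
      (a \<otimes> b) \<odot>\<^bsub>M\<^esub> x = a \<odot>\<^bsub>M\<^esub> (b \<odot>\<^bsub>M\<^esub> x)"
    and smult_one: "x \<in> carrier M \<Longrightarrow> \<one> \<odot>\<^bsub>M\<^esub> x = x"

definition left_hom ::
  "('a, 's) ring_scheme \<Rightarrow> ('a, 'b, 't) module_scheme \<Rightarrow> ('a, 'c, 'u) module_scheme \<Rightarrow> ('b \<Rightarrow> 'c) set" where
  "left_hom R M N = {f \<in> carrier M \<rightarrow>\<^sub>E carrier N.
     (\<forall>x\<in>carrier M. \<forall>y\<in>carrier M. f (x \<oplus>\<^bsub>M\<^esub> y) = f x \<oplus>\<^bsub>N\<^esub> f y) \<and>
     (\<forall>a\<in>carrier R. \<forall>x\<in>carrier M. f (a \<odot>\<^bsub>M\<^esub> x) = a \<odot>\<^bsub>N\<^esub> f x)}"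

text \<open>The dual \<open>Hom\<^sub>H(Y, H)\<close> of a right submodule \<open>Y\<close> of the universal module, as a left module.\<close>

definition dual :: "('g, 's) monoid_scheme \<Rightarrow> 'g set \<Rightarrow> ('g set \<Rightarrow> 'k::field) set \<Rightarrow>
    (('g, 'k) hecke, ('g set \<Rightarrow> 'k) \<Rightarrow> ('g, 'k) hecke) module" where
  "dual G I Y = (let H = hecke_algebra G I in \<lparr>
     carrier = {l \<in> Y \<rightarrow>\<^sub>E carrier H.
       (\<forall>x\<in>Y. \<forall>y\<in>Y. l (\<lambda>c. x c + y c) = l x \<oplus>\<^bsub>H\<^esub> l y) \<and>
       (\<forall>x\<in>Y. \<forall>h\<in>carrier H. l (h x) = l x \<otimes>\<^bsub>H\<^esub> h)},
     monoid.mult = undefined, one = undefined,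
     ring.zero = (\<lambda>x\<in>Y. \<zero>\<^bsub>H\<^esub>),
     add = (\<lambda>l l'. \<lambda>x\<in>Y. l x \<oplus>\<^bsub>H\<^esub> l' x),
     smult = (\<lambda>h l. \<lambda>x\<in>Y. h \<otimes>\<^bsub>H\<^esub> l x)\<rparr>)"

text \<open>The right action \<open>(l g)(x) = l (g x)\<close>.\<close>

definition dual_act :: "('g, 's) monoid_scheme \<Rightarrow> ('g set \<Rightarrow> 'k::field) set \<Rightarrow> 'g \<Rightarrow>
    (('g set \<Rightarrow> 'k) \<Rightarrow> ('g, 'k) hecke) \<Rightarrow> (('g set \<Rightarrow> 'k) \<Rightarrow> ('g, 'k) hecke)" where
  "dual_act G Y g l = (\<lambda>x\<in>Y. l (translate G g x))"


section \<open>The modules Z\<open>\<^sub>m\<close>\<close>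

definition coinv_rel :: "('v, 's) monoid_scheme \<Rightarrow> 'g set \<Rightarrow> ('g \<Rightarrow> 'v \<Rightarrow> 'v) \<Rightarrow> 'v set" where
  "coinv_rel A J act = generate A {act i l \<otimes>\<^bsub>A\<^esub> inv\<^bsub>A\<^esub> l | i l. i \<in> J \<and> l \<in> carrier A}"

definition coinvariants :: "('v, 's) monoid_scheme \<Rightarrow> 'g set \<Rightarrow> ('g \<Rightarrow> 'v \<Rightarrow> 'v) \<Rightarrow> 'v set monoid" where
  "coinvariants A J act = A Mod coinv_rel A J act"

definition Z_bold :: "('g, 's) monoid_scheme \<Rightarrow> 'g set \<Rightarrow> 'g set \<Rightarrow>
    (('g, 'k::field) hecke, ('g set \<Rightarrow> 'k) \<Rightarrow> ('g, 'k) hecke) module" where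
  "Z_bold G I Km = (let Y = fixed_vectors G I Km in
     (dual G I Y)\<lparr>carrier := (\<lambda>l. restrict l Y) ` carrier (dual G I (univ_mod G I))\<rparr>)"

definition Z_bold_coinv :: "('g, 's) monoid_scheme \<Rightarrow> 'g set \<Rightarrow> 'g set \<Rightarrow>
    (('g set \<Rightarrow> 'k::field) \<Rightarrow> ('g, 'k) hecke) set monoid" where
  "Z_bold_coinv G I Km =
     coinvariants (add_monoid (Z_bold G I Km)) I (dual_act G (fixed_vectors G I Km))"

text \<open>The kernel of the composite of the map of coinvariants induced by the inclusion (a coset is sent
  to the coset containing it) and the restriction to the \<open>I\<close>-fixed vectors. The target is left
  as the dual of the \<open>I\<close>-fixed vectors instead of being identified with the Hecke algebra.\<close>

definition Z_mod :: "('g, 's) monoid_scheme \<Rightarrow> 'g set \<Rightarrow> 'g set \<Rightarrow>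
    (('g set \<Rightarrow> 'k::field) \<Rightarrow> ('g, 'k) hecke) set set" where
  "Z_mod G I Km =
     (let Y = fixed_vectors G I Km; D = add_monoid (dual G I Y); YI = fixed_vectors G I I;
          incl = (\<lambda>A. A <#>\<^bsub>D\<^esub> coinv_rel D I (dual_act G Y));
          restr = (\<lambda>A. the_elem ((\<lambda>l. restrict l YI) ` A))
      in kernel (Z_bold_coinv G I Km) (add_monoid (dual G I YI)) (restr \<circ> incl))"


section \<open>Smooth representations and the functor t\<close>

record ('k, 'v, 'g) rep = "('k, 'v) module" +
  act :: "'g \<Rightarrow> 'v \<Rightarrow> 'v"

definition smooth_rep :: "'g topology \<Rightarrow> ('g, 's) monoid_scheme \<Rightarrow> ('k::field, 'v, 'g) rep \<Rightarrow> bool" where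
  "smooth_rep tg G V \<longleftrightarrow> module (ring_of_type_algebra :: 'k ring) V \<and>
     (\<forall>g\<in>carrier G. act V g \<in> left_hom (ring_of_type_algebra :: 'k ring) V V) \<and>
     (\<forall>v\<in>carrier V. act V \<one>\<^bsub>G\<^esub> v = v) \<and>
     (\<forall>g\<in>carrier G. \<forall>h\<in>carrier G. \<forall>v\<in>carrier V. act V (g \<otimes>\<^bsub>G\<^esub> h) v = act V g (act V h v)) \<and>
     (\<forall>v\<in>carrier V. openin tg {g \<in> carrier G. act V g v = v})"

definition generated_by_fixed :: "('g, 's) monoid_scheme \<Rightarrow> 'g set \<Rightarrow> ('k::field, 'v, 'g) rep \<Rightarrow> bool" where
  "generated_by_fixed G I V \<longleftrightarrow>
     (\<forall>W. submodule W (ring_of_type_algebra :: 'k ring) V \<and>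
          (\<forall>g\<in>carrier G. \<forall>w\<in>W. act V g w \<in> W) \<and>
          {v \<in> carrier V. \<forall>g\<in>I. act V g v = v} \<subseteq> W \<longrightarrow> W = carrier V)"

definition rep_hom ::
  "('g, 's) monoid_scheme \<Rightarrow> ('k::field, 'v, 'g) rep \<Rightarrow> ('k, 'w, 'g) rep \<Rightarrow> ('v \<Rightarrow> 'w) set" where
  "rep_hom G V W = {f \<in> left_hom (ring_of_type_algebra :: 'k ring) V W.
     \<forall>g\<in>carrier G. \<forall>v\<in>carrier V. f (act V g v) = act W g (f v)}"

definition tensor_rel :: "('g, 's) monoid_scheme \<Rightarrow> 'g set \<Rightarrow> (('g, 'k::field) hecke, 'm) module \<Rightarrow>
    (('g set \<Rightarrow> 'k) \<times> 'm \<Rightarrow>\<^sub>0 int) set" where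
  "tensor_rel G I M = (let XX = univ_mod G I; F = free_Abelian_group (XX \<times> carrier M);
       e = (\<lambda>x m. Poly_Mapping.single (x, m) (1::int))
     in generate F
       ({e (\<lambda>c. x c + y c) m - e x m - e y m | x y m. x \<in> XX \<and> y \<in> XX \<and> m \<in> carrier M} \<union>
        {e x (m \<oplus>\<^bsub>M\<^esub> m') - e x m - e x m' | x m m'. x \<in> XX \<and> m \<in> carrier M \<and> m' \<in> carrier M} \<union>
        {e (h x) m - e x (h \<odot>\<^bsub>M\<^esub> m) | h x m.
           h \<in> carrier (hecke_algebra G I) \<and> x \<in> XX \<and> m \<in> carrier M}))"

definition tensor :: "('g, 's) monoid_scheme \<Rightarrow> 'g set \<Rightarrow> (('g, 'k::field) hecke, 'm) module \<Rightarrow>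
    (('g set \<Rightarrow> 'k) \<times> 'm \<Rightarrow>\<^sub>0 int) set monoid" where
  "tensor G I M = free_Abelian_group (univ_mod G I \<times> carrier M) Mod tensor_rel G I M"

text \<open>\<open>tau_free\<close> is the additive extension of \<open>(x, m) \<mapsto> [l \<mapsto> l(x) m]\<close> to the free abelian group;
  \<open>tau\<close> is the induced map on its quotient, the tensor product.\<close>

definition tau_free :: "('g, 's) monoid_scheme \<Rightarrow> 'g set \<Rightarrow> (('g, 'k::field) hecke, 'm) module \<Rightarrow>
    (('g set \<Rightarrow> 'k) \<times> 'm \<Rightarrow>\<^sub>0 int) \<Rightarrow> (('g set \<Rightarrow> 'k) \<Rightarrow> ('g, 'k) hecke) \<Rightarrow> 'm" where
  "tau_free G I M z = (\<lambda>l\<in>carrier (dual G I (univ_mod G I)).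
     \<Oplus>\<^bsub>M\<^esub>xm\<in>Poly_Mapping.keys z. [Poly_Mapping.lookup z xm] \<cdot>\<^bsub>M\<^esub> (l (fst xm) \<odot>\<^bsub>M\<^esub> snd xm))"

definition tau :: "('g, 's) monoid_scheme \<Rightarrow> 'g set \<Rightarrow> (('g, 'k::field) hecke, 'm) module \<Rightarrow>
    (('g set \<Rightarrow> 'k) \<times> 'm \<Rightarrow>\<^sub>0 int) set \<Rightarrow> (('g set \<Rightarrow> 'k) \<Rightarrow> ('g, 'k) hecke) \<Rightarrow> 'm" where
  "tau G I M A = the_elem (tau_free G I M ` A)"

text \<open>The image of \<open>tau\<close> in \<open>Hom\<^sub>H(X*, M)\<close>, with \<open>(g \<phi>)(l) = \<phi> (l g)\<close>; scalars act through the
  Hecke algebra.\<close>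

definition t_obj :: "('g, 's) monoid_scheme \<Rightarrow> 'g set \<Rightarrow> (('g, 'k::field) hecke, 'm) module \<Rightarrow>
    ('k, (('g set \<Rightarrow> 'k) \<Rightarrow> ('g, 'k) hecke) \<Rightarrow> 'm, 'g) rep" where
  "t_obj G I M = (let XX = univ_mod G I; D = carrier (dual G I XX);
       U = tau G I M ` carrier (tensor G I M) in \<lparr>
     carrier = U,
     monoid.mult = undefined, one = undefined,
     ring.zero = (\<lambda>l\<in>D. \<zero>\<^bsub>M\<^esub>),
     add = (\<lambda>\<phi> \<psi>. \<lambda>l\<in>D. \<phi> l \<oplus>\<^bsub>M\<^esub> \<psi> l),
     smult = (\<lambda>a \<phi>. \<lambda>l\<in>D. hecke_scalar G I a \<odot>\<^bsub>M\<^esub> \<phi> l),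
     act = (\<lambda>g. \<lambda>\<phi>\<in>U. \<lambda>l\<in>D. \<phi> (dual_act G XX g l))\<rparr>)"

text \<open>On morphisms the functor is the restriction of \<open>Hom\<^sub>H(X*, f)\<close>.\<close>

definition t_mor :: "('g, 's) monoid_scheme \<Rightarrow> 'g set \<Rightarrow> (('g, 'k::field) hecke, 'm) module \<Rightarrow> ('m \<Rightarrow> 'n) \<Rightarrow>
    ((('g set \<Rightarrow> 'k) \<Rightarrow> ('g, 'k) hecke) \<Rightarrow> 'm) \<Rightarrow> (('g set \<Rightarrow> 'k) \<Rightarrow> ('g, 'k) hecke) \<Rightarrow> 'n" where
  "t_mor G I M f = (\<lambda>\<phi>\<in>carrier (t_obj G I M).
     \<lambda>l\<in>carrier (dual G I (univ_mod G I)). f (\<phi> l))"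

end

theory Submission
  imports Defs "HOL-Algebra.Sylow"
begin

text \<open>
  Every quotient \<open>I/K\<^sub>m\<close> is finite, and an element of \<open>I\<close> whose \<open>l\<close>-th power lies in \<open>K\<^sub>m\<close>, for a prime \<open>l\<close>
  different from the residue characteristic, lies in \<open>K\<^sub>m\<close> itself: its reduction is unipotent, hence
  trivial, and then \<open>(1 + Z)\<^sup>l\<close> is \<open>1 + l Z\<close> up to smaller terms. By Cauchy's theorem the order of \<open>I/K\<^sub>m\<close>
  is invertible in \<open>k\<close>. So averaging over \<open>I\<close> is an \<open>H\<close>-linear projector of the universal module onto its
  \<open>I\<close>-fixed vectors, that is, onto \<open>H\<close>. Averaging makes \<open>I\<close>-coinvariants exact, which gives \<open>Z\<^sub>m = 0\<close>. The
  projector is an element \<open>e\<close> of \<open>X\<^sup>*\<close> with \<open>e(char\<^sub>I) = 1\<close>, and evaluation at \<open>e\<close> identifies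
  \<open>t(M)\<^sup>I\<close> with \<open>M\<close>. Since \<open>t(M)\<close> is generated by these vectors, a homomorphism from \<open>t(M)\<close> to \<open>t(N)\<close> is
  the same as a homomorphism from \<open>M\<close> to \<open>N\<close>.
\<close>

section \<open>The universal module and the Hecke algebra\<close>

text \<open>The obstacle is that \<open>I\<close> is infinite, so a mean over \<open>I\<close> is
  not a finite sum. Every vector of the universal module is fixed by some K_n, because a conjugate
  of a small enough K_n lies in \<open>I\<close>, and its mean is taken over I/K_n: the level
  depends on the vector, the mean does not. Invertibility of the index is reached through torsion
  instead of a count of I/K_m, which would call for the structure of the integral model; torsion is
  a question about single matrices. The two halves meet in the locale
  \<open>averaging_setting\<close>, which retains a filtration of \<open>I\<close> by subgroups
  normal in \<open>I\<close>, of index invertible in k, and small enough under conjugation by G.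
  Whether tau is injective is left open. The computation takes place in its image, where a function
  of l is tested at each l: the mean of x \<otimes> m has the value l(e x) m = l(char_I) e(x) m at
  l, which is the value of char_I \<otimes> e(x) m. So the fixed vectors of the image are found
  although the kernel of tau is unknown.\<close>

text \<open>Serves the duals, the modules \<open>Zn\<close> and t(M) alike: all are sets of
  functions, extensional outside \<open>Y\<close>, with pointwise operations. The formula for the
  inverse is a separate conclusion because \<open>a_inv\<close> is a definite description and does
  not unfold to the pointwise expression.\<close>

lemma pointwise_abelian_group:
  assumes N: "abelian_group N" and sub: "carrier S \<subseteq> Y \<rightarrow>\<^sub>E carrier N"
    and zero: "\<zero>\<^bsub>S\<^esub> = (\<lambda>x\<in>Y. \<zero>\<^bsub>N\<^esub>)" "\<zero>\<^bsub>S\<^esub> \<in> carrier S"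
    and add: "\<And>l l'. l \<in> carrier S \<Longrightarrow> l' \<in> carrier S \<Longrightarrow> l \<oplus>\<^bsub>S\<^esub> l' = (\<lambda>x\<in>Y. l x \<oplus>\<^bsub>N\<^esub> l' x)"
      "\<And>l l'. l \<in> carrier S \<Longrightarrow> l' \<in> carrier S \<Longrightarrow> l \<oplus>\<^bsub>S\<^esub> l' \<in> carrier S"
    and neg: "\<And>l. l \<in> carrier S \<Longrightarrow> (\<lambda>x\<in>Y. \<ominus>\<^bsub>N\<^esub> l x) \<in> carrier S"
  shows "abelian_group S" and "l \<in> carrier S \<Longrightarrow> \<ominus>\<^bsub>S\<^esub> l = (\<lambda>x\<in>Y. \<ominus>\<^bsub>N\<^esub> l x)"
proof -
  interpret N: abelian_group N by fact
  have val: "l x \<in> carrier N" if "l \<in> carrier S" "x \<in> Y" for l x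
    using that sub by (auto simp: PiE_def)
  have ext: "l \<in> extensional Y" if "l \<in> carrier S" for l
    using that sub by (auto simp: PiE_def)
  have inverse: "(\<lambda>x\<in>Y. \<ominus>\<^bsub>N\<^esub> l x) \<oplus>\<^bsub>S\<^esub> l = \<zero>\<^bsub>S\<^esub>" if "l \<in> carrier S" for l
    using that by (auto simp: add neg zero(1) fun_eq_iff val N.l_neg)
  show S: "abelian_group S"
  proof (rule abelian_groupI)
    fix l l' l'' assume "l \<in> carrier S" "l' \<in> carrier S" "l'' \<in> carrier S"
    then show "l \<oplus>\<^bsub>S\<^esub> l' \<oplus>\<^bsub>S\<^esub> l'' = l \<oplus>\<^bsub>S\<^esub> (l' \<oplus>\<^bsub>S\<^esub> l'')"
      using add(2)[of l l'] add(2)[of l' l''] by (auto simp: add(1) fun_eq_iff val N.a_assoc)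
  next
    fix l l' assume "l \<in> carrier S" "l' \<in> carrier S"
    then show "l \<oplus>\<^bsub>S\<^esub> l' = l' \<oplus>\<^bsub>S\<^esub> l"
      by (auto simp: add(1) fun_eq_iff val N.a_comm)
  next
    fix l assume l: "l \<in> carrier S"
    show "\<zero>\<^bsub>S\<^esub> \<oplus>\<^bsub>S\<^esub> l = l"
      unfolding add(1)[OF zero(2) l] using l ext[OF l] by (auto simp: zero(1) fun_eq_iff val extensional_def)
  qed (use add(2) zero(2) inverse neg in blast)+
  interpret S: abelian_group S by fact
  show "\<ominus>\<^bsub>S\<^esub> l = (\<lambda>x\<in>Y. \<ominus>\<^bsub>N\<^esub> l x)" if "l \<in> carrier S"
    using inverse[OF that] neg[OF that] that S.minus_equality by blast
qed

text \<open>
  Associativity and the left unit law are required off the carrier as well, because \<open>translate\<close> acts on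
  functions of arbitrary sets, not only of cosets. The parameter \<open>coeff_type\<close> only fixes the
  coefficient field.
\<close>

locale averaging_setting = group G for G :: "('g, 's) monoid_scheme" (structure) +
  fixes I :: "'g set" and K :: "nat \<Rightarrow> 'g set" and coeff_type :: "'k::field itself"
  assumes assoc: "x \<otimes> (y \<otimes> z) = (x \<otimes> y) \<otimes> z" and left_one: "\<one> \<otimes> x = x"
    and I: "subgroup I G" and K: "subgroup (K n) G" "K n \<subseteq> I" "m \<le> n \<Longrightarrow> K n \<subseteq> K m"
    and K_normal: "i \<in> I \<Longrightarrow> k \<in> K n \<Longrightarrow> inv i \<otimes> k \<otimes> i \<in> K n"
    and transversal: "\<exists>R\<subseteq>I. finite R \<and> (\<forall>i\<in>I. \<exists>!r. r \<in> R \<and> inv r \<otimes> i \<in> K n) \<and> of_nat (card R) \<noteq> (0::'k)"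
    and K_small: "g \<in> carrier G \<Longrightarrow> \<exists>n. \<forall>k\<in>K n. inv g \<otimes> k \<otimes> g \<in> I"
begin

abbreviation coset_act :: "'g \<Rightarrow> 'g set \<Rightarrow> 'g set" (infixr "\<rhd>" 75) where "g \<rhd> c \<equiv> l_coset G g c"
abbreviation XX :: "('g set \<Rightarrow> 'k) set" where "XX \<equiv> univ_mod G I"
abbreviation H :: "('g, 'k) hecke ring" where "H \<equiv> hecke_algebra G I"
abbreviation Y :: "nat \<Rightarrow> ('g set \<Rightarrow> 'k) set" where "Y n \<equiv> fixed_vectors G I (K n)"
abbreviation XI :: "('g set \<Rightarrow> 'k) set" where "XI \<equiv> fixed_vectors G I I"
abbreviation D where "D \<equiv> dual G I XX"
abbreviation scal :: "'k \<Rightarrow> ('g, 'k) hecke" where "scal \<equiv> hecke_scalar G I"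

section \<open>Translation of cosets and of functions on cosets\<close>

lemma I_carrier: "i \<in> I \<Longrightarrow> i \<in> carrier G"
  using I subgroup.mem_carrier by metis

lemma K_carrier: "k \<in> K n \<Longrightarrow> k \<in> carrier G"
  using K(2) I_carrier by blast+

lemma mult_inv_cancel: "g \<in> carrier G \<Longrightarrow> g \<otimes> (inv g \<otimes> x) = x" "g \<in> carrier G \<Longrightarrow> inv g \<otimes> (g \<otimes> x) = x"
  by (simp_all add: assoc left_one)

lemma lcos_lcos: "g \<rhd> (h \<rhd> c) = (g \<otimes> h) \<rhd> c"
  by (auto simp: l_coset_def assoc)

lemma lcos_one: "\<one> \<rhd> c = c"
  by (simp add: l_coset_def left_one)

lemma lcos_eq_iff: "g \<in> carrier G \<Longrightarrow> inv g \<rhd> c = d \<longleftrightarrow> c = g \<rhd> d"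
  by (auto simp: lcos_lcos lcos_one)

lemma lcos_I: "i \<in> I \<Longrightarrow> i \<rhd> I = I"
  by (simp add: I I_carrier coset_join3)

lemma lcosets_I: "c \<in> lcosets I \<longleftrightarrow> (\<exists>g\<in>carrier G. c = g \<rhd> I)"
  by (auto simp: LCOSETS_def)

lemma lcosets_lcos: "g \<in> carrier G \<Longrightarrow> c \<in> lcosets I \<Longrightarrow> g \<rhd> c \<in> lcosets I"
  unfolding lcosets_I by (auto simp: lcos_lcos)

lemma translate_translate:
  "g \<in> carrier G \<Longrightarrow> h \<in> carrier G \<Longrightarrow> translate G g (translate G h x) = translate G (g \<otimes> h) x"
  by (simp add: translate_def lcos_lcos inv_mult_group)

lemma translate_one: "translate G \<one> x = x"
  by (simp add: translate_def lcos_one)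

lemma translate_sum: "translate G g (\<lambda>c. \<Sum>s\<in>S. x s c) = (\<lambda>c. \<Sum>s\<in>S. translate G g (x s) c)"
  and translate_add: "translate G g (\<lambda>c. x' c + y' c) = (\<lambda>c. translate G g x' c + translate G g y' c)"
  and translate_scale: "translate G g (\<lambda>c. a * x' c) = (\<lambda>c. a * translate G g x' c)"
  by (simp_all add: translate_def)

section \<open>The universal module and its spanning set of point masses\<close>

lemma X_zero: "(\<lambda>c. 0) \<in> XX"
  by (simp add: univ_mod_def)

lemma X_add: "x \<in> XX \<Longrightarrow> y \<in> XX \<Longrightarrow> (\<lambda>c. x c + y c) \<in> XX"
  unfolding univ_mod_def
  by (auto intro: finite_subset[of _ "{c. x c \<noteq> 0} \<union> {c. y c \<noteq> 0}"])
     (metis (mono_tags, lifting) add_0 mem_Collect_eq subsetD)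

lemma X_scale: "x \<in> XX \<Longrightarrow> (\<lambda>c. a * x c) \<in> XX"
  unfolding univ_mod_def
  by (auto intro: finite_subset[of _ "{c. x c \<noteq> 0}"])

lemma X_sum: "(\<And>s. s \<in> S \<Longrightarrow> x s \<in> XX) \<Longrightarrow> (\<lambda>c. \<Sum>s\<in>S. x s c) \<in> XX"
  by (induction S rule: infinite_finite_induct) (auto simp: X_zero X_add)

lemma X_finite: "x \<in> XX \<Longrightarrow> finite {c. x c \<noteq> 0}"
  and X_lcosets: "x \<in> XX \<Longrightarrow> x c \<noteq> 0 \<Longrightarrow> c \<in> lcosets I"
  by (auto simp: univ_mod_def)

lemma translate_support:
  assumes g: "g \<in> carrier G"
  shows "{c. translate G g x c \<noteq> 0} = l_coset G g ` {c. x c \<noteq> 0}"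
proof
  show "{c. translate G g x c \<noteq> 0} \<subseteq> l_coset G g ` {c. x c \<noteq> 0}"
  proof
    fix c assume "c \<in> {c. translate G g x c \<noteq> 0}"
    then show "c \<in> l_coset G g ` {c. x c \<noteq> 0}"
      using g by (intro image_eqI[of _ _ "inv g \<rhd> c"]) (auto simp: translate_def lcos_lcos lcos_one)
  qed
  show "l_coset G g ` {c. x c \<noteq> 0} \<subseteq> {c. translate G g x c \<noteq> 0}"
    using g by (auto simp: translate_def lcos_lcos lcos_one)
qed

lemma X_translate:
  assumes g: "g \<in> carrier G" and x: "x \<in> XX" shows "translate G g x \<in> XX"
proof -
  have "{c. translate G g x c \<noteq> 0} = l_coset G g ` {c. x c \<noteq> 0}"
    by (rule translate_support[OF g])
  moreover have "l_coset G g ` {c. x c \<noteq> 0} \<subseteq> lcosets I"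
    using x g by (auto intro: lcosets_lcos X_lcosets)
  ultimately show ?thesis
    using X_finite[OF x] by (simp add: univ_mod_def)
qed

text \<open>\<open>delta \<one>\<close> is the generator char_I of the universal module, through
  which H is identified with the I-fixed vectors.\<close>

definition delta :: "'g \<Rightarrow> 'g set \<Rightarrow> 'k" where "delta g c = (if c = g \<rhd> I then 1 else 0)"

lemma delta_X: "g \<in> carrier G \<Longrightarrow> delta g \<in> XX"
proof -
  assume "g \<in> carrier G"
  moreover have "{c. delta g c \<noteq> 0} = {g \<rhd> I}"
    by (auto simp: delta_def)
  ultimately show ?thesis
    by (auto simp: univ_mod_def lcosets_I)
qed

lemma translate_delta: "g \<in> carrier G \<Longrightarrow> translate G g (delta h) = delta (g \<otimes> h)"
  by (simp add: translate_def delta_def lcos_eq_iff lcos_lcos fun_eq_iff)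

lemma delta_translate_one: "g \<in> carrier G \<Longrightarrow> delta g = translate G g (delta \<one>)"
  by (simp add: translate_delta)

text \<open>Induction on the finite support: at a point d = gI of the support, subtracting
  \<open>x d * delta g\<close> removes d and changes no other value.\<close>

lemma X_induct [consumes 1, case_names zero step]:
  assumes "x \<in> XX" and zero: "P (\<lambda>c. 0)"
    and step: "\<And>a g y. y \<in> XX \<Longrightarrow> g \<in> carrier G \<Longrightarrow> P y \<Longrightarrow> P (\<lambda>c. a * delta g c + y c)"
  shows "P x"
proof -
  have "finite S \<Longrightarrow> x \<in> XX \<Longrightarrow> {c. x c \<noteq> 0} = S \<Longrightarrow> P x" for S
  proof (induction S arbitrary: x rule: finite_induct)
    case empty
    then show ?case using zero by (simp add: fun_eq_iff[symmetric])
  next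
    case (insert d S)
    then have "d \<in> lcosets I" by (auto intro: X_lcosets)
    then obtain g where g: "g \<in> carrier G" "d = g \<rhd> I" by (auto simp: lcosets_I)
    define y where "y = (\<lambda>c. x c + - x d * delta g c)"
    have y: "y \<in> XX"
      unfolding y_def using insert g by (intro X_add X_scale delta_X)
    moreover have "{c. y c \<noteq> 0} = S"
      using insert g by (auto simp: y_def delta_def)
    ultimately have "P y" by (rule insert)
    then have "P (\<lambda>c. x d * delta g c + y c)" by (rule step[OF y g(1)])
    then show ?case by (simp add: y_def)
  qed
  then show ?thesis using X_finite assms(1) by blast
qed

section \<open>The ring structure of the Hecke algebra\<close>

lemma hecke_simps:
  "h \<otimes>\<^bsub>H\<^esub> h' = (\<lambda>x\<in>XX. h' (h x))" "\<one>\<^bsub>H\<^esub> = (\<lambda>x\<in>XX. x)" "\<zero>\<^bsub>H\<^esub> = (\<lambda>x\<in>XX. \<lambda>c. 0)"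
  "h \<oplus>\<^bsub>H\<^esub> h' = (\<lambda>x\<in>XX. \<lambda>c. h x c + h' x c)"
  by (simp_all add: hecke_algebra_def)

lemma hecke_carrier: "h \<in> carrier H \<longleftrightarrow> h \<in> XX \<rightarrow>\<^sub>E XX \<and>
       (\<forall>x\<in>XX. \<forall>y\<in>XX. h (\<lambda>c. x c + y c) = (\<lambda>c. h x c + h y c)) \<and>
       (\<forall>a. \<forall>x\<in>XX. h (\<lambda>c. a * x c) = (\<lambda>c. a * h x c)) \<and>
       (\<forall>g\<in>carrier G. \<forall>x\<in>XX. h (translate G g x) = translate G g (h x))"
  by (simp add: hecke_algebra_def)

lemma hecke_X: "h \<in> carrier H \<Longrightarrow> x \<in> XX \<Longrightarrow> h x \<in> XX"
  and hecke_ext: "h \<in> carrier H \<Longrightarrow> x \<notin> XX \<Longrightarrow> h x = undefined"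
  and hecke_add: "h \<in> carrier H \<Longrightarrow> x \<in> XX \<Longrightarrow> y \<in> XX \<Longrightarrow> h (\<lambda>c. x c + y c) = (\<lambda>c. h x c + h y c)"
  and hecke_scale: "h \<in> carrier H \<Longrightarrow> x \<in> XX \<Longrightarrow> h (\<lambda>c. a * x c) = (\<lambda>c. a * h x c)"
  and hecke_translate: "h \<in> carrier H \<Longrightarrow> g \<in> carrier G \<Longrightarrow> x \<in> XX \<Longrightarrow> h (translate G g x) = translate G g (h x)"
  by (auto simp: hecke_carrier PiE_def extensional_def)

lemma hecke_zero: "h \<in> carrier H \<Longrightarrow> h (\<lambda>c. 0) = (\<lambda>c. 0)"
  using hecke_scale[of h "\<lambda>c. 0" 0] X_zero by simp

lemma hecke_sum: "h \<in> carrier H \<Longrightarrow> (\<And>s. s \<in> S \<Longrightarrow> x s \<in> XX) \<Longrightarrow> h (\<lambda>c. \<Sum>s\<in>S. x s c) = (\<lambda>c. \<Sum>s\<in>S. h (x s) c)"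
proof (induction S rule: infinite_finite_induct)
  case (insert t S)
  then have "h (\<lambda>c. x t c + (\<Sum>s\<in>S. x s c)) = (\<lambda>c. h (x t) c + h (\<lambda>c. \<Sum>s\<in>S. x s c) c)"
    by (intro hecke_add X_sum) auto
  with insert show ?case by simp
qed (simp_all add: hecke_zero)

text \<open>The G-translates of char_I span the universal module. This is the injective half of the
  identification of H with the I-fixed vectors.\<close>

lemma hecke_eqI:
  assumes h: "h \<in> carrier H" and h': "h' \<in> carrier H" and eq: "h (delta \<one>) = h' (delta \<one>)"
  shows "h = h'"
proof
  fix x show "h x = h' x"
  proof (cases "x \<in> XX")
    case True
    then show ?thesis
    proof (induction rule: X_induct)
      case zero
      show ?case using h h' by (simp add: hecke_zero)
    next
      case (step a g y)
      have "h (delta g) = h' (delta g)"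
        using step(2) h h' eq
        by (simp add: delta_translate_one[of g] hecke_translate delta_X)
      then show ?case using step(1-3)
        by (simp add: hecke_add[OF h X_scale[OF delta_X]] hecke_add[OF h' X_scale[OF delta_X]]
            hecke_scale[OF h delta_X] hecke_scale[OF h' delta_X])
    qed
  next
    case False
    then show ?thesis using h h' by (simp add: hecke_ext)
  qed
qed

lemma hecke_mult_closed: "h \<in> carrier H \<Longrightarrow> h' \<in> carrier H \<Longrightarrow> h \<otimes>\<^bsub>H\<^esub> h' \<in> carrier H"
  and hecke_one_closed: "\<one>\<^bsub>H\<^esub> \<in> carrier H"
  and hecke_zero_closed: "\<zero>\<^bsub>H\<^esub> \<in> carrier H"
  and hecke_add_closed: "h \<in> carrier H \<Longrightarrow> h' \<in> carrier H \<Longrightarrow> h \<oplus>\<^bsub>H\<^esub> h' \<in> carrier H"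
  and scal_closed: "scal a \<in> carrier H"
proof -
  assume h: "h \<in> carrier H" and h': "h' \<in> carrier H"
  show "h \<otimes>\<^bsub>H\<^esub> h' \<in> carrier H"
    unfolding hecke_simps hecke_carrier using h h'
    by (auto simp: hecke_add hecke_scale hecke_translate X_translate hecke_X X_add X_scale)
  show "h \<oplus>\<^bsub>H\<^esub> h' \<in> carrier H"
    unfolding hecke_simps hecke_carrier using h h'
    by (auto simp: hecke_add hecke_scale hecke_translate X_translate hecke_X X_add X_scale translate_add
        algebra_simps)
next
  show "\<one>\<^bsub>H\<^esub> \<in> carrier H" "\<zero>\<^bsub>H\<^esub> \<in> carrier H" "scal a \<in> carrier H"
    unfolding hecke_simps hecke_carrier hecke_scalar_def
    by (auto simp: X_translate X_add X_scale X_zero translate_scale algebra_simps)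
       (simp_all add: translate_def)
qed

lemma scal_apply: "x \<in> XX \<Longrightarrow> scal a x = (\<lambda>c. a * x c)"
  by (simp add: hecke_scalar_def)

lemma hecke_minus_closed: "h \<in> carrier H \<Longrightarrow> (\<lambda>x\<in>XX. \<lambda>c. - h x c) \<in> carrier H"
proof -
  assume h: "h \<in> carrier H"
  have "h \<otimes>\<^bsub>H\<^esub> scal (-1) = (\<lambda>x\<in>XX. \<lambda>c. - h x c)"
    unfolding hecke_simps using h by (auto simp: fun_eq_iff scal_apply hecke_X)
  then show ?thesis
    using hecke_mult_closed[OF h scal_closed[of "-1"]] by simp
qed

lemma hecke_ring: "ring H"
proof (rule ringI)
  show "abelian_group H"
  proof (rule abelian_groupI)
    fix h h' h'' assume "h \<in> carrier H" "h' \<in> carrier H" "h'' \<in> carrier H"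
    then show "h \<oplus>\<^bsub>H\<^esub> h' \<oplus>\<^bsub>H\<^esub> h'' = h \<oplus>\<^bsub>H\<^esub> (h' \<oplus>\<^bsub>H\<^esub> h'')"
      by (auto simp: hecke_simps fun_eq_iff add.assoc)
  next
    fix h h' assume "h \<in> carrier H" "h' \<in> carrier H"
    then show "h \<oplus>\<^bsub>H\<^esub> h' = h' \<oplus>\<^bsub>H\<^esub> h"
      by (auto simp: hecke_simps fun_eq_iff add.commute)
  next
    fix h assume h: "h \<in> carrier H"
    show "\<zero>\<^bsub>H\<^esub> \<oplus>\<^bsub>H\<^esub> h = h"
      using h by (auto simp: hecke_simps fun_eq_iff hecke_ext)
    show "\<exists>y\<in>carrier H. y \<oplus>\<^bsub>H\<^esub> h = \<zero>\<^bsub>H\<^esub>"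
      using hecke_minus_closed[OF h] by (rule bexI[rotated]) (auto simp: hecke_simps fun_eq_iff)
  qed (simp_all add: hecke_add_closed hecke_zero_closed)
  show "Group.monoid H"
  proof (rule monoidI)
    fix h assume h: "h \<in> carrier H"
    then show "\<one>\<^bsub>H\<^esub> \<otimes>\<^bsub>H\<^esub> h = h" "h \<otimes>\<^bsub>H\<^esub> \<one>\<^bsub>H\<^esub> = h"
      by (auto simp: hecke_simps fun_eq_iff hecke_ext hecke_X)
  next
    fix h h' h'' assume "h \<in> carrier H" "h' \<in> carrier H" "h'' \<in> carrier H"
    then show "h \<otimes>\<^bsub>H\<^esub> h' \<otimes>\<^bsub>H\<^esub> h'' = h \<otimes>\<^bsub>H\<^esub> (h' \<otimes>\<^bsub>H\<^esub> h'')"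
      by (auto simp: hecke_simps hecke_X)
  qed (simp_all add: hecke_mult_closed hecke_one_closed)
next
  fix h h' h'' assume "h \<in> carrier H" "h' \<in> carrier H" "h'' \<in> carrier H"
  then show "(h \<oplus>\<^bsub>H\<^esub> h') \<otimes>\<^bsub>H\<^esub> h'' = h \<otimes>\<^bsub>H\<^esub> h'' \<oplus>\<^bsub>H\<^esub> h' \<otimes>\<^bsub>H\<^esub> h''"
    "h'' \<otimes>\<^bsub>H\<^esub> (h \<oplus>\<^bsub>H\<^esub> h') = h'' \<otimes>\<^bsub>H\<^esub> h \<oplus>\<^bsub>H\<^esub> h'' \<otimes>\<^bsub>H\<^esub> h'"
    by (auto simp: hecke_simps hecke_X hecke_add)
qed

lemma hecke_minus: "h \<in> carrier H \<Longrightarrow> \<ominus>\<^bsub>H\<^esub> h = (\<lambda>x\<in>XX. \<lambda>c. - h x c)"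
proof -
  interpret ring H by (rule hecke_ring)
  assume h: "h \<in> carrier H"
  show ?thesis
    by (rule minus_equality[OF _ h hecke_minus_closed[OF h]]) (auto simp: hecke_simps fun_eq_iff)
qed

lemma scal_central: "h \<in> carrier H \<Longrightarrow> scal a \<otimes>\<^bsub>H\<^esub> h = h \<otimes>\<^bsub>H\<^esub> scal a"
  by (auto simp: hecke_simps scal_apply hecke_scale hecke_X)

lemma scal_ring: "scal 1 = \<one>\<^bsub>H\<^esub>" "scal 0 = \<zero>\<^bsub>H\<^esub>" "scal (a + b) = scal a \<oplus>\<^bsub>H\<^esub> scal b"
  "scal (a * b) = scal a \<otimes>\<^bsub>H\<^esub> scal b" "scal (- a) = \<ominus>\<^bsub>H\<^esub> scal a"
  using hecke_minus[OF scal_closed[of a]]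
  by (auto simp: hecke_simps hecke_scalar_def fun_eq_iff algebra_simps X_scale)

section \<open>Vectors fixed by a subgroup, and smoothness of the universal module\<close>

lemma fixed_X: "(x :: 'g set \<Rightarrow> 'k) \<in> fixed_vectors G I L \<Longrightarrow> x \<in> XX"
  and fixed_translate: "x \<in> fixed_vectors G I L \<Longrightarrow> g \<in> L \<Longrightarrow> translate G g x = x"
  by (auto simp: fixed_vectors_def)

lemma fixed_add: "x \<in> fixed_vectors G I L \<Longrightarrow> (y :: 'g set \<Rightarrow> 'k) \<in> fixed_vectors G I L \<Longrightarrow>
    (\<lambda>c. x c + y c) \<in> fixed_vectors G I L"
  and fixed_scale: "x \<in> fixed_vectors G I L \<Longrightarrow> (\<lambda>c. (a :: 'k) * x c) \<in> fixed_vectors G I L"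
  and fixed_zero: "(\<lambda>c. 0 :: 'k) \<in> fixed_vectors G I L"
  by (simp_all add: fixed_vectors_def translate_add translate_scale X_add X_scale X_zero)
    (simp add: translate_def)

lemma fixed_hecke: "L \<subseteq> carrier G \<Longrightarrow> h \<in> carrier H \<Longrightarrow> x \<in> fixed_vectors G I L \<Longrightarrow> h x \<in> fixed_vectors G I L"
  by (auto simp: fixed_vectors_def hecke_X) (metis hecke_translate subsetD)

lemma fixed_anti: "L \<subseteq> L' \<Longrightarrow> fixed_vectors G I L' \<subseteq> fixed_vectors G I L"
  by (auto simp: fixed_vectors_def)

lemma XI_Y: "x \<in> XI \<Longrightarrow> x \<in> Y n"
  using fixed_anti[OF K(2)] by auto

lemma Y_mono: "m \<le> n \<Longrightarrow> x \<in> Y m \<Longrightarrow> x \<in> Y n"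
  using fixed_anti[OF K(3)] by auto

lemma delta_one_XI: "delta \<one> \<in> XI"
  by (auto simp: fixed_vectors_def delta_X translate_delta I_carrier) (simp add: delta_def lcos_I lcos_one fun_eq_iff)

text \<open>Since k g = g (g^-1 k g), the coset gI is fixed by every k whose conjugate g^-1 k g lies
  in \<open>I\<close>, and \<open>K_small\<close> provides a whole K_n of such k. A linear
  combination is fixed at the larger of the levels involved.\<close>

lemma X_Y: "x \<in> XX \<Longrightarrow> \<exists>n. x \<in> Y n"
proof (induction rule: X_induct)
  case zero
  then show ?case by (simp add: fixed_zero)
next
  case (step a g y)
  then obtain m where m: "y \<in> Y m" by blast
  obtain n where n: "\<forall>k\<in>K n. inv g \<otimes> k \<otimes> g \<in> I" using K_small step by blast
  have "delta g \<in> Y n"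
  proof -
    have "(k \<otimes> g) \<rhd> I = g \<rhd> I" if k: "k \<in> K n" for k
    proof -
      have "k \<otimes> g = g \<otimes> (inv g \<otimes> k \<otimes> g)"
        using step by (simp add: assoc left_one)
      then show ?thesis
        using n k lcos_I lcos_lcos by metis
    qed
    then show ?thesis
      by (auto simp: fixed_vectors_def delta_X step translate_delta K_carrier) (simp add: delta_def fun_eq_iff)
  qed
  then have "(\<lambda>c. a * delta g c + y c) \<in> Y (max m n)"
    by (intro fixed_add[OF fixed_scale]) (rule Y_mono[OF max.cobounded2] Y_mono[OF max.cobounded1 m], assumption?)+
  then show ?case by blast
qed

text \<open>Normality of \<open>K n\<close> in \<open>I\<close> makes \<open>I\<close> act on the
  K_n-fixed vectors, hence on their dual; the coinvariants refer to this action.\<close>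

lemma Y_translate_I:
  assumes i: "i \<in> I" and x: "x \<in> Y n" shows "translate G i x \<in> Y n"
proof -
  have "translate G k (translate G i x) = translate G i x" if k: "k \<in> K n" for k
  proof -
    have "k \<otimes> i = i \<otimes> (inv i \<otimes> k \<otimes> i)"
      using i I_carrier by (simp add: assoc left_one)
    then have "translate G k (translate G i x) = translate G i (translate G (inv i \<otimes> k \<otimes> i) x)"
      using i k K_normal[OF i k] by (simp add: translate_translate I_carrier K_carrier)
    then show ?thesis using fixed_translate[OF x K_normal[OF i k]] by simp
  qed
  then show ?thesis using x i by (auto simp: fixed_vectors_def X_translate I_carrier)
qed

section \<open>Averaging over \<open>I\<close>\<close>

definition reps :: "nat \<Rightarrow> 'g set" where
  "reps n = (SOME R. R \<subseteq> I \<and> finite R \<and> (\<forall>i\<in>I. \<exists>!r. r \<in> R \<and> inv r \<otimes> i \<in> K n) \<and> of_nat (card R) \<noteq> (0::'k))"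

lemma reps: "reps n \<subseteq> I" "finite (reps n)" "i \<in> I \<Longrightarrow> \<exists>!r. r \<in> reps n \<and> inv r \<otimes> i \<in> K n"
  "of_nat (card (reps n)) \<noteq> (0::'k)"
  using someI_ex[OF transversal[of n, unfolded Bex_def]] unfolding reps_def by auto

lemma reps_I: "r \<in> reps n \<Longrightarrow> r \<in> I" and reps_carrier: "r \<in> reps n \<Longrightarrow> r \<in> carrier G"
  using reps(1) I_carrier by blast+

lemma reps_eqI: "r \<in> reps n \<Longrightarrow> s \<in> reps n \<Longrightarrow> inv r \<otimes> s \<in> K n \<Longrightarrow> r = s"
  using reps(3)[of s n] subgroup.one_closed[OF K(1)] by (metis l_inv reps_I reps_carrier)

text \<open>The sum is really over I/K_n, as \<open>f\<close> is constant on the cosets i K_n.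
  \<open>q r\<close> is the representative of the coset of \<open>p r\<close>; an injective self-map
  of a finite set is a bijection, so injectivity of \<open>p\<close> modulo \<open>K n\<close> is
  enough.\<close>

lemma sum_reps_reindex:
  fixes f :: "'g \<Rightarrow> 'a::comm_monoid_add"
  assumes f: "\<And>i k. i \<in> I \<Longrightarrow> k \<in> K n \<Longrightarrow> f (i \<otimes> k) = f i"
    and p: "\<And>r. r \<in> reps n \<Longrightarrow> p r \<in> I"
    and inj: "\<And>r s. r \<in> reps n \<Longrightarrow> s \<in> reps n \<Longrightarrow> inv (p r) \<otimes> p s \<in> K n \<Longrightarrow> inv r \<otimes> s \<in> K n"
  shows "(\<Sum>r\<in>reps n. f (p r)) = (\<Sum>r\<in>reps n. f r)"
proof -
  interpret KN: subgroup "K n" G by (rule K)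
  define q where "q r = (THE s. s \<in> reps n \<and> inv s \<otimes> p r \<in> K n)" for r
  have q: "q r \<in> reps n" "inv (q r) \<otimes> p r \<in> K n" if "r \<in> reps n" for r
    using theI'[OF reps(3)[OF p[OF that], of n]] by (auto simp: q_def)
  have "inj_on q (reps n)"
  proof (rule inj_onI)
    fix r s assume rs: "r \<in> reps n" "s \<in> reps n" "q r = q s"
    have "inv (inv (q r) \<otimes> p r) \<otimes> (inv (q r) \<otimes> p s) \<in> K n"
      using q[OF rs(1)] q[OF rs(2)] rs(3) by simp
    also have "inv (inv (q r) \<otimes> p r) \<otimes> (inv (q r) \<otimes> p s) = inv (p r) \<otimes> p s"
      using I_carrier[OF p[OF rs(1)]] I_carrier[OF p[OF rs(2)]] reps_carrier[OF q(1)[OF rs(2)]] rs(3)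
      by (simp add: inv_mult_group m_assoc mult_inv_cancel)
    finally show "r = s"
      using inj reps_eqI rs by blast
  qed
  then have "bij_betw q (reps n) (reps n)"
    using q(1) reps(2) by (simp add: bij_betw_def endo_inj_surj image_subsetI)
  moreover have "f (p r) = f (q r)" if "r \<in> reps n" for r
    using f[OF reps_I[OF q(1)[OF that]] q(2)[OF that]] mult_inv_cancel(1)[OF reps_carrier[OF q(1)[OF that]]]
    by simp
  ultimately show ?thesis
    using sum.reindex_bij_betw[of q "reps n" "reps n" f] by simp
qed

lemma sum_reps_left:
  fixes f :: "'g \<Rightarrow> 'a::comm_monoid_add"
  assumes f: "\<And>i k. i \<in> I \<Longrightarrow> k \<in> K n \<Longrightarrow> f (i \<otimes> k) = f i" and j: "j \<in> I"
  shows "(\<Sum>r\<in>reps n. f (j \<otimes> r)) = (\<Sum>r\<in>reps n. f r)"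
proof (rule sum_reps_reindex[OF f])
  show "j \<otimes> r \<in> I" if "r \<in> reps n" for r
    using that j I reps_I by (simp add: subgroup.m_closed)
  show "inv r \<otimes> s \<in> K n" if "r \<in> reps n" "s \<in> reps n" "inv (j \<otimes> r) \<otimes> (j \<otimes> s) \<in> K n" for r s
    using that j by (simp add: inv_mult_group I_carrier reps_carrier m_assoc mult_inv_cancel)
qed

text \<open>Left translation permutes the cosets i K_n in any case, right translation by j does so
  because \<open>K n\<close> is normal: conjugating by the inverse of j takes (r j)^-1 (s j) back to
  r^-1 s.\<close>

lemma sum_reps_right:
  fixes f :: "'g \<Rightarrow> 'a::comm_monoid_add"
  assumes f: "\<And>i k. i \<in> I \<Longrightarrow> k \<in> K n \<Longrightarrow> f (i \<otimes> k) = f i" and j: "j \<in> I"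
  shows "(\<Sum>r\<in>reps n. f (r \<otimes> j)) = (\<Sum>r\<in>reps n. f r)"
proof (rule sum_reps_reindex[OF f])
  show "r \<otimes> j \<in> I" if "r \<in> reps n" for r
    using that j I reps_I by (simp add: subgroup.m_closed)
  show "inv r \<otimes> s \<in> K n" if "r \<in> reps n" "s \<in> reps n" "inv (r \<otimes> j) \<otimes> (s \<otimes> j) \<in> K n" for r s
  proof -
    have "inv (inv j) \<otimes> (inv (r \<otimes> j) \<otimes> (s \<otimes> j)) \<otimes> inv j \<in> K n"
      using that j I by (intro K_normal) (auto simp: subgroup.m_inv_closed)
    also have "inv (inv j) \<otimes> (inv (r \<otimes> j) \<otimes> (s \<otimes> j)) \<otimes> inv j = inv r \<otimes> s"
      using that j by (simp add: inv_mult_group I_carrier reps_carrier m_assoc mult_inv_cancel)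
    finally show ?thesis .
  qed
qed

text \<open>For \<open>x\<close> fixed by \<open>K n\<close> this is the mean over I/K_n; for other
  \<open>x\<close> the value depends on the chosen representatives.\<close>

definition average_at :: "nat \<Rightarrow> ('g set \<Rightarrow> 'k) \<Rightarrow> ('g set \<Rightarrow> 'k)" where
  "average_at n x = (\<lambda>c. inverse (of_nat (card (reps n))) * (\<Sum>r\<in>reps n. translate G r x c))"

lemma translate_right_K:
  "x \<in> Y n \<Longrightarrow> i \<in> I \<Longrightarrow> k \<in> K n \<Longrightarrow> translate G (i \<otimes> k) x = translate G i x"
  by (simp add: translate_translate[symmetric] I_carrier K_carrier fixed_translate)

lemma average_at_X: "x \<in> XX \<Longrightarrow> average_at n x \<in> XX"
  unfolding average_at_def by (intro X_scale X_sum X_translate) (auto simp: reps_carrier)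

lemma average_at_XI:
  assumes x: "x \<in> Y n" shows "average_at n x \<in> XI"
proof -
  have "translate G i (average_at n x) = average_at n x" if i: "i \<in> I" for i
  proof -
    have "translate G i (average_at n x) =
        (\<lambda>c. inverse (of_nat (card (reps n))) * (\<Sum>r\<in>reps n. translate G (i \<otimes> r) x c))"
      using i unfolding average_at_def translate_scale translate_sum
      by (simp add: translate_translate I_carrier reps_carrier)
    also have "\<dots> = average_at n x"
      unfolding average_at_def using translate_right_K[OF x]
      by (subst sum_reps_left[where f = "\<lambda>r. translate G r x _"]) (auto simp: i)
    finally show ?thesis .
  qed
  then show ?thesis using x by (simp add: fixed_vectors_def average_at_X)
qed

lemma average_at_id: "x \<in> XI \<Longrightarrow> average_at n x = x"
  using reps(4)[of n] by (simp add: average_at_def fixed_translate reps_I flip: mult.assoc)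

lemma average_at_translate:
  assumes x: "x \<in> Y n" and i: "i \<in> I" shows "average_at n (translate G i x) = average_at n x"
proof -
  have "average_at n (translate G i x) =
      (\<lambda>c. inverse (of_nat (card (reps n))) * (\<Sum>r\<in>reps n. translate G (r \<otimes> i) x c))"
    using i unfolding average_at_def by (simp add: translate_translate I_carrier reps_carrier)
  also have "\<dots> = average_at n x"
    unfolding average_at_def using translate_right_K[OF x]
    by (subst sum_reps_right[where f = "\<lambda>r. translate G r x _"]) (auto simp: i)
  finally show ?thesis .
qed

lemma average_at_sum: "average_at n (\<lambda>c. \<Sum>s\<in>S. x s c) = (\<lambda>c. \<Sum>s\<in>S. average_at n (x s) c)"
  unfolding average_at_def translate_sum by (subst sum.swap) (simp add: sum_distrib_left)

lemma average_at_scale: "average_at n (\<lambda>c. a * x c) = (\<lambda>c. a * average_at n x c)"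
  by (simp add: average_at_def translate_scale sum_distrib_left mult.left_commute)

lemma average_at_add: "average_at n (\<lambda>c. x c + y c) = (\<lambda>c. average_at n x c + average_at n y c)"
  by (simp add: average_at_def translate_add sum.distrib algebra_simps)

lemma average_at_hecke: "h \<in> carrier H \<Longrightarrow> x \<in> XX \<Longrightarrow> average_at n (h x) = h (average_at n x)"
  unfolding average_at_def
  by (subst hecke_scale, assumption, (intro X_sum X_translate; simp add: reps_carrier),
      subst hecke_sum) (simp_all add: hecke_translate X_translate reps_carrier)

text \<open>The level-n mean of the level-m mean is computed twice. It is the level-m mean, which is
  already I-fixed; and by linearity it is the level-n mean of \<open>x\<close>, because all
  I-translates of \<open>x\<close> have the same level-n mean. Representatives of different levels
  are never compared.\<close>

lemma average_at_indep:
  assumes m: "x \<in> Y m" and n: "x \<in> Y n" shows "average_at m x = average_at n x"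
proof -
  have "average_at m x = average_at n (average_at m x)"
    using average_at_id[OF average_at_XI[OF m]] by simp
  also have "\<dots> = (\<lambda>c. inverse (of_nat (card (reps m))) * (\<Sum>r\<in>reps m. average_at n (translate G r x) c))"
    unfolding average_at_def[of m] average_at_scale average_at_sum ..
  also have "\<dots> = average_at n x"
    using reps(4)[of m] by (simp add: average_at_translate[OF n] reps_I flip: mult.assoc)
  finally show ?thesis .
qed

text \<open>By \<open>average_at_indep\<close> any level \<open>n\<close> at which \<open>x\<close> is fixed could be used here.\<close>

definition average :: "('g set \<Rightarrow> 'k) \<Rightarrow> ('g set \<Rightarrow> 'k)" where
  "average x = average_at (LEAST n. x \<in> Y n) x"

lemma average_eq: "x \<in> Y n \<Longrightarrow> average x = average_at n x"
  unfolding average_def by (meson LeastI average_at_indep)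

lemma average_XI: "x \<in> XX \<Longrightarrow> average x \<in> XI"
  using X_Y average_eq average_at_XI by metis

lemma average_add:
  assumes "x \<in> XX" "y \<in> XX" shows "average (\<lambda>c. x c + y c) = (\<lambda>c. average x c + average y c)"
proof -
  obtain m n where "x \<in> Y m" "y \<in> Y n" using X_Y assms by blast
  then have "x \<in> Y (max m n)" "y \<in> Y (max m n)"
    by (auto intro: Y_mono[OF max.cobounded1] Y_mono[OF max.cobounded2])
  then show ?thesis by (simp add: average_eq[of _ "max m n"] fixed_add average_at_add)
qed

lemma average_hecke:
  assumes h: "h \<in> carrier H" and "x \<in> XX" shows "average (h x) = h (average x)"
proof -
  obtain n where "x \<in> Y n" using X_Y assms by blast
  moreover from this have "h x \<in> Y n" by (rule fixed_hecke[OF subsetI h, rotated]) (simp add: K_carrier)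
  ultimately show ?thesis using assms by (simp add: average_eq[of _ n] average_at_hecke)
qed

section \<open>The identification of the fixed vectors with the Hecke algebra\<close>

definition rep :: "'g set \<Rightarrow> 'g" where "rep d = (SOME g. g \<in> d)"

lemma lcoset_mem: "g \<in> carrier G \<Longrightarrow> g' \<in> g \<rhd> I \<longleftrightarrow> (\<exists>i\<in>I. g' = g \<otimes> i)"
  by (auto simp: l_coset_def)

text \<open>Two elements of gI differ on the right by an element of \<open>I\<close>, which fixes
  \<open>y\<close>; so the choice made by \<open>rep\<close> is harmless.\<close>

lemma translate_rep:
  assumes y: "y \<in> XI" and g: "g \<in> carrier G" shows "translate G (rep (g \<rhd> I)) y = translate G g y"
proof -
  have "rep (g \<rhd> I) \<in> g \<rhd> I"
    unfolding rep_def using lcos_self[OF g I] by (rule someI)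
  then obtain i where "i \<in> I" "rep (g \<rhd> I) = g \<otimes> i" using g by (auto simp: lcoset_mem)
  then show ?thesis
    using g y by (simp add: translate_translate[symmetric] I_carrier fixed_translate)
qed

text \<open>Frobenius reciprocity: the equivariant endomorphism that sends char_I to the I-fixed
  vector \<open>y\<close>, hence the inverse of evaluation at char_I.\<close>

definition hecke_of :: "('g set \<Rightarrow> 'k) \<Rightarrow> ('g, 'k) hecke" where
  "hecke_of y = (\<lambda>x\<in>XX. \<lambda>c. \<Sum>d | x d \<noteq> 0. x d * translate G (rep d) y c)"

text \<open>The index set in the definition varies with \<open>x\<close>; linearity is checked over
  one finite set containing all supports that occur.\<close>

lemma hecke_of_superset:
  assumes "x \<in> XX" "finite S" "{d. x d \<noteq> 0} \<subseteq> S"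
  shows "hecke_of y x = (\<lambda>c. \<Sum>d\<in>S. x d * translate G (rep d) y c)"
  unfolding hecke_of_def using assms by (auto simp: fun_eq_iff intro!: sum.mono_neutral_left)

lemma rep_carrier: "d \<in> lcosets I \<Longrightarrow> rep d \<in> carrier G"
proof -
  assume "d \<in> lcosets I"
  then obtain g where g: "g \<in> carrier G" "d = g \<rhd> I" by (auto simp: lcosets_I)
  then have "rep d \<in> d"
    unfolding rep_def using lcos_self[OF g(1) I] by (auto intro: someI)
  then show ?thesis using g I I_carrier by (auto simp: lcoset_mem)
qed

lemma hecke_of_closed:
  assumes y: "y \<in> XI" shows "hecke_of y \<in> carrier H"
  unfolding hecke_carrier
proof (intro conjI ballI allI)
  show "hecke_of y \<in> XX \<rightarrow>\<^sub>E XX"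
    unfolding hecke_of_def
    by (intro restrict_PiE PiE_I) (auto intro!: X_sum X_scale X_translate rep_carrier fixed_X[OF y] intro: X_lcosets)
next
  fix x x' assume x: "x \<in> XX" "x' \<in> XX"
  let ?S = "{d. x d \<noteq> 0} \<union> {d. x' d \<noteq> 0}"
  have S: "finite ?S" using x by (simp add: X_finite)
  show "hecke_of y (\<lambda>c. x c + x' c) = (\<lambda>c. hecke_of y x c + hecke_of y x' c)"
    using x by (subst (1 2 3) hecke_of_superset[OF _ S]) (auto simp: X_add algebra_simps sum.distrib)
next
  fix a x assume x: "x \<in> XX"
  show "hecke_of y (\<lambda>c. a * x c) = (\<lambda>c. a * hecke_of y x c)"
    using x by (subst (1 2) hecke_of_superset[OF _ X_finite[OF x]]) (auto simp: X_scale algebra_simps sum_distrib_left)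
next
  fix g x assume g: "g \<in> carrier G" and x: "x \<in> XX"
  \<comment> \<open>Equivariance is a reindexing of the defining sum along the map d to gd: the
    support moves with g, and the representative of gd acts on \<open>y\<close> like g followed
    after the representative of d.\<close>
  have supp: "{c. translate G g x c \<noteq> 0} = l_coset G g ` {c. x c \<noteq> 0}"
    by (rule translate_support[OF g])
  have inj: "inj_on (l_coset G g) S" for S
    by (rule inj_onI) (metis lcos_eq_iff[OF g])
  have rep: "translate G (rep (g \<rhd> d)) y = translate G g (translate G (rep d) y)" if d: "x d \<noteq> 0" for d
  proof -
    obtain h where "h \<in> carrier G" "d = h \<rhd> I"
      using X_lcosets[OF x d] by (auto simp: lcosets_I)
    then show ?thesis using g by (simp add: lcos_lcos translate_rep[OF y] translate_translate)
  qed
  have val: "translate G g x (g \<rhd> d) = x d" for d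
    by (simp add: translate_def lcos_lcos g lcos_one)
  show "hecke_of y (translate G g x) = translate G g (hecke_of y x)"
    using x g unfolding hecke_of_def
    by (simp add: X_translate supp sum.reindex[OF inj] rep val translate_sum translate_scale cong: sum.cong_simp)
qed

lemma hecke_of_delta: "y \<in> XI \<Longrightarrow> hecke_of y (delta \<one>) = y"
proof -
  assume y: "y \<in> XI"
  have "{d. delta \<one> d \<noteq> 0} = {\<one> \<rhd> I}" "delta \<one> (\<one> \<rhd> I) = 1"
    by (auto simp: delta_def)
  then show ?thesis
    using y by (simp add: hecke_of_def delta_X translate_rep translate_one)
qed

lemma hecke_of_eqI: "h \<in> carrier H \<Longrightarrow> y \<in> XI \<Longrightarrow> h (delta \<one>) = y \<Longrightarrow> hecke_of y = h"
  by (rule hecke_eqI) (auto simp: hecke_of_closed hecke_of_delta)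

section \<open>Duals and the modules \<open>Z\<^sub>m\<close>\<close>

lemma dual_simps:
  "\<zero>\<^bsub>dual G I Z\<^esub> = (\<lambda>x\<in>Z. \<zero>\<^bsub>H\<^esub>)" "l \<oplus>\<^bsub>dual G I Z\<^esub> l' = (\<lambda>x\<in>Z. l x \<oplus>\<^bsub>H\<^esub> l' x)"
  "h \<odot>\<^bsub>dual G I Z\<^esub> l = (\<lambda>x\<in>Z. h \<otimes>\<^bsub>H\<^esub> l x)"
  by (simp_all add: dual_def Let_def)

lemma dual_carrier: "l \<in> carrier (dual G I Z) \<longleftrightarrow> l \<in> Z \<rightarrow>\<^sub>E carrier H \<and>
       (\<forall>x\<in>Z. \<forall>y\<in>Z. l (\<lambda>c. x c + y c) = l x \<oplus>\<^bsub>H\<^esub> l y) \<and>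
       (\<forall>x\<in>Z. \<forall>h\<in>carrier H. l (h x) = l x \<otimes>\<^bsub>H\<^esub> h)"
  by (simp add: dual_def Let_def)

text \<open>The averaging projector of the universal module onto its \<open>I\<close>-fixed vectors, viewed through
  \<open>hecke_of\<close> as an element of the dual: it splits the inclusion of the \<open>I\<close>-fixed vectors.\<close>

definition proj :: "('g set \<Rightarrow> 'k) \<Rightarrow> ('g, 'k) hecke" where
  "proj = (\<lambda>x\<in>XX. hecke_of (average x))"

text \<open>By \<open>hecke_of_eqI\<close> both identities may be tested at char_I. There they turn
  into additivity of \<open>average\<close> and its compatibility with Hecke operators; the product
  in H is composition in reverse order, so \<open>h\<close> stands on the right.\<close>

lemma proj_dual: "proj \<in> carrier D"
  unfolding dual_carrier
proof (intro conjI ballI)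
  show "proj \<in> XX \<rightarrow>\<^sub>E carrier H"
    by (auto simp: proj_def intro: hecke_of_closed average_XI)
next
  fix x y assume x: "x \<in> XX" and y: "y \<in> XX"
  have "hecke_of (average (\<lambda>c. x c + y c)) = hecke_of (average x) \<oplus>\<^bsub>H\<^esub> hecke_of (average y)"
  proof (rule hecke_of_eqI)
    show "hecke_of (average x) \<oplus>\<^bsub>H\<^esub> hecke_of (average y) \<in> carrier H"
      by (rule hecke_add_closed[OF hecke_of_closed[OF average_XI[OF x]] hecke_of_closed[OF average_XI[OF y]]])
    show "average (\<lambda>c. x c + y c) \<in> XI"
      by (rule average_XI[OF X_add[OF x y]])
    show "(hecke_of (average x) \<oplus>\<^bsub>H\<^esub> hecke_of (average y)) (delta \<one>) = average (\<lambda>c. x c + y c)"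
      unfolding hecke_simps average_add[OF x y] using x y by (simp add: delta_X hecke_of_delta average_XI)
  qed
  then show "proj (\<lambda>c. x c + y c) = proj x \<oplus>\<^bsub>H\<^esub> proj y"
    unfolding proj_def using x y X_add[OF x y] by simp
next
  fix x h assume x: "x \<in> XX" and h: "h \<in> carrier H"
  have "hecke_of (average (h x)) = hecke_of (average x) \<otimes>\<^bsub>H\<^esub> h"
  proof (rule hecke_of_eqI)
    show "hecke_of (average x) \<otimes>\<^bsub>H\<^esub> h \<in> carrier H"
      by (rule hecke_mult_closed[OF hecke_of_closed[OF average_XI[OF x]] h])
    show "average (h x) \<in> XI"
      by (rule average_XI[OF hecke_X[OF h x]])
    show "(hecke_of (average x) \<otimes>\<^bsub>H\<^esub> h) (delta \<one>) = average (h x)"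
      unfolding hecke_simps average_hecke[OF h x] using x by (simp add: delta_X hecke_of_delta average_XI)
  qed
  then show "proj (h x) = proj x \<otimes>\<^bsub>H\<^esub> h"
    unfolding proj_def using x hecke_X[OF h x] by simp
qed

lemma proj_delta: "proj (delta \<one>) = \<one>\<^bsub>H\<^esub>"
proof -
  have "average (delta \<one>) = delta \<one>"
    using average_eq[OF XI_Y[OF delta_one_XI]] average_at_id[OF delta_one_XI] by metis
  moreover have "hecke_of (delta \<one>) = \<one>\<^bsub>H\<^esub>"
    by (rule hecke_of_eqI[OF hecke_one_closed delta_one_XI]) (simp add: hecke_simps(2) delta_X)
  ultimately show ?thesis
    by (simp add: proj_def delta_X)
qed

lemma proj_apply_delta: "x \<in> XX \<Longrightarrow> proj x (delta \<one>) = average x"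
  by (simp add: proj_def hecke_of_delta average_XI)

abbreviation fixv :: "'g set \<Rightarrow> ('g set \<Rightarrow> 'k) set" where "fixv L \<equiv> fixed_vectors G I L"

text \<open>Presents the universal module as the fixed vectors of the empty set, so that the lemmas
  on duals of fixed vectors cover its full dual too.\<close>

lemma XX_fixed: "XX = fixed_vectors G I {}"
  by (simp add: fixed_vectors_def)

lemma dual_val: "l \<in> carrier (dual G I Z) \<Longrightarrow> x \<in> Z \<Longrightarrow> l x \<in> carrier H"
  and dual_add: "l \<in> carrier (dual G I Z) \<Longrightarrow> x \<in> Z \<Longrightarrow> y \<in> Z \<Longrightarrow> l (\<lambda>c. x c + y c) = l x \<oplus>\<^bsub>H\<^esub> l y"
  and dual_hecke: "l \<in> carrier (dual G I Z) \<Longrightarrow> x \<in> Z \<Longrightarrow> h \<in> carrier H \<Longrightarrow> l (h x) = l x \<otimes>\<^bsub>H\<^esub> h"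
  by (auto simp: dual_carrier)

text \<open>Scalars act on the universal module as the Hecke operators \<open>scal a\<close>, so
  k-linearity of a functional is a case of H-linearity.\<close>

lemma dual_scale:
  assumes l: "l \<in> carrier (dual G I Z)" and x: "x \<in> Z" "x \<in> XX"
  shows "l (\<lambda>c. a * x c) = l x \<otimes>\<^bsub>H\<^esub> scal a"
  using dual_hecke[OF l x(1) scal_closed[of a]] by (simp add: scal_apply x)

lemma dual_zero:
  assumes "l \<in> carrier (dual G I (fixv L))" shows "l (\<lambda>c. 0) = \<zero>\<^bsub>H\<^esub>"
proof -
  interpret H: ring H by (rule hecke_ring)
  show ?thesis
    using dual_scale[OF assms fixed_zero X_zero, of 0] dual_val[OF assms fixed_zero] by (simp add: scal_ring)
qed

lemma dual_closed:
  fixes L defines "Z \<equiv> fixv L"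
  assumes L: "L \<subseteq> carrier G"
  shows "(\<lambda>x\<in>Z. \<zero>\<^bsub>H\<^esub>) \<in> carrier (dual G I Z)"
    and "l \<in> carrier (dual G I Z) \<Longrightarrow> l' \<in> carrier (dual G I Z) \<Longrightarrow> (\<lambda>x\<in>Z. l x \<oplus>\<^bsub>H\<^esub> l' x) \<in> carrier (dual G I Z)"
    and "l \<in> carrier (dual G I Z) \<Longrightarrow> (\<lambda>x\<in>Z. \<ominus>\<^bsub>H\<^esub> l x) \<in> carrier (dual G I Z)"
    and "l \<in> carrier (dual G I Z) \<Longrightarrow> h \<in> carrier H \<Longrightarrow> (\<lambda>x\<in>Z. h \<otimes>\<^bsub>H\<^esub> l x) \<in> carrier (dual G I Z)"
proof -
  interpret H: ring H by (rule hecke_ring)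
  have add: "(\<lambda>c. x c + y c) \<in> Z" if "x \<in> Z" "y \<in> Z" for x y
    using that by (simp add: Z_def fixed_add)
  have act: "h x \<in> Z" if "x \<in> Z" "h \<in> carrier H" for x h
    using that fixed_hecke[OF L] by (simp add: Z_def)
  show "(\<lambda>x\<in>Z. \<zero>\<^bsub>H\<^esub>) \<in> carrier (dual G I Z)"
    unfolding dual_carrier by (simp add: add act)
  show "(\<lambda>x\<in>Z. \<ominus>\<^bsub>H\<^esub> l x) \<in> carrier (dual G I Z)" if l: "l \<in> carrier (dual G I Z)"
    unfolding dual_carrier using l by (simp add: add act dual_val[OF l] dual_add[OF l] dual_hecke[OF l]
      H.minus_add H.l_minus H.a_comm)
  show "(\<lambda>x\<in>Z. l x \<oplus>\<^bsub>H\<^esub> l' x) \<in> carrier (dual G I Z)"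
    if l: "l \<in> carrier (dual G I Z)" and l': "l' \<in> carrier (dual G I Z)"
    unfolding dual_carrier by (simp add: add act dual_val[OF l] dual_add[OF l] dual_hecke[OF l]
      dual_val[OF l'] dual_add[OF l'] dual_hecke[OF l'] H.l_distr H.a_ac)
  show "(\<lambda>x\<in>Z. h \<otimes>\<^bsub>H\<^esub> l x) \<in> carrier (dual G I Z)"
    if l: "l \<in> carrier (dual G I Z)" and h: "h \<in> carrier H"
    unfolding dual_carrier using h by (simp add: add act dual_val[OF l] dual_add[OF l] dual_hecke[OF l]
      H.r_distr H.m_assoc)
qed

lemma dual_group:
  assumes L: "L \<subseteq> carrier G"
  shows "abelian_group (dual G I (fixv L))"
    and "l \<in> carrier (dual G I (fixv L)) \<Longrightarrow>
      \<ominus>\<^bsub>dual G I (fixv L)\<^esub> l = (\<lambda>x\<in>fixv L. \<ominus>\<^bsub>H\<^esub> l x)"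
proof -
  let ?Z = "fixv L"
  have sub: "carrier (dual G I ?Z) \<subseteq> ?Z \<rightarrow>\<^sub>E carrier H" by (auto simp only: dual_carrier)
  note pg = pointwise_abelian_group[OF ring.is_abelian_group[OF hecke_ring] sub]
  show "abelian_group (dual G I ?Z)"
    by (rule pg(1)) (use dual_closed[OF L] in \<open>simp_all only: dual_simps\<close>)
  show "\<ominus>\<^bsub>dual G I ?Z\<^esub> l = (\<lambda>x\<in>?Z. \<ominus>\<^bsub>H\<^esub> l x)" if "l \<in> carrier (dual G I ?Z)"
    by (rule pg(2)) (use dual_closed[OF L] that in \<open>simp_all only: dual_simps\<close>)
qed

lemma dual_act_closed:
  fixes l :: "('g set \<Rightarrow> 'k) \<Rightarrow> ('g, 'k) hecke"
  assumes g: "g \<in> carrier G" and l: "l \<in> carrier (dual G I (fixv L))" and L: "L \<subseteq> carrier G"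
    and stable: "\<And>x :: 'g set \<Rightarrow> 'k. x \<in> fixv L \<Longrightarrow> translate G g x \<in> fixv L"
  shows "dual_act G (fixv L) g l \<in> carrier (dual G I (fixv L))"
  unfolding dual_carrier dual_act_def
  using fixed_hecke[OF L]
  by (auto simp: stable fixed_add translate_add dual_val[OF l] dual_add[OF l] dual_hecke[OF l]
      hecke_translate[OF _ g fixed_X, symmetric])

lemma dual_act_D: "g \<in> carrier G \<Longrightarrow> l \<in> carrier D \<Longrightarrow> dual_act G XX g l \<in> carrier D"
  using dual_act_closed[of g l "{}", folded XX_fixed] by (simp add: X_translate)

lemma dual_restrict:
  assumes l: "l \<in> carrier D" and L: "L \<subseteq> carrier G"
  shows "restrict l (fixv L) \<in> carrier (dual G I (fixv L))"
  unfolding dual_carrier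
  using fixed_hecke[OF L] fixed_X[of _ L]
  by (auto simp: fixed_add dual_val[OF l] dual_add[OF l] dual_hecke[OF l])

section \<open>The modules of restricted functionals and their coinvariants\<close>

abbreviation Zn where "Zn n \<equiv> Z_bold G I (K n) :: (('g, 'k) hecke, ('g set \<Rightarrow> 'k) \<Rightarrow> ('g, 'k) hecke) module"

lemma Zn_simps: "carrier (Zn n) = (\<lambda>l. restrict l (Y n)) ` carrier D"
  "\<zero>\<^bsub>Zn n\<^esub> = (\<lambda>x\<in>Y n. \<zero>\<^bsub>H\<^esub>)" "l \<oplus>\<^bsub>Zn n\<^esub> l' = (\<lambda>x\<in>Y n. l x \<oplus>\<^bsub>H\<^esub> l' x)"
  by (simp_all add: Z_bold_def Let_def dual_simps)

lemma K_subset: "K n \<subseteq> carrier G"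
  using K_carrier by blast

lemma Zn_dual: "carrier (Zn n) \<subseteq> carrier (dual G I (Y n))"
  using dual_restrict[OF _ K_subset] by (auto simp: Zn_simps)

text \<open>Each operation on restrictions is the restriction of the same operation on functionals
  of the whole universal module, where closure is known. For the action of \<open>I\<close> this
  also uses that \<open>Y n\<close> is stable under \<open>I\<close>.\<close>

lemma Zn_closed:
  shows "(\<lambda>x\<in>Y n. \<zero>\<^bsub>H\<^esub>) \<in> carrier (Zn n)"
    and "l \<in> carrier (Zn n) \<Longrightarrow> l' \<in> carrier (Zn n) \<Longrightarrow> (\<lambda>x\<in>Y n. l x \<oplus>\<^bsub>H\<^esub> l' x) \<in> carrier (Zn n)"
    and "l \<in> carrier (Zn n) \<Longrightarrow> (\<lambda>x\<in>Y n. \<ominus>\<^bsub>H\<^esub> l x) \<in> carrier (Zn n)"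
    and "l \<in> carrier (Zn n) \<Longrightarrow> h \<in> carrier H \<Longrightarrow> (\<lambda>x\<in>Y n. h \<otimes>\<^bsub>H\<^esub> l x) \<in> carrier (Zn n)"
    and "l \<in> carrier (Zn n) \<Longrightarrow> i \<in> I \<Longrightarrow> dual_act G (Y n) i l \<in> carrier (Zn n)"
proof -
  have restr: "(\<lambda>x\<in>Y n. F x) \<in> carrier (Zn n)" if "(\<lambda>x\<in>XX. F x) \<in> carrier D" for F
  proof -
    have "restrict (\<lambda>x\<in>XX. F x) (Y n) = (\<lambda>x\<in>Y n. F x)"
      using fixed_X by (auto simp: restrict_def fun_eq_iff)
    then show ?thesis using that unfolding Zn_simps by (metis imageI)
  qed
  note cl = dual_closed[of "{}", simplified, folded XX_fixed]
  show "(\<lambda>x\<in>Y n. \<zero>\<^bsub>H\<^esub>) \<in> carrier (Zn n)"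
    by (rule restr[OF cl(1)])
  show "(\<lambda>x\<in>Y n. l x \<oplus>\<^bsub>H\<^esub> l' x) \<in> carrier (Zn n)" if "l \<in> carrier (Zn n)" "l' \<in> carrier (Zn n)"
    using that restr[OF cl(2)] by (auto simp: Zn_simps cong: restrict_cong)
  show "(\<lambda>x\<in>Y n. \<ominus>\<^bsub>H\<^esub> l x) \<in> carrier (Zn n)" if "l \<in> carrier (Zn n)"
    using that restr[OF cl(3)] by (auto simp: Zn_simps cong: restrict_cong)
  show "(\<lambda>x\<in>Y n. h \<otimes>\<^bsub>H\<^esub> l x) \<in> carrier (Zn n)" if "l \<in> carrier (Zn n)" "h \<in> carrier H"
    using that restr[OF cl(4)] by (auto simp: Zn_simps cong: restrict_cong)
  show "dual_act G (Y n) i l \<in> carrier (Zn n)" if "l \<in> carrier (Zn n)" "i \<in> I"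
    using that restr[OF dual_act_D[unfolded dual_act_def]]
    by (auto simp: Zn_simps dual_act_def I_carrier Y_translate_I cong: restrict_cong)
qed

lemma Zn_group: "abelian_group (Zn n)"
  and Zn_minus: "l \<in> carrier (Zn n) \<Longrightarrow> \<ominus>\<^bsub>Zn n\<^esub> l = (\<lambda>x\<in>Y n. \<ominus>\<^bsub>H\<^esub> l x)"
proof -
  have sub: "carrier (Zn n) \<subseteq> Y n \<rightarrow>\<^sub>E carrier H"
    using Zn_dual[of n] unfolding dual_carrier subset_iff by blast
  note pg = pointwise_abelian_group[OF ring.is_abelian_group[OF hecke_ring] sub]
  show "abelian_group (Zn n)"
    by (rule pg(1)) (use Zn_closed(1-3)[where n = n] in \<open>simp_all only: Zn_simps(2,3)\<close>)
  show "\<ominus>\<^bsub>Zn n\<^esub> l = (\<lambda>x\<in>Y n. \<ominus>\<^bsub>H\<^esub> l x)" if "l \<in> carrier (Zn n)"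
    by (rule pg(2)) (use Zn_closed(1-3)[where n = n] that in \<open>simp_all only: Zn_simps(2,3)\<close>)
qed

text \<open>A relation i l - l takes the value l(i y) - l(y) = 0 at an I-fixed \<open>y\<close>. The
  group \<open>S\<close> is kept abstract because the coinvariants of \<open>Zn n\<close> and of the
  full dual of \<open>Y n\<close> both occur in the definition of \<open>Z_mod\<close>.\<close>

lemma coinv_rel_vanish:
  assumes sub: "carrier S \<subseteq> carrier (dual G I (Y n))"
    and zero: "\<zero>\<^bsub>S\<^esub> = (\<lambda>x\<in>Y n. \<zero>\<^bsub>H\<^esub>)"
    and add: "\<And>l l'. l \<oplus>\<^bsub>S\<^esub> l' = (\<lambda>x\<in>Y n. l x \<oplus>\<^bsub>H\<^esub> l' x)"
    and minus: "\<And>l. l \<in> carrier S \<Longrightarrow> \<ominus>\<^bsub>S\<^esub> l = (\<lambda>x\<in>Y n. \<ominus>\<^bsub>H\<^esub> l x)"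
    and closed: "\<And>i l. i \<in> I \<Longrightarrow> l \<in> carrier S \<Longrightarrow> dual_act G (Y n) i l \<oplus>\<^bsub>S\<^esub> \<ominus>\<^bsub>S\<^esub> l \<in> carrier S"
    and w: "w \<in> coinv_rel (add_monoid S) I (dual_act G (Y n))" and y: "y \<in> XI"
  shows "w y = \<zero>\<^bsub>H\<^esub>"
proof -
  interpret H: ring H by (rule hecke_ring)
  note y' = XI_Y[OF y, of n]
  have gen: "(dual_act G (Y n) i l \<oplus>\<^bsub>S\<^esub> \<ominus>\<^bsub>S\<^esub> l) y = \<zero>\<^bsub>H\<^esub>" if "i \<in> I" "l \<in> carrier S" for i l
    using that y' sub dual_val[of l "Y n" y] by (auto simp: add minus dual_act_def fixed_translate[OF y] H.r_neg)
  from w show ?thesis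
    unfolding coinv_rel_def a_inv_def[symmetric]
  proof (induction rule: generate.induct)
    case one
    then show ?case using y' by (simp add: zero)
  next
    case (incl h)
    then show ?case using gen by auto
  next
    case (inv h)
    then show ?case using gen closed y' minus by (auto simp flip: a_inv_def)
  next
    case (eng h1 h2)
    then show ?case using y' by (simp add: add)
  qed
qed

text \<open>If \<open>l\<close> kills the \<open>I\<close>-fixed vectors, then \<open>l(x) = l(x - e x)\<close> for the averaging projector \<open>e\<close>, and
  \<open>x - e x\<close> is the mean of the \<open>x - r x\<close> over representatives \<open>r\<close> of \<open>I/K\<^sub>m\<close>; hence \<open>l\<close> is a sum of
  the relations defining the coinvariants.\<close>

lemma Z_mod_trivial:
  "(Z_mod G I (K n) :: (('g set \<Rightarrow> 'k) \<Rightarrow> ('g, 'k) hecke) set set) = {\<one>\<^bsub>Z_bold_coinv G I (K n)\<^esub>}"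
proof -
  interpret H: ring H by (rule hecke_ring)
  define Dn where "Dn = dual G I (Y n)"
  define W where "W = coinv_rel (add_monoid (Zn n)) I (dual_act G (Y n))"
  define V where "V = coinv_rel (add_monoid Dn) I (dual_act G (Y n))"
  interpret Zn: abelian_group "Zn n" by (rule Zn_group)
  have Zg: "group (add_monoid (Zn n))" by (rule Zn.a_group)
  have act_dual: "dual_act G (Y n) i l \<in> carrier Dn" if "i \<in> I" "l \<in> carrier Dn" for i l
    using that unfolding Dn_def by (intro dual_act_closed) (auto simp only: I_carrier K_carrier Y_translate_I)
  have W_gen: "{dual_act G (Y n) i l \<otimes>\<^bsub>add_monoid (Zn n)\<^esub> inv\<^bsub>add_monoid (Zn n)\<^esub> l | i l.
      i \<in> I \<and> l \<in> carrier (add_monoid (Zn n))} \<subseteq> carrier (add_monoid (Zn n))"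
    using Zn_closed(5)[where n = n] by (auto simp flip: a_inv_def)
  have W: "subgroup W (add_monoid (Zn n))"
    unfolding W_def coinv_rel_def by (rule group.generate_is_subgroup[OF Zg W_gen])
  have W_add: "w \<oplus>\<^bsub>Zn n\<^esub> w' \<in> W" if "w \<in> W" "w' \<in> W" for w w'
    using subgroup.m_closed[OF W that] by simp
  have W_vanish: "w y = \<zero>\<^bsub>H\<^esub>" if "w \<in> W" "y \<in> XI" for w y
    by (rule coinv_rel_vanish[OF Zn_dual Zn_simps(2,3) Zn_minus _ that[unfolded W_def]])
       (auto intro!: Zn.a_closed Zn_closed(5))
  have V_vanish: "v y = \<zero>\<^bsub>H\<^esub>" if "v \<in> V" "y \<in> XI" for v y
  proof (rule coinv_rel_vanish[OF _ _ _ _ _ that[unfolded V_def]])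
    interpret Dn: abelian_group Dn unfolding Dn_def by (rule dual_group[OF K_subset])
    show "dual_act G (Y n) i l \<oplus>\<^bsub>Dn\<^esub> \<ominus>\<^bsub>Dn\<^esub> l \<in> carrier Dn" if "i \<in> I" "l \<in> carrier Dn" for i l
      using that by (auto intro!: Dn.a_closed act_dual)
  qed (use dual_group(2)[OF K_subset] in \<open>auto simp: Dn_def dual_simps\<close>)
  \<comment> \<open>In \<open>Z_mod\<close> the map on cosets is the sole element of an image. It
    exists because elements of \<open>W\<close> and \<open>V\<close> vanish on \<open>XI\<close>, so
    that all members of the enlarged coset of \<open>l\<close> have the same restriction.\<close>
  have map_eq: "the_elem ((\<lambda>l. restrict l XI) ` ((W #>\<^bsub>add_monoid (Zn n)\<^esub> l) <#>\<^bsub>add_monoid Dn\<^esub> V)) = restrict l XI"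
    if l: "l \<in> carrier (Zn n)" for l
  proof -
    have eq: "restrict (w \<oplus>\<^bsub>Zn n\<^esub> l \<oplus>\<^bsub>Dn\<^esub> v) XI = restrict l XI" if "w \<in> W" "v \<in> V" for w v
    proof (rule restrict_ext)
      fix y assume y: "y \<in> XI"
      moreover have "l y \<in> carrier H"
        by (rule dual_val[OF subsetD[OF Zn_dual l] XI_Y[OF y]])
      ultimately show "(w \<oplus>\<^bsub>Zn n\<^esub> l \<oplus>\<^bsub>Dn\<^esub> v) y = l y"
        using XI_Y[OF y, of n] by (simp add: Dn_def dual_simps Zn_simps(3) W_vanish[OF that(1) y] V_vanish[OF that(2) y])
    qed
    have W0: "\<zero>\<^bsub>Zn n\<^esub> \<in> W"
      using subgroup.one_closed[OF W] by simp
    have V0: "\<zero>\<^bsub>Dn\<^esub> \<in> V"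
      unfolding V_def coinv_rel_def using generate.one[of "add_monoid Dn"] by simp
    let ?S = "(W #>\<^bsub>add_monoid (Zn n)\<^esub> l) <#>\<^bsub>add_monoid Dn\<^esub> V"
    have S: "a \<in> ?S \<longleftrightarrow> (\<exists>w\<in>W. \<exists>v\<in>V. a = w \<oplus>\<^bsub>Zn n\<^esub> l \<oplus>\<^bsub>Dn\<^esub> v)" for a
      unfolding r_coset_def set_mult_def by auto
    have "\<zero>\<^bsub>Zn n\<^esub> \<oplus>\<^bsub>Zn n\<^esub> l \<oplus>\<^bsub>Dn\<^esub> \<zero>\<^bsub>Dn\<^esub> \<in> ?S"
      unfolding S by (rule bexI[OF bexI[OF refl V0] W0])
    moreover have "restrict a XI = restrict l XI" if a: "a \<in> ?S" for a
    proof -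
      obtain w v where "w \<in> W" "v \<in> V" and av: "a = w \<oplus>\<^bsub>Zn n\<^esub> l \<oplus>\<^bsub>Dn\<^esub> v"
        using a[unfolded S] by (elim bexE)
      then show ?thesis unfolding av by (intro eq)
    qed
    ultimately have "(\<lambda>l. restrict l XI) ` ?S = {restrict l XI}"
      by (intro equalityI subsetI) (auto simp only: image_iff singleton_iff, metis)
    then show ?thesis by simp
  qed
  have in_W: "l \<in> W" if l: "l \<in> carrier (Zn n)" and l0: "\<And>y. y \<in> XI \<Longrightarrow> l y = \<zero>\<^bsub>H\<^esub>" for l
  proof -
    let ?N = "of_nat (card (reps n)) :: 'k"
    have ld: "l \<in> carrier (dual G I (Y n))" using l Zn_dual by blast
    \<comment> \<open>The mean of the x - r x is -1/N times the sum of the r x - x. Absorbing this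
      central scalar into \<open>l'\<close> makes each summand l'(r x - x) the value at x of a
      generator r l' - l' of \<open>W\<close>.\<close>
    define l' where "l' = (\<lambda>x\<in>Y n. scal (- inverse ?N) \<otimes>\<^bsub>H\<^esub> l x)"
    have l': "l' \<in> carrier (Zn n)" unfolding l'_def by (rule Zn_closed(4)[OF l scal_closed])
    have ld': "l' \<in> carrier (dual G I (Y n))" using l' Zn_dual by blast
    \<comment> \<open>The difference is written with the factor \<open>- 1\<close>, so that only
      additivity and scaling of functionals and of fixed vectors are called upon.\<close>
    define d where "d r x = (\<lambda>c. translate G r x c + - 1 * x c)" for r and x :: "'g set \<Rightarrow> 'k"
    have d: "d r x \<in> Y n" if "r \<in> I" "x \<in> Y n" for r x
      unfolding d_def using that by (intro fixed_add fixed_scale Y_translate_I)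
    have dsum: "(\<lambda>c. \<Sum>r\<in>S. d r x c) \<in> Y n" if "S \<subseteq> I" "x \<in> Y n" for S x
      using that
      by (induction S rule: infinite_finite_induct) (auto simp: fixed_zero fixed_add d)
    have "(\<lambda>x\<in>Y n. l' (\<lambda>c. \<Sum>r\<in>S. d r x c)) \<in> W" if "finite S" "S \<subseteq> I" for S
      using that
    proof (induction S rule: finite_induct)
      case empty
      then show ?case
        using subgroup.one_closed[OF W] by (simp add: dual_zero[OF ld'] Zn_simps(2) restrict_def)
    next
      case (insert r S)
      have "(\<lambda>x\<in>Y n. l' (\<lambda>c. \<Sum>r\<in>insert r S. d r x c)) =
          (dual_act G (Y n) r l' \<oplus>\<^bsub>Zn n\<^esub> \<ominus>\<^bsub>Zn n\<^esub> l') \<oplus>\<^bsub>Zn n\<^esub> (\<lambda>x\<in>Y n. l' (\<lambda>c. \<Sum>r\<in>S. d r x c))"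
      proof -
        have "l' (\<lambda>c. \<Sum>r\<in>insert r S. d r x c) =
            (l' (translate G r x) \<oplus>\<^bsub>H\<^esub> \<ominus>\<^bsub>H\<^esub> l' x) \<oplus>\<^bsub>H\<^esub> l' (\<lambda>c. \<Sum>r\<in>S. d r x c)" if x: "x \<in> Y n" for x
        proof -
          have "l' (\<lambda>c. \<Sum>r\<in>insert r S. d r x c) = l' (d r x) \<oplus>\<^bsub>H\<^esub> l' (\<lambda>c. \<Sum>r\<in>S. d r x c)"
            using insert x by (simp add: dual_add[OF ld' d dsum])
          also have "l' (d r x) = l' (translate G r x) \<oplus>\<^bsub>H\<^esub> l' x \<otimes>\<^bsub>H\<^esub> scal (- 1)"
            unfolding d_def using insert x
            by (simp only: dual_add[OF ld' Y_translate_I fixed_scale] insert_subset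
                dual_scale[OF ld' x fixed_X[OF x]])
          also have "l' x \<otimes>\<^bsub>H\<^esub> scal (- 1) = \<ominus>\<^bsub>H\<^esub> l' x"
            using dual_val[OF ld' x] by (simp add: scal_ring scal_closed H.r_minus)
          finally show ?thesis .
        qed
        then show ?thesis
          by (auto simp: Zn_simps(3) Zn_minus[OF l'] dual_act_def)
      qed
      moreover have "dual_act G (Y n) r l' \<oplus>\<^bsub>Zn n\<^esub> \<ominus>\<^bsub>Zn n\<^esub> l' \<in> W"
        unfolding W_def coinv_rel_def a_inv_def using insert l' by (auto intro!: generate.incl)
      moreover have "(\<lambda>x\<in>Y n. l' (\<lambda>c. \<Sum>r\<in>S. d r x c)) \<in> W"
        using insert by blast
      ultimately show ?case
        by (simp only: W_add)
    qed
    then have "(\<lambda>x\<in>Y n. l' (\<lambda>c. \<Sum>r\<in>reps n. d r x c)) \<in> W"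
      using reps(1,2) by blast
    also have "(\<lambda>x\<in>Y n. l' (\<lambda>c. \<Sum>r\<in>reps n. d r x c)) = l"
    proof -
      have "l' (\<lambda>c. \<Sum>r\<in>reps n. d r x c) = l x" if x: "x \<in> Y n" for x
      proof -
        have ds: "(\<lambda>c. \<Sum>r\<in>reps n. d r x c) \<in> Y n" by (rule dsum[OF reps(1) x])
        have "l' (\<lambda>c. \<Sum>r\<in>reps n. d r x c) = l (\<lambda>c. \<Sum>r\<in>reps n. d r x c) \<otimes>\<^bsub>H\<^esub> scal (- inverse ?N)"
          using ds dual_val[OF ld ds] by (simp add: l'_def scal_central)
        also have "\<dots> = l (\<lambda>c. - inverse ?N * (\<Sum>r\<in>reps n. d r x c))"
          by (rule dual_scale[OF ld ds fixed_X[OF ds], symmetric])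
        also have "(\<lambda>c. - inverse ?N * (\<Sum>r\<in>reps n. d r x c)) = (\<lambda>c. x c + -1 * average_at n x c)"
          using reps(4)[of n] by (simp add: d_def average_at_def sum_subtractf algebra_simps flip: mult.assoc)
        also have "l \<dots> = l x \<oplus>\<^bsub>H\<^esub> l (average_at n x) \<otimes>\<^bsub>H\<^esub> scal (-1)"
          using average_at_XI[OF x]
          by (simp only: dual_add[OF ld x fixed_scale] XI_Y dual_scale[OF ld XI_Y fixed_X])
        also have "\<dots> = l x"
          using dual_val[OF ld x] by (simp add: l0 average_at_XI[OF x] scal_closed)
        finally show ?thesis .
      qed
      then show ?thesis
        using ld by (auto simp: dual_carrier fun_eq_iff PiE_def extensional_def)
    qed
    finally show ?thesis .
  qed
  have coinv: "Z_bold_coinv G I (K n) = (add_monoid (Zn n)) Mod W"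
    by (simp add: Z_bold_coinv_def coinvariants_def W_def)
  show ?thesis
  proof (intro equalityI subsetI)
    fix A assume "A \<in> (Z_mod G I (K n) :: (('g set \<Rightarrow> 'k) \<Rightarrow> ('g, 'k) hecke) set set)"
    then have A: "A \<in> rcosets\<^bsub>add_monoid (Zn n)\<^esub> W"
      and ker: "the_elem ((\<lambda>l. restrict l XI) ` (A <#>\<^bsub>add_monoid Dn\<^esub> V)) = (\<lambda>x\<in>XI. \<zero>\<^bsub>H\<^esub>)"
      unfolding Z_mod_def Let_def kernel_def coinv by (auto simp: FactGroup_def V_def Dn_def dual_simps)
    obtain l where l: "l \<in> carrier (Zn n)" "A = W #>\<^bsub>add_monoid (Zn n)\<^esub> l"
      using A by (auto simp: RCOSETS_def)
    have "l \<in> W"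
    proof (rule in_W[OF l(1)])
      fix y assume "y \<in> XI"
      then show "l y = \<zero>\<^bsub>H\<^esub>"
        using ker unfolding l(2) map_eq[OF l(1)] by (metis restrict_apply')
    qed
    then have "A = W"
      using l group.coset_join2[OF Zg _ W] by simp
    then show "A \<in> {\<one>\<^bsub>Z_bold_coinv G I (K n)\<^esub>}"
      by (simp add: coinv FactGroup_def)
  next
    fix A assume "A \<in> {\<one>\<^bsub>Z_bold_coinv G I (K n)\<^esub> :: (('g set \<Rightarrow> 'k) \<Rightarrow> ('g, 'k) hecke) set}"
    then have AW: "A = W" by (simp add: coinv FactGroup_def)
    have W0: "W = W #>\<^bsub>add_monoid (Zn n)\<^esub> \<zero>\<^bsub>Zn n\<^esub>"
      using group.coset_join2[OF Zg _ W, of "\<zero>\<^bsub>Zn n\<^esub>"] subgroup.one_closed[OF W] by simp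
    then have "W \<in> rcosets\<^bsub>add_monoid (Zn n)\<^esub> W"
      unfolding RCOSETS_def by auto
    moreover have "restrict \<zero>\<^bsub>Zn n\<^esub> XI = (\<lambda>x\<in>XI. \<zero>\<^bsub>H\<^esub>)"
      using XI_Y by (auto simp: Zn_simps(2) fun_eq_iff)
    then have "the_elem ((\<lambda>l. restrict l XI) ` (W <#>\<^bsub>add_monoid Dn\<^esub> V)) = (\<lambda>x\<in>XI. \<zero>\<^bsub>H\<^esub>)"
      using map_eq[OF Zn.zero_closed] unfolding W0[symmetric] by (rule trans[rotated])
    ultimately show "A \<in> Z_mod G I (K n)"
      unfolding AW Z_mod_def Let_def kernel_def coinv by (simp add: FactGroup_def V_def Dn_def dual_simps)
  qed
qed

end

section \<open>The representation \<open>t(M)\<close>\<close>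

locale hecke_module = averaging_setting G I K coeff_type +
  HM: left_module "hecke_algebra G I :: ('g, 'k) hecke ring" M
  for G :: "('g, 's) monoid_scheme" (structure) and I K and coeff_type :: "'k::field itself"
    and M :: "(('g, 'k) hecke, 'm) module"
begin

abbreviation tM where "tM \<equiv> t_obj G I M"

text \<open>The image under tau of the elementary tensor x \<otimes> m.\<close>

definition pure :: "('g set \<Rightarrow> 'k) \<Rightarrow> 'm \<Rightarrow> (('g set \<Rightarrow> 'k) \<Rightarrow> ('g, 'k) hecke) \<Rightarrow> 'm" where
  "pure x m = (\<lambda>l\<in>carrier D. l x \<odot>\<^bsub>M\<^esub> m)"

lemma D_val: "l \<in> carrier D \<Longrightarrow> x \<in> XX \<Longrightarrow> l x \<in> carrier H"
  by (rule dual_val)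

lemma smult_zero: "h \<in> carrier H \<Longrightarrow> h \<odot>\<^bsub>M\<^esub> \<zero>\<^bsub>M\<^esub> = \<zero>\<^bsub>M\<^esub>"
proof -
  assume h: "h \<in> carrier H"
  have "h \<odot>\<^bsub>M\<^esub> \<zero>\<^bsub>M\<^esub> \<oplus>\<^bsub>M\<^esub> h \<odot>\<^bsub>M\<^esub> \<zero>\<^bsub>M\<^esub> = h \<odot>\<^bsub>M\<^esub> \<zero>\<^bsub>M\<^esub>"
    using HM.smult_r_distr[OF h HM.M.zero_closed HM.M.zero_closed] by simp
  then show ?thesis
    using HM.smult_closed[OF h HM.M.zero_closed] by simp
qed

lemma smult_minus: "h \<in> carrier H \<Longrightarrow> m \<in> carrier M \<Longrightarrow> h \<odot>\<^bsub>M\<^esub> (\<ominus>\<^bsub>M\<^esub> m) = \<ominus>\<^bsub>M\<^esub> (h \<odot>\<^bsub>M\<^esub> m)"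
proof -
  assume h: "h \<in> carrier H" and m: "m \<in> carrier M"
  have "h \<odot>\<^bsub>M\<^esub> (\<ominus>\<^bsub>M\<^esub> m) \<oplus>\<^bsub>M\<^esub> h \<odot>\<^bsub>M\<^esub> m = \<zero>\<^bsub>M\<^esub>"
    using h m by (simp add: HM.smult_r_distr[symmetric] HM.M.l_neg smult_zero)
  then show ?thesis
    using h m by (intro HM.M.minus_equality[symmetric]) (auto intro: HM.smult_closed)
qed

lemma smult_diff: "h \<in> carrier H \<Longrightarrow> m \<in> carrier M \<Longrightarrow> m' \<in> carrier M \<Longrightarrow>
    h \<odot>\<^bsub>M\<^esub> (m \<ominus>\<^bsub>M\<^esub> m') = h \<odot>\<^bsub>M\<^esub> m \<ominus>\<^bsub>M\<^esub> h \<odot>\<^bsub>M\<^esub> m'"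
  by (simp add: a_minus_def HM.smult_r_distr smult_minus)

lemma minus_zero: "\<ominus>\<^bsub>M\<^esub> \<zero>\<^bsub>M\<^esub> = \<zero>\<^bsub>M\<^esub>"
  using HM.M.r_neg[OF HM.M.zero_closed] HM.M.a_inv_closed[OF HM.M.zero_closed] by simp

lemma finsum_minus:
  "finite S \<Longrightarrow> f \<in> S \<rightarrow> carrier M \<Longrightarrow> (\<Oplus>\<^bsub>M\<^esub>s\<in>S. \<ominus>\<^bsub>M\<^esub> f s) = \<ominus>\<^bsub>M\<^esub> (\<Oplus>\<^bsub>M\<^esub>s\<in>S. f s)"
  by (induction S rule: finite_induct) (auto simp: HM.M.minus_add minus_zero Pi_iff)

lemma zero_smult: "m \<in> carrier M \<Longrightarrow> \<zero>\<^bsub>H\<^esub> \<odot>\<^bsub>M\<^esub> m = \<zero>\<^bsub>M\<^esub>"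
proof -
  assume m: "m \<in> carrier M"
  have "\<zero>\<^bsub>H\<^esub> \<odot>\<^bsub>M\<^esub> m \<oplus>\<^bsub>M\<^esub> \<zero>\<^bsub>H\<^esub> \<odot>\<^bsub>M\<^esub> m = \<zero>\<^bsub>H\<^esub> \<odot>\<^bsub>M\<^esub> m"
    using HM.smult_l_distr[OF hecke_zero_closed hecke_zero_closed m] by simp
  then show ?thesis
    using HM.smult_closed[OF hecke_zero_closed m] by simp
qed

section \<open>The tensor product and the image of tau\<close>

abbreviation FA where "FA \<equiv> free_Abelian_group (XX \<times> carrier M)"

lemma carrier_FA: "carrier FA = {z. Poly_Mapping.keys z \<subseteq> XX \<times> carrier M}"
  by (simp add: free_Abelian_group_def)

lemma tau_free_superset:
  assumes S: "finite S" "Poly_Mapping.keys z \<subseteq> S" "S \<subseteq> XX \<times> carrier M" and l: "l \<in> carrier D"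
  shows "tau_free G I M z l = (\<Oplus>\<^bsub>M\<^esub>xm\<in>S. [Poly_Mapping.lookup z xm] \<cdot>\<^bsub>M\<^esub> (l (fst xm) \<odot>\<^bsub>M\<^esub> snd xm))"
proof -
  have c: "[k] \<cdot>\<^bsub>M\<^esub> (l (fst xm) \<odot>\<^bsub>M\<^esub> snd xm) \<in> carrier M" if "xm \<in> S" for xm and k :: int
    using that S(3) D_val[OF l] by (auto intro!: HM.M.add.int_pow_closed HM.smult_closed)
  show ?thesis
    unfolding tau_free_def using S c l
    by (auto intro!: HM.M.add.finprod_mono_neutral_cong_left simp: in_keys_iff add_pow_def)
qed

lemma tau_free_val:
  "Poly_Mapping.keys z \<subseteq> XX \<times> carrier M \<Longrightarrow> l \<in> carrier D \<Longrightarrow> tau_free G I M z l \<in> carrier M"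
  unfolding tau_free_def
  by (auto intro!: HM.M.finsum_closed HM.M.add.int_pow_closed HM.smult_closed D_val)

text \<open>Differences are the basic operation because \<open>frag_induction\<close> builds the
  free abelian group from generators by subtraction, and the tensor relations are differences as
  well. Sums are recovered as z - (0 - w).\<close>

lemma tau_free_diff:
  assumes z: "Poly_Mapping.keys z \<subseteq> XX \<times> carrier M" and w: "Poly_Mapping.keys w \<subseteq> XX \<times> carrier M"
  shows "tau_free G I M (z - w) = (\<lambda>l\<in>carrier D. tau_free G I M z l \<ominus>\<^bsub>M\<^esub> tau_free G I M w l)"
proof
  fix l show "tau_free G I M (z - w) l = (\<lambda>l\<in>carrier D. tau_free G I M z l \<ominus>\<^bsub>M\<^esub> tau_free G I M w l) l"
  proof (cases "l \<in> carrier D")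
    case l: True
    define S where "S = Poly_Mapping.keys z \<union> Poly_Mapping.keys w"
    have S: "finite S" "S \<subseteq> XX \<times> carrier M" using z w by (auto simp: S_def)
    have keys: "Poly_Mapping.keys (z - w) \<subseteq> S" using keys_diff[of z w] by (simp add: S_def)
    define v where "v xm = l (fst xm) \<odot>\<^bsub>M\<^esub> snd xm" for xm
    have v: "v xm \<in> carrier M" if "xm \<in> S" for xm
      using that S(2) D_val[OF l] by (auto simp: v_def intro!: HM.smult_closed)
    have "tau_free G I M (z - w) l =
        (\<Oplus>\<^bsub>M\<^esub>xm\<in>S. [Poly_Mapping.lookup z xm] \<cdot>\<^bsub>M\<^esub> v xm \<oplus>\<^bsub>M\<^esub> \<ominus>\<^bsub>M\<^esub> ([Poly_Mapping.lookup w xm] \<cdot>\<^bsub>M\<^esub> v xm))"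
      unfolding tau_free_superset[OF S(1) keys S(2) l] v_def[symmetric]
      using v by (intro HM.M.finsum_cong') (auto simp: lookup_minus HM.M.add.int_pow_diff intro!: HM.M.add.int_pow_closed)
    also have "\<dots> = (\<Oplus>\<^bsub>M\<^esub>xm\<in>S. [Poly_Mapping.lookup z xm] \<cdot>\<^bsub>M\<^esub> v xm) \<ominus>\<^bsub>M\<^esub> (\<Oplus>\<^bsub>M\<^esub>xm\<in>S. [Poly_Mapping.lookup w xm] \<cdot>\<^bsub>M\<^esub> v xm)"
      using v by (subst HM.M.finsum_addf) (auto simp: finsum_minus[OF S(1)] a_minus_def intro!: HM.M.add.int_pow_closed)
    also have "\<dots> = tau_free G I M z l \<ominus>\<^bsub>M\<^esub> tau_free G I M w l"
      using S l by (simp add: tau_free_superset[of S] S_def v_def)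
    finally show ?thesis using l by simp
  qed (simp add: tau_free_def)
qed

lemma tau_free_zero: "tau_free G I M 0 = (\<lambda>l\<in>carrier D. \<zero>\<^bsub>M\<^esub>)"
  by (simp add: tau_free_def)

lemma tau_free_single: "x \<in> XX \<Longrightarrow> m \<in> carrier M \<Longrightarrow> tau_free G I M (frag_of (x, m)) = pure x m"
  by (auto simp: tau_free_def pure_def fun_eq_iff D_val HM.smult_closed)

text \<open>Makes tau well defined: biadditivity comes from additivity of l and of the action on
  \<open>M\<close>, the balancing relation from l(h x) = l(x) h. The claim on the keys is carried
  along because \<open>tau_free\<close> is known to be additive only on combinations of admissible
  pairs.\<close>

lemma tensor_rel_vanish:
  assumes "z \<in> tensor_rel G I M"
  shows "Poly_Mapping.keys z \<subseteq> XX \<times> carrier M \<and> tau_free G I M z = (\<lambda>l\<in>carrier D. \<zero>\<^bsub>M\<^esub>)"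
proof -
  define P where "P z \<longleftrightarrow> Poly_Mapping.keys z \<subseteq> XX \<times> carrier M \<and> tau_free G I M z = (\<lambda>l\<in>carrier D. \<zero>\<^bsub>M\<^esub>)"
    for z :: "(('g set \<Rightarrow> 'k) \<times> 'm) \<Rightarrow>\<^sub>0 int"
  have P0: "P 0" by (simp add: P_def tau_free_zero)
  have Pdiff: "P (z - w)" if "P z" "P w" for z w
    using that keys_diff[of z w] by (auto simp: P_def tau_free_diff fun_eq_iff a_minus_def HM.M.r_neg)
  have Pneg: "P (- z)" if "P z" for z
    using Pdiff[OF P0 that] by simp
  have Padd: "P (z + w)" if "P z" "P w" for z w
    using Pdiff[OF that(1) Pneg[OF that(2)]] by simp
  have keys2: "Poly_Mapping.keys (frag_of a - frag_of b) \<subseteq> XX \<times> carrier M"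
    if "a \<in> XX \<times> carrier M" "b \<in> XX \<times> carrier M" for a b
    using keys_diff[of "frag_of a" "frag_of b"] that by auto
  have keys3: "Poly_Mapping.keys (frag_of a - frag_of b - frag_of c) \<subseteq> XX \<times> carrier M"
    if "a \<in> XX \<times> carrier M" "b \<in> XX \<times> carrier M" "c \<in> XX \<times> carrier M" for a b c
    using keys_diff[of "frag_of a - frag_of b" "frag_of c"] keys2[of a b] that by auto
  have cancel: "a \<oplus>\<^bsub>M\<^esub> b \<ominus>\<^bsub>M\<^esub> a \<ominus>\<^bsub>M\<^esub> b = \<zero>\<^bsub>M\<^esub>" if "a \<in> carrier M" "b \<in> carrier M" for a b
    using that HM.M.r_neg[of "a \<oplus>\<^bsub>M\<^esub> b"] by (simp add: a_minus_def HM.M.minus_add HM.M.a_assoc)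
  have P1: "P (frag_of (\<lambda>c. x c + y c, m) - frag_of (x, m) - frag_of (y, m))"
    if "x \<in> XX" "y \<in> XX" "m \<in> carrier M" for x y m
    unfolding P_def using that X_add[of x y] keys2 keys3
    by (auto simp: tau_free_diff tau_free_single pure_def fun_eq_iff D_val HM.smult_closed
        dual_add HM.smult_l_distr cancel)
  have P2: "P (frag_of (x, m \<oplus>\<^bsub>M\<^esub> m') - frag_of (x, m) - frag_of (x, m'))"
    if "x \<in> XX" "m \<in> carrier M" "m' \<in> carrier M" for x m m'
    unfolding P_def using that keys2 keys3
    by (auto simp: tau_free_diff tau_free_single pure_def fun_eq_iff D_val HM.smult_closed
        HM.smult_r_distr cancel)
  have P3: "P (frag_of (h x, m) - frag_of (x, h \<odot>\<^bsub>M\<^esub> m))"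
    if "h \<in> carrier H" "x \<in> XX" "m \<in> carrier M" for h x m
    unfolding P_def using that hecke_X[OF that(1,2)] keys2 HM.smult_closed[OF that(1,3)]
    by (auto simp: tau_free_diff tau_free_single pure_def fun_eq_iff D_val HM.smult_closed
        dual_hecke HM.smult_assoc a_minus_def HM.M.r_neg)
  from assms have "P z"
    unfolding tensor_rel_def Let_def
  proof (induction rule: generate.induct)
    case one
    then show ?case using P0 by simp
  next
    case (incl h)
    then show ?case using P1 P2 P3 by blast
  next
    case (inv h)
    then have "P h" using P1 P2 P3 by blast
    then show ?case using Pneg by (simp add: P_def)
  next
    case (eng h1 h2)
    then show ?case using Padd by simp
  qed
  then show ?thesis by (simp add: P_def)
qed

lemma tau_free_add:
  assumes z: "Poly_Mapping.keys z \<subseteq> XX \<times> carrier M" and w: "Poly_Mapping.keys w \<subseteq> XX \<times> carrier M"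
  shows "tau_free G I M (z + w) = (\<lambda>l\<in>carrier D. tau_free G I M z l \<oplus>\<^bsub>M\<^esub> tau_free G I M w l)"
proof -
  have "tau_free G I M (z - (0 - w)) = (\<lambda>l\<in>carrier D. tau_free G I M z l \<oplus>\<^bsub>M\<^esub> tau_free G I M w l)"
    by (subst tau_free_diff[OF z], simp add: w, subst tau_free_diff[OF _ w], simp)
       (auto simp: tau_free_zero a_minus_def tau_free_val z w)
  then show ?thesis by simp
qed

text \<open>\<open>tau_free\<close> is constant on cosets of the tensor relations, so t(M) is the
  image of the free group itself, and the quotient need not be handled again.\<close>

lemma tM_carrier: "carrier tM = tau_free G I M ` {z. Poly_Mapping.keys z \<subseteq> XX \<times> carrier M}"
proof -
  have tau: "tau G I M (tensor_rel G I M #>\<^bsub>FA\<^esub> z) = tau_free G I M z"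
    if z: "Poly_Mapping.keys z \<subseteq> XX \<times> carrier M" for z
  proof -
    have eq: "tau_free G I M (w + z) = tau_free G I M z" if "w \<in> tensor_rel G I M" for w
      using tensor_rel_vanish[OF that] z
      by (auto simp: tau_free_add fun_eq_iff tau_free_val) (simp add: tau_free_def)
    have "0 \<in> tensor_rel G I M"
      using generate.one[of FA] by (simp add: tensor_rel_def Let_def)
    then have "tau_free G I M ` (tensor_rel G I M #>\<^bsub>FA\<^esub> z) = {tau_free G I M z}"
      using eq by (fastforce simp: r_coset_def)
    then show ?thesis by (simp add: tau_def)
  qed
  have "carrier tM = tau G I M ` carrier (tensor G I M)"
    by (simp add: t_obj_def Let_def)
  also have "\<dots> = tau G I M ` (\<lambda>z. tensor_rel G I M #>\<^bsub>FA\<^esub> z) ` {z. Poly_Mapping.keys z \<subseteq> XX \<times> carrier M}"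
    by (simp add: tensor_def FactGroup_def RCOSETS_def UNION_singleton_eq_range carrier_FA)
  also have "\<dots> = tau_free G I M ` {z. Poly_Mapping.keys z \<subseteq> XX \<times> carrier M}"
    using tau by (auto simp: image_image)
  finally show ?thesis .
qed

lemma tM_simps: "\<zero>\<^bsub>tM\<^esub> = (\<lambda>l\<in>carrier D. \<zero>\<^bsub>M\<^esub>)" "\<phi> \<oplus>\<^bsub>tM\<^esub> \<psi> = (\<lambda>l\<in>carrier D. \<phi> l \<oplus>\<^bsub>M\<^esub> \<psi> l)"
  "a \<odot>\<^bsub>tM\<^esub> \<phi> = (\<lambda>l\<in>carrier D. scal a \<odot>\<^bsub>M\<^esub> \<phi> l)"
  "act tM g = (\<lambda>\<phi>\<in>carrier tM. \<lambda>l\<in>carrier D. \<phi> (dual_act G XX g l))"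
  by (simp_all add: t_obj_def Let_def)

lemma tM_pure: "x \<in> XX \<Longrightarrow> m \<in> carrier M \<Longrightarrow> pure x m \<in> carrier tM"
  unfolding tM_carrier by (rule image_eqI[of _ _ "frag_of (x, m)"]) (auto simp: tau_free_single)

lemma tM_zero: "(\<lambda>l\<in>carrier D. \<zero>\<^bsub>M\<^esub>) \<in> carrier tM"
  unfolding tM_carrier by (rule image_eqI[of _ _ 0]) (auto simp: tau_free_zero)

lemma tM_diff: "\<phi> \<in> carrier tM \<Longrightarrow> \<psi> \<in> carrier tM \<Longrightarrow> (\<lambda>l\<in>carrier D. \<phi> l \<ominus>\<^bsub>M\<^esub> \<psi> l) \<in> carrier tM"
  unfolding tM_carrier using keys_diff by (fastforce simp: tau_free_diff[symmetric])

lemma tM_add: "\<phi> \<in> carrier tM \<Longrightarrow> \<psi> \<in> carrier tM \<Longrightarrow> (\<lambda>l\<in>carrier D. \<phi> l \<oplus>\<^bsub>M\<^esub> \<psi> l) \<in> carrier tM"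
  unfolding tM_carrier using keys_add by (fastforce simp: tau_free_add[symmetric])

lemma tM_sub: "carrier tM \<subseteq> carrier D \<rightarrow>\<^sub>E carrier M"
  by (auto simp: tM_carrier tau_free_val) (simp add: tau_free_def)

lemma tM_val: "\<phi> \<in> carrier tM \<Longrightarrow> l \<in> carrier D \<Longrightarrow> \<phi> l \<in> carrier M"
  and tM_ext: "\<phi> \<in> carrier tM \<Longrightarrow> l \<notin> carrier D \<Longrightarrow> \<phi> l = undefined"
  using tM_sub by (auto simp: PiE_def extensional_def)

lemma tM_minus_closed: "\<phi> \<in> carrier tM \<Longrightarrow> (\<lambda>l\<in>carrier D. \<ominus>\<^bsub>M\<^esub> \<phi> l) \<in> carrier tM"
  using tM_diff[OF tM_zero, of \<phi>] tM_val[of \<phi>] by (simp add: a_minus_def cong: restrict_cong)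

lemma tM_group: "abelian_group tM"
  and tM_minus: "\<phi> \<in> carrier tM \<Longrightarrow> \<ominus>\<^bsub>tM\<^esub> \<phi> = (\<lambda>l\<in>carrier D. \<ominus>\<^bsub>M\<^esub> \<phi> l)"
proof -
  note pg = pointwise_abelian_group[OF HM.M.abelian_group_axioms tM_sub]
  show "abelian_group tM"
    by (rule pg(1)) (use tM_zero tM_add tM_minus_closed in \<open>simp_all only: tM_simps\<close>)
  show "\<ominus>\<^bsub>tM\<^esub> \<phi> = (\<lambda>l\<in>carrier D. \<ominus>\<^bsub>M\<^esub> \<phi> l)" if "\<phi> \<in> carrier tM"
    by (rule pg(2)) (use tM_zero tM_add tM_minus_closed that in \<open>simp_all only: tM_simps\<close>)
qed

lemma tM_diff_eq: "\<psi> \<in> carrier tM \<Longrightarrow> \<phi> \<ominus>\<^bsub>tM\<^esub> \<psi> = (\<lambda>l\<in>carrier D. \<phi> l \<ominus>\<^bsub>M\<^esub> \<psi> l)"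
  unfolding a_minus_def[of tM] tM_minus tM_simps(2) by (auto simp: a_minus_def)

lemma tM_diff_apply: "\<psi> \<in> carrier tM \<Longrightarrow> l \<in> carrier D \<Longrightarrow> (\<phi> \<ominus>\<^bsub>tM\<^esub> \<psi>) l = \<phi> l \<ominus>\<^bsub>M\<^esub> \<psi> l"
  and tM_zero_apply: "l \<in> carrier D \<Longrightarrow> \<zero>\<^bsub>tM\<^esub> l = \<zero>\<^bsub>M\<^esub>"
  by (simp_all add: tM_diff_eq tM_simps)

lemma tM_zero_closed: "\<zero>\<^bsub>tM\<^esub> \<in> carrier tM"
  and tM_diff_closed: "\<phi> \<in> carrier tM \<Longrightarrow> \<psi> \<in> carrier tM \<Longrightarrow> \<phi> \<ominus>\<^bsub>tM\<^esub> \<psi> \<in> carrier tM"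
  using abelian_group.minus_closed[OF tM_group] abelian_monoid.zero_closed[of tM] tM_group
  by (auto simp: abelian_group_def)

text \<open>The induction of the free abelian group pushed forward to the image of tau: properties
  stable under differences are to be checked on elementary tensors.\<close>

lemma tM_induct [consumes 1, case_names zero pure diff]:
  assumes "\<phi> \<in> carrier tM"
    and zero: "P \<zero>\<^bsub>tM\<^esub>"
    and pure: "\<And>x m. x \<in> XX \<Longrightarrow> m \<in> carrier M \<Longrightarrow> P (pure x m)"
    and diff: "\<And>\<phi> \<psi>. \<phi> \<in> carrier tM \<Longrightarrow> \<psi> \<in> carrier tM \<Longrightarrow> P \<phi> \<Longrightarrow> P \<psi> \<Longrightarrow> P (\<phi> \<ominus>\<^bsub>tM\<^esub> \<psi>)"
  shows "P \<phi>"
proof -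
  obtain z where z: "Poly_Mapping.keys z \<subseteq> XX \<times> carrier M" "\<phi> = tau_free G I M z"
    using assms(1) by (auto simp: tM_carrier)
  have "Poly_Mapping.keys z \<subseteq> XX \<times> carrier M \<and> P (tau_free G I M z)"
    using z(1)
  proof (induction z rule: frag_induction)
    case zero
    then show ?case using assms(2) by (simp only: tau_free_zero tM_simps keys_zero empty_subsetI)
  next
    case (one a)
    then show ?case using pure by (cases a) (simp add: tau_free_single)
  next
    case (diff a b)
    then have "tau_free G I M a \<in> carrier tM" "tau_free G I M b \<in> carrier tM"
      by (auto simp: tM_carrier)
    then have "P (tau_free G I M (a - b))"
      using diff assms(4) by (simp only: tau_free_diff tM_diff_eq[symmetric])
    then show ?case using diff keys_diff[of a b] by blast
  qed
  then show ?thesis using z by simp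
qed

section \<open>The action of G and of the scalars on t(M)\<close>

lemma act_apply: "\<phi> \<in> carrier tM \<Longrightarrow> act tM g \<phi> = (\<lambda>l\<in>carrier D. \<phi> (dual_act G XX g l))"
  by (simp add: tM_simps)

lemma act_pure: "g \<in> carrier G \<Longrightarrow> x \<in> XX \<Longrightarrow> m \<in> carrier M \<Longrightarrow> act tM g (pure x m) = pure (translate G g x) m"
  unfolding act_apply[OF tM_pure] by (rule ext) (auto simp: pure_def dual_act_D, simp add: dual_act_def)

lemma act_diff: "g \<in> carrier G \<Longrightarrow> \<phi> \<in> carrier tM \<Longrightarrow> \<psi> \<in> carrier tM \<Longrightarrow>
    act tM g (\<phi> \<ominus>\<^bsub>tM\<^esub> \<psi>) = (\<lambda>l\<in>carrier D. act tM g \<phi> l \<ominus>\<^bsub>M\<^esub> act tM g \<psi> l)"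
  by (auto simp: act_apply tM_diff_closed tM_diff_apply dual_act_D fun_eq_iff)

lemma act_zero: "g \<in> carrier G \<Longrightarrow> act tM g \<zero>\<^bsub>tM\<^esub> = \<zero>\<^bsub>tM\<^esub>"
  unfolding act_apply[OF tM_zero_closed] by (auto simp: tM_simps(1) dual_act_D fun_eq_iff)

lemma act_closed: "\<phi> \<in> carrier tM \<Longrightarrow> g \<in> carrier G \<Longrightarrow> act tM g \<phi> \<in> carrier tM"
proof (induction rule: tM_induct)
  case (diff \<phi> \<psi>)
  then show ?case by (simp only: act_diff tM_diff)
qed (simp_all add: act_zero tM_zero_closed act_pure tM_pure X_translate)

text \<open>A functional l takes a x to l(x) \<open>scal a\<close>. As \<open>scal a\<close> is
  central in H it can be moved to the left of l(x), which is where the scalar action on t(M) has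
  it.\<close>

lemma pure_scale: "x \<in> XX \<Longrightarrow> m \<in> carrier M \<Longrightarrow> pure (\<lambda>c. a * x c) m = a \<odot>\<^bsub>tM\<^esub> pure x m"
proof (unfold tM_simps(3) pure_def, rule restrict_ext)
  fix l assume x: "x \<in> XX" and m: "m \<in> carrier M" and l: "l \<in> carrier D"
  show "l (\<lambda>c. a * x c) \<odot>\<^bsub>M\<^esub> m = scal a \<odot>\<^bsub>M\<^esub> (\<lambda>l\<in>carrier D. l x \<odot>\<^bsub>M\<^esub> m) l"
    using l HM.smult_assoc[OF scal_closed D_val[OF l x] m]
    by (simp add: dual_scale[OF l x x] scal_central[OF D_val[OF l x], symmetric])
qed

lemma tM_scale: "\<phi> \<in> carrier tM \<Longrightarrow> a \<odot>\<^bsub>tM\<^esub> \<phi> \<in> carrier tM"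
proof (induction rule: tM_induct)
  case zero
  have "a \<odot>\<^bsub>tM\<^esub> \<zero>\<^bsub>tM\<^esub> = \<zero>\<^bsub>tM\<^esub>"
    by (auto simp: tM_simps(1,3) smult_zero scal_closed fun_eq_iff)
  then show ?case by (simp only: tM_zero_closed)
next
  case (pure x m)
  then show ?case by (simp only: pure_scale[symmetric] tM_pure X_scale)
next
  case (diff \<phi> \<psi>)
  have "a \<odot>\<^bsub>tM\<^esub> (\<phi> \<ominus>\<^bsub>tM\<^esub> \<psi>) = (a \<odot>\<^bsub>tM\<^esub> \<phi>) \<ominus>\<^bsub>tM\<^esub> (a \<odot>\<^bsub>tM\<^esub> \<psi>)"
    unfolding tM_diff_eq[OF diff(4)] unfolding tM_simps(3)
    using tM_val[OF diff(1)] tM_val[OF diff(2)] by (auto simp: fun_eq_iff smult_diff scal_closed tM_diff_apply diff(2))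
  then show ?case using diff by (simp only: tM_diff_closed)
qed

lemma dual_act_one: "l \<in> carrier D \<Longrightarrow> dual_act G XX \<one> l = l"
  by (auto simp: dual_act_def translate_one dual_carrier fun_eq_iff PiE_def extensional_def)

text \<open>Functionals carry a right action, so the factors appear in this order; functions of
  functionals then carry a left action.\<close>

lemma dual_act_act: "g \<in> carrier G \<Longrightarrow> h \<in> carrier G \<Longrightarrow>
    dual_act G XX h (dual_act G XX g l) = dual_act G XX (g \<otimes> h) l"
  by (auto simp: dual_act_def X_translate translate_translate)

lemma act_one: "\<phi> \<in> carrier tM \<Longrightarrow> act tM \<one> \<phi> = \<phi>"
  using tM_ext[of \<phi>] by (auto simp: act_apply dual_act_one fun_eq_iff)

lemma act_act: "\<phi> \<in> carrier tM \<Longrightarrow> g \<in> carrier G \<Longrightarrow> h \<in> carrier G \<Longrightarrow>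
    act tM (g \<otimes> h) \<phi> = act tM g (act tM h \<phi>)"
  using act_closed[of \<phi> h] by (auto simp: act_apply dual_act_D dual_act_act fun_eq_iff)

lemma tM_module: "Module.module (ring_of_type_algebra :: 'k ring) tM"
proof (rule moduleI)
  show "cring (ring_of_type_algebra :: 'k ring)" by (rule cring_from_type_algebra)
  show "abelian_group tM" by (rule tM_group)
next
  fix a :: 'k and \<phi> assume "\<phi> \<in> carrier tM"
  then show "a \<odot>\<^bsub>tM\<^esub> \<phi> \<in> carrier tM" by (rule tM_scale)
next
  fix a b :: 'k and \<phi> assume "\<phi> \<in> carrier tM"
  then show "(a \<oplus>\<^bsub>ring_of_type_algebra\<^esub> b) \<odot>\<^bsub>tM\<^esub> \<phi> = a \<odot>\<^bsub>tM\<^esub> \<phi> \<oplus>\<^bsub>tM\<^esub> b \<odot>\<^bsub>tM\<^esub> \<phi>"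
    "(a \<otimes>\<^bsub>ring_of_type_algebra\<^esub> b) \<odot>\<^bsub>tM\<^esub> \<phi> = a \<odot>\<^bsub>tM\<^esub> (b \<odot>\<^bsub>tM\<^esub> \<phi>)"
    "\<one>\<^bsub>ring_of_type_algebra\<^esub> \<odot>\<^bsub>tM\<^esub> \<phi> = \<phi>"
    using tM_ext[of \<phi>] tM_val[of \<phi>]
    by (auto simp: tM_simps ring_of_type_algebra_def fun_eq_iff scal_ring HM.smult_l_distr HM.smult_assoc
        scal_closed HM.smult_one)
next
  fix a :: 'k and \<phi> \<psi> assume "\<phi> \<in> carrier tM" "\<psi> \<in> carrier tM"
  then show "a \<odot>\<^bsub>tM\<^esub> (\<phi> \<oplus>\<^bsub>tM\<^esub> \<psi>) = a \<odot>\<^bsub>tM\<^esub> \<phi> \<oplus>\<^bsub>tM\<^esub> a \<odot>\<^bsub>tM\<^esub> \<psi>"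
    using tM_val[of \<phi>] tM_val[of \<psi>]
    by (auto simp: tM_simps fun_eq_iff HM.smult_r_distr scal_closed)
qed

lemma act_hom: "g \<in> carrier G \<Longrightarrow> act tM g \<in> left_hom (ring_of_type_algebra :: 'k ring) tM tM"
proof -
  assume g: "g \<in> carrier G"
  have "act tM g \<in> carrier tM \<rightarrow>\<^sub>E carrier tM"
    using act_closed[OF _ g] by (auto simp: tM_simps(4))
  then show ?thesis
    unfolding left_hom_def using g tM_add[folded tM_simps(2)] tM_scale
    by (auto simp: act_apply) (auto simp: tM_simps(2,3) dual_act_D fun_eq_iff)
qed

lemma locally_fixed: "\<phi> \<in> carrier tM \<Longrightarrow> \<exists>n. \<forall>k\<in>K n. act tM k \<phi> = \<phi>"
proof (induction rule: tM_induct)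
  case zero
  then show ?case using act_zero K_carrier by blast
next
  case (pure x m)
  obtain n where n: "x \<in> Y n" using X_Y[OF pure(1)] by blast
  have "act tM k (pure x m) = pure x m" if "k \<in> K n" for k
    using that pure by (simp add: act_pure K_carrier fixed_translate[OF n])
  then show ?case by blast
next
  case (diff \<phi> \<psi>)
  then obtain m n where m: "\<forall>k\<in>K m. act tM k \<phi> = \<phi>" and n: "\<forall>k\<in>K n. act tM k \<psi> = \<psi>" by blast
  show ?case
  proof (intro exI[of _ "max m n"] ballI)
    fix k assume k: "k \<in> K (max m n)"
    then have "act tM k \<phi> = \<phi>" "act tM k \<psi> = \<psi>"
      using K(3)[of m "max m n"] K(3)[of n "max m n"] m n by auto
    then show "act tM k (\<phi> \<ominus>\<^bsub>tM\<^esub> \<psi>) = \<phi> \<ominus>\<^bsub>tM\<^esub> \<psi>"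
      unfolding act_diff[OF K_carrier[OF k] diff(1,2)] by (simp only: tM_diff_eq[OF diff(2)])
  qed
qed

text \<open>If K_n fixes a vector, its stabilizer is a union of cosets g K_n. Openness of such
  unions is the property demanded of \<open>tg\<close>, to be supplied by the metric on
  matrices.\<close>

lemma tM_smooth:
  assumes top: "\<And>S n. S \<subseteq> carrier G \<Longrightarrow> (\<And>g k. g \<in> S \<Longrightarrow> k \<in> K n \<Longrightarrow> g \<otimes> k \<in> S) \<Longrightarrow> openin tg S"
  shows "smooth_rep tg G tM"
  unfolding smooth_rep_def
proof (intro conjI ballI)
  fix \<phi> assume \<phi>: "\<phi> \<in> carrier tM"
  obtain n where n: "\<forall>k\<in>K n. act tM k \<phi> = \<phi>" using locally_fixed[OF \<phi>] by blast
  show "openin tg {g \<in> carrier G. act tM g \<phi> = \<phi>}"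
  proof (rule top[of _ n])
    fix g k assume "g \<in> {g \<in> carrier G. act tM g \<phi> = \<phi>}" "k \<in> K n"
    then show "g \<otimes> k \<in> {g \<in> carrier G. act tM g \<phi> = \<phi>}"
      using n by (simp add: act_act[OF \<phi>] K_carrier)
  qed auto
qed (use tM_module act_hom act_one act_act in auto)

section \<open>The fixed vectors of \<open>t(M)\<close>\<close>

lemma finsum_pure:
  assumes S: "finite S" "S \<subseteq> carrier G" and x: "x \<in> XX" and m: "m \<in> carrier M" and l: "l \<in> carrier D"
  shows "(\<Oplus>\<^bsub>M\<^esub>r\<in>S. act tM r (pure x m) l) = l (\<lambda>c. \<Sum>r\<in>S. translate G r x c) \<odot>\<^bsub>M\<^esub> m"
  using S
proof (induction S rule: finite_induct)
  case empty
  show ?case using zero_smult[OF m] dual_zero[OF l[unfolded XX_fixed]] by simp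
next
  case (insert r S)
  have val: "act tM r (pure x m) l \<in> carrier M" if "r \<in> carrier G" for r
    by (rule tM_val[OF act_closed[OF tM_pure[OF x m] that] l])
  have "l (\<lambda>c. translate G r x c + (\<Sum>r\<in>S. translate G r x c)) \<odot>\<^bsub>M\<^esub> m =
      l (translate G r x) \<odot>\<^bsub>M\<^esub> m \<oplus>\<^bsub>M\<^esub> l (\<lambda>c. \<Sum>r\<in>S. translate G r x c) \<odot>\<^bsub>M\<^esub> m"
  proof -
    have a: "translate G r x \<in> XX" "(\<lambda>c. \<Sum>r\<in>S. translate G r x c) \<in> XX"
      using insert x by (auto intro!: X_sum X_translate)
    show ?thesis
      unfolding dual_add[OF l a] by (rule HM.smult_l_distr[OF D_val[OF l a(1)] D_val[OF l a(2)] m])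
  qed
  moreover have "act tM r (pure x m) l = l (translate G r x) \<odot>\<^bsub>M\<^esub> m"
    using insert x m l by (simp add: act_pure) (simp add: pure_def)
  moreover have "act tM r (pure x m) l \<in> carrier M" "(\<lambda>r. act tM r (pure x m) l) \<in> S \<rightarrow> carrier M"
    using insert val by auto
  ultimately show ?case
    using insert by (subst HM.M.finsum_insert) auto
qed

lemma finsum_const: "finite S \<Longrightarrow> m \<in> carrier M \<Longrightarrow> (\<Oplus>\<^bsub>M\<^esub>r\<in>S. m) = scal (of_nat (card S)) \<odot>\<^bsub>M\<^esub> m"
proof (induction S rule: finite_induct)
  case empty
  then show ?case by (simp add: scal_ring zero_smult)
next
  case (insert r S)
  then show ?case
    by (subst HM.M.finsum_insert) (auto simp: scal_ring HM.smult_l_distr HM.smult_one scal_closed hecke_one_closed)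
qed

text \<open>The level \<open>J\<close> has to be large enough for the finitely many vectors occurring in \<open>\<phi>\<close>.\<close>

lemma finsum_act:
  assumes "\<phi> \<in> carrier tM"
  shows "\<exists>J. \<forall>j\<ge>J. \<forall>l\<in>carrier D. (\<Oplus>\<^bsub>M\<^esub>r\<in>reps j. act tM r \<phi> l) =
      scal (of_nat (card (reps j))) \<odot>\<^bsub>M\<^esub> (l (delta \<one>) \<odot>\<^bsub>M\<^esub> \<phi> proj)"
  using assms
proof (induction rule: tM_induct)
  case zero
  have "(\<Oplus>\<^bsub>M\<^esub>r\<in>reps j. act tM r \<zero>\<^bsub>tM\<^esub> l) = (\<Oplus>\<^bsub>M\<^esub>r\<in>reps j. \<zero>\<^bsub>M\<^esub>)" if "l \<in> carrier D" for j l
    using that by (intro HM.M.finsum_cong') (auto simp: act_zero tM_zero_apply reps_carrier)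
  then show ?case
    using proj_dual by (simp add: tM_zero_apply smult_zero scal_closed D_val delta_X)
next
  case (pure x m)
  obtain J where J: "x \<in> Y J" using X_Y[OF pure(1)] by blast
  show ?case
  proof (intro exI allI impI ballI)
    fix j l assume j: "J \<le> j" and l: "l \<in> carrier D"
    let ?N = "of_nat (card (reps j)) :: 'k"
    have xj: "x \<in> Y j" by (rule Y_mono[OF j J])
    have p: "proj x \<in> carrier H" by (rule D_val[OF proj_dual pure(1)])
    have d: "delta \<one> \<in> XX" by (simp add: delta_X)
    \<comment> \<open>The sum of the translates is N times the mean of x, and this mean is
      \<open>proj x\<close> applied to char_I; H-linearity of \<open>l\<close> then takes
      \<open>proj x\<close> out of the argument.\<close>
    have "(\<lambda>c. \<Sum>r\<in>reps j. translate G r x c) = (\<lambda>c. ?N * average x c)"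
      using reps(4)[of j] by (simp add: average_eq[OF xj] average_at_def flip: mult.assoc)
    also have "\<dots> = (\<lambda>c. ?N * proj x (delta \<one>) c)"
      by (simp add: proj_apply_delta pure)
    finally have "l (\<lambda>c. \<Sum>r\<in>reps j. translate G r x c) = l (delta \<one>) \<otimes>\<^bsub>H\<^esub> proj x \<otimes>\<^bsub>H\<^esub> scal ?N"
      using dual_scale[OF l hecke_X[OF p d] hecke_X[OF p d]] dual_hecke[OF l d p] by simp
    also have "\<dots> = scal ?N \<otimes>\<^bsub>H\<^esub> (l (delta \<one>) \<otimes>\<^bsub>H\<^esub> proj x)"
      using scal_central[OF hecke_mult_closed[OF D_val[OF l d] p]] by simp
    finally show "(\<Oplus>\<^bsub>M\<^esub>r\<in>reps j. act tM r (pure x m) l) = scal ?N \<odot>\<^bsub>M\<^esub> (l (delta \<one>) \<odot>\<^bsub>M\<^esub> pure x m proj)"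
      using pure p proj_dual D_val[OF l d] reps_carrier
      by (subst finsum_pure[OF reps(2) _ pure l])
         (auto simp: pure_def HM.smult_assoc HM.smult_closed scal_closed hecke_mult_closed)
  qed
next
  case (diff \<phi> \<psi>)
  then obtain J1 J2 where
    J1: "\<And>j l. j \<ge> J1 \<Longrightarrow> l \<in> carrier D \<Longrightarrow> (\<Oplus>\<^bsub>M\<^esub>r\<in>reps j. act tM r \<phi> l) =
      scal (of_nat (card (reps j))) \<odot>\<^bsub>M\<^esub> (l (delta \<one>) \<odot>\<^bsub>M\<^esub> \<phi> proj)" and
    J2: "\<And>j l. j \<ge> J2 \<Longrightarrow> l \<in> carrier D \<Longrightarrow> (\<Oplus>\<^bsub>M\<^esub>r\<in>reps j. act tM r \<psi> l) =
      scal (of_nat (card (reps j))) \<odot>\<^bsub>M\<^esub> (l (delta \<one>) \<odot>\<^bsub>M\<^esub> \<psi> proj)"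
    by blast
  show ?case
  proof (intro exI[of _ "max J1 J2"] allI impI ballI)
    fix j l assume j: "max J1 J2 \<le> j" and l: "l \<in> carrier D"
    have val: "act tM r \<theta> l \<in> carrier M" if "r \<in> reps j" "\<theta> \<in> carrier tM" for r \<theta>
      by (rule tM_val[OF act_closed[OF that(2) reps_carrier[OF that(1)]] l])
    have "(\<Oplus>\<^bsub>M\<^esub>r\<in>reps j. act tM r (\<phi> \<ominus>\<^bsub>tM\<^esub> \<psi>) l) =
        (\<Oplus>\<^bsub>M\<^esub>r\<in>reps j. act tM r \<phi> l \<oplus>\<^bsub>M\<^esub> \<ominus>\<^bsub>M\<^esub> act tM r \<psi> l)"
      using diff(1,2) l val by (intro HM.M.finsum_cong') (auto simp: act_diff reps_carrier a_minus_def[of M])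
    also have "\<dots> = (\<Oplus>\<^bsub>M\<^esub>r\<in>reps j. act tM r \<phi> l) \<ominus>\<^bsub>M\<^esub> (\<Oplus>\<^bsub>M\<^esub>r\<in>reps j. act tM r \<psi> l)"
      using diff(1,2) val by (subst HM.M.finsum_addf) (auto simp: finsum_minus[OF reps(2)] a_minus_def)
    also have "\<dots> = scal (of_nat (card (reps j))) \<odot>\<^bsub>M\<^esub> (l (delta \<one>) \<odot>\<^bsub>M\<^esub> (\<phi> proj \<ominus>\<^bsub>M\<^esub> \<psi> proj))"
      using j l tM_val[OF diff(1) proj_dual] tM_val[OF diff(2) proj_dual] D_val[OF l delta_X[OF one_closed]]
      by (simp add: J1 J2 smult_diff scal_closed HM.smult_closed)
    finally show "(\<Oplus>\<^bsub>M\<^esub>r\<in>reps j. act tM r (\<phi> \<ominus>\<^bsub>tM\<^esub> \<psi>) l) =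
        scal (of_nat (card (reps j))) \<odot>\<^bsub>M\<^esub> (l (delta \<one>) \<odot>\<^bsub>M\<^esub> (\<phi> \<ominus>\<^bsub>tM\<^esub> \<psi>) proj)"
      by (simp only: tM_diff_apply[OF diff(2) proj_dual])
  qed
qed

text \<open>The sum of the translates of \<phi> over representatives is N \<phi> as \<phi> is fixed,
  and N (char_I \<otimes> \<phi>(e)) by \<open>finsum_act\<close>; N is invertible in k. Together
  with \<open>pure_delta_proj\<close> and \<open>act_pure_delta\<close> this identifies the I-fixed
  vectors of t(M) with \<open>M\<close>.\<close>

lemma fixed_eq_pure:
  assumes \<phi>: "\<phi> \<in> carrier tM" and fixed: "\<And>i. i \<in> I \<Longrightarrow> act tM i \<phi> = \<phi>"
  shows "\<phi> = pure (delta \<one>) (\<phi> proj)"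
proof
  fix l show "\<phi> l = pure (delta \<one>) (\<phi> proj) l"
  proof (cases "l \<in> carrier D")
    case l: True
    obtain j where j: "(\<Oplus>\<^bsub>M\<^esub>r\<in>reps j. act tM r \<phi> l) =
        scal (of_nat (card (reps j))) \<odot>\<^bsub>M\<^esub> (l (delta \<one>) \<odot>\<^bsub>M\<^esub> \<phi> proj)"
      using finsum_act[OF \<phi>] l by blast
    let ?N = "of_nat (card (reps j)) :: 'k"
    have v: "\<phi> l \<in> carrier M" "l (delta \<one>) \<odot>\<^bsub>M\<^esub> \<phi> proj \<in> carrier M"
      using tM_val[OF \<phi> l] HM.smult_closed[OF D_val[OF l delta_X[OF one_closed]] tM_val[OF \<phi> proj_dual]]
      by simp_all
    have "(\<Oplus>\<^bsub>M\<^esub>r\<in>reps j. act tM r \<phi> l) = (\<Oplus>\<^bsub>M\<^esub>r\<in>reps j. \<phi> l)"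
      using v by (intro HM.M.finsum_cong') (auto simp: fixed reps_I)
    also have "\<dots> = scal ?N \<odot>\<^bsub>M\<^esub> \<phi> l"
      by (rule finsum_const[OF reps(2) v(1)])
    finally have eq: "scal ?N \<odot>\<^bsub>M\<^esub> \<phi> l = scal ?N \<odot>\<^bsub>M\<^esub> (l (delta \<one>) \<odot>\<^bsub>M\<^esub> \<phi> proj)"
      using j by simp
    have cancel: "scal (inverse ?N) \<odot>\<^bsub>M\<^esub> (scal ?N \<odot>\<^bsub>M\<^esub> w) = w" if "w \<in> carrier M" for w
    proof -
      have "scal (inverse ?N) \<otimes>\<^bsub>H\<^esub> scal ?N = \<one>\<^bsub>H\<^esub>"
        unfolding scal_ring(4)[symmetric] using reps(4)[of j] by (simp add: scal_ring(1))
      then show ?thesis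
        unfolding HM.smult_assoc[OF scal_closed scal_closed that, symmetric] by (simp add: HM.smult_one[OF that])
    qed
    have "\<phi> l = l (delta \<one>) \<odot>\<^bsub>M\<^esub> \<phi> proj"
      using arg_cong[OF eq, of "\<lambda>w. scal (inverse ?N) \<odot>\<^bsub>M\<^esub> w"]
      unfolding cancel[OF v(1)] cancel[OF v(2)] .
    then show ?thesis
      using l by (simp only: pure_def restrict_apply')
  qed (use tM_ext[OF \<phi>] in \<open>simp add: pure_def\<close>)
qed

lemma pure_delta_proj: "m \<in> carrier M \<Longrightarrow> pure (delta \<one>) m proj = m"
  using proj_dual by (simp add: pure_def proj_delta HM.smult_one)

lemma act_pure_delta: "i \<in> I \<Longrightarrow> m \<in> carrier M \<Longrightarrow> act tM i (pure (delta \<one>) m) = pure (delta \<one>) m"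
  using fixed_translate[OF delta_one_XI] by (simp add: act_pure I_carrier delta_X)

section \<open>Generation of t(M) by its fixed vectors\<close>

lemma pure_add: "x \<in> XX \<Longrightarrow> y \<in> XX \<Longrightarrow> m \<in> carrier M \<Longrightarrow> pure (\<lambda>c. x c + y c) m = pure x m \<oplus>\<^bsub>tM\<^esub> pure y m"
proof (unfold tM_simps(2) pure_def, rule restrict_ext)
  fix l assume x: "x \<in> XX" and y: "y \<in> XX" and m: "m \<in> carrier M" and l: "l \<in> carrier D"
  show "l (\<lambda>c. x c + y c) \<odot>\<^bsub>M\<^esub> m = (\<lambda>l\<in>carrier D. l x \<odot>\<^bsub>M\<^esub> m) l \<oplus>\<^bsub>M\<^esub> (\<lambda>l\<in>carrier D. l y \<odot>\<^bsub>M\<^esub> m) l"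
    using l by (simp add: dual_add[OF l x y] HM.smult_l_distr[OF D_val[OF l x] D_val[OF l y] m])
qed

lemma pure_zero: "m \<in> carrier M \<Longrightarrow> pure (\<lambda>c. 0) m = \<zero>\<^bsub>tM\<^esub>"
proof -
  assume m: "m \<in> carrier M"
  interpret tM: abelian_group tM by (rule tM_group)
  have "pure (\<lambda>c. 0) m = pure (\<lambda>c. 0) m \<oplus>\<^bsub>tM\<^esub> pure (\<lambda>c. 0) m"
    using pure_add[OF X_zero X_zero m] unfolding add_0_left .
  then show ?thesis using tM.add.r_cancel_one'[OF tM_pure[OF X_zero m] tM_pure[OF X_zero m]] by blast
qed

lemma pure_hecke: "x \<in> XX \<Longrightarrow> h \<in> carrier H \<Longrightarrow> m \<in> carrier M \<Longrightarrow> pure (h x) m = pure x (h \<odot>\<^bsub>M\<^esub> m)"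
proof (unfold pure_def, rule restrict_ext)
  fix l assume x: "x \<in> XX" and h: "h \<in> carrier H" and m: "m \<in> carrier M" and l: "l \<in> carrier D"
  show "l (h x) \<odot>\<^bsub>M\<^esub> m = l x \<odot>\<^bsub>M\<^esub> (h \<odot>\<^bsub>M\<^esub> m)"
    unfolding dual_hecke[OF l x h] by (rule HM.smult_assoc[OF D_val[OF l x] h m])
qed

text \<open>char_I generates the universal module under translations and k-linear combinations, so
  the char_I \<otimes> m generate all elementary tensors.\<close>

lemma tM_subspace_induct:
  assumes W: "submodule W (ring_of_type_algebra :: 'k ring) tM"
    and stable: "\<And>g w. g \<in> carrier G \<Longrightarrow> w \<in> W \<Longrightarrow> act tM g w \<in> W"
    and delta: "\<And>m. m \<in> carrier M \<Longrightarrow> pure (delta \<one>) m \<in> W"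
  shows "W = carrier tM"
proof -
  interpret W: submodule W "ring_of_type_algebra :: 'k ring" tM by (rule W)
  interpret tM: abelian_group tM by (rule tM_group)
  have W0: "\<zero>\<^bsub>tM\<^esub> \<in> W" and Wadd: "\<And>v w. v \<in> W \<Longrightarrow> w \<in> W \<Longrightarrow> v \<oplus>\<^bsub>tM\<^esub> w \<in> W"
    and Wneg: "\<And>v. v \<in> W \<Longrightarrow> \<ominus>\<^bsub>tM\<^esub> v \<in> W" and Wsub: "W \<subseteq> carrier tM"
    using W.one_closed W.m_closed W.m_inv_closed W.subset by (auto simp: a_inv_def)
  have pure: "pure x m \<in> W" if "x \<in> XX" and m: "m \<in> carrier M" for x m
    using that(1)
  proof (induction rule: X_induct)
    case zero
    then show ?case using W0 m by (simp add: pure_zero)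
  next
    case (step a g y)
    have "pure (\<lambda>c. a * delta g c + y c) m = a \<odot>\<^bsub>tM\<^esub> act tM g (pure (delta \<one>) m) \<oplus>\<^bsub>tM\<^esub> pure y m"
      using step m by (simp add: pure_add pure_scale delta_X X_scale act_pure translate_delta)
    then show ?case
      using step delta[OF m] stable W.smult_closed[of a] by (auto simp: ring_of_type_algebra_def intro!: Wadd)
  qed
  have "\<phi> \<in> W" if "\<phi> \<in> carrier tM" for \<phi>
    using that
  proof (induction rule: tM_induct)
    case zero
    show ?case by (rule W0)
  next
    case (diff \<phi> \<psi>)
    then show ?case using Wadd Wneg by (simp add: a_minus_def[of tM])
  qed (rule pure)
  then show ?thesis using Wsub by blast
qed

lemma tM_generated: "generated_by_fixed G I tM"
  unfolding generated_by_fixed_def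
proof (intro allI impI, elim conjE)
  fix W assume W: "submodule W (ring_of_type_algebra :: 'k ring) tM"
    and stable: "\<forall>g\<in>carrier G. \<forall>w\<in>W. act tM g w \<in> W"
    and fixed: "{v \<in> carrier tM. \<forall>g\<in>I. act tM g v = v} \<subseteq> W"
  show "W = carrier tM"
  proof (rule tM_subspace_induct[OF W])
    show "act tM g w \<in> W" if "g \<in> carrier G" "w \<in> W" for g w
      using stable that by blast
    show "pure (delta \<one>) m \<in> W" if "m \<in> carrier M" for m
      by (rule subsetD[OF fixed]) (simp add: that tM_pure delta_X act_pure_delta)
  qed
qed

end

section \<open>Full faithfulness\<close>

locale hecke_module_pair = hecke_module G I K coeff_type M + B: hecke_module G I K coeff_type N
  for G :: "('g, 's) monoid_scheme" (structure) and I K and coeff_type :: "'k::field itself"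
    and M :: "(('g, 'k) hecke, 'm) module" and N :: "(('g, 'k) hecke, 'n) module"
begin

lemma pure_add_right: "x \<in> XX \<Longrightarrow> m \<in> carrier M \<Longrightarrow> m' \<in> carrier M \<Longrightarrow>
    pure x (m \<oplus>\<^bsub>M\<^esub> m') = pure x m \<oplus>\<^bsub>tM\<^esub> pure x m'"
  unfolding tM_simps by (auto simp: pure_def fun_eq_iff D_val HM.smult_r_distr)

lemma left_homD:
  assumes "f \<in> left_hom H M N"
  shows "m \<in> carrier M \<Longrightarrow> f m \<in> carrier N"
    and "m \<in> carrier M \<Longrightarrow> m' \<in> carrier M \<Longrightarrow> f (m \<oplus>\<^bsub>M\<^esub> m') = f m \<oplus>\<^bsub>N\<^esub> f m'"
    and "h \<in> carrier H \<Longrightarrow> m \<in> carrier M \<Longrightarrow> f (h \<odot>\<^bsub>M\<^esub> m) = h \<odot>\<^bsub>N\<^esub> f m"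
    and "m \<notin> carrier M \<Longrightarrow> f m = undefined"
  using assms by (auto simp: left_hom_def PiE_def extensional_def)

lemma left_hom_zero: "f \<in> left_hom H M N \<Longrightarrow> f \<zero>\<^bsub>M\<^esub> = \<zero>\<^bsub>N\<^esub>"
proof -
  assume f: "f \<in> left_hom H M N"
  have "f \<zero>\<^bsub>M\<^esub> \<oplus>\<^bsub>N\<^esub> f \<zero>\<^bsub>M\<^esub> = f \<zero>\<^bsub>M\<^esub>"
    using left_homD(2)[OF f HM.M.zero_closed HM.M.zero_closed] by simp
  then show ?thesis using left_homD(1)[OF f HM.M.zero_closed] by simp
qed

lemma left_hom_diff:
  assumes f: "f \<in> left_hom H M N" and m: "m \<in> carrier M" "m' \<in> carrier M"
  shows "f (m \<ominus>\<^bsub>M\<^esub> m') = f m \<ominus>\<^bsub>N\<^esub> f m'"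
proof -
  have "f (\<ominus>\<^bsub>M\<^esub> m') \<oplus>\<^bsub>N\<^esub> f m' = \<zero>\<^bsub>N\<^esub>"
    using m by (simp add: left_homD(2)[OF f, symmetric] HM.M.l_neg left_hom_zero[OF f])
  then have "\<ominus>\<^bsub>N\<^esub> f m' = f (\<ominus>\<^bsub>M\<^esub> m')"
    using m left_homD(1)[OF f] by (intro B.HM.M.minus_equality) auto
  then show ?thesis
    using m by (simp add: a_minus_def left_homD(2)[OF f])
qed

abbreviation tN where "tN \<equiv> B.tM"

lemma t_mor_apply: "\<phi> \<in> carrier tM \<Longrightarrow> t_mor G I M f \<phi> = (\<lambda>l\<in>carrier D. f (\<phi> l))"
  by (simp add: t_mor_def)

text \<open>On elementary tensors t(f) is id \<otimes> f; this is why Hom_H applied to f carries the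
  image of tau for \<open>M\<close> into the one for \<open>N\<close>.\<close>

lemma t_mor_pure:
  assumes f: "f \<in> left_hom H M N" and x: "x \<in> XX" and m: "m \<in> carrier M"
  shows "t_mor G I M f (pure x m) = B.pure x (f m)"
  unfolding t_mor_apply[OF tM_pure[OF x m]]
  unfolding pure_def B.pure_def
  using x m by (auto simp: fun_eq_iff left_homD(3)[OF f] D_val)

lemma t_mor_closed:
  assumes f: "f \<in> left_hom H M N"
  shows "\<phi> \<in> carrier tM \<Longrightarrow> t_mor G I M f \<phi> \<in> carrier tN"
proof (induction rule: tM_induct)
  case zero
  have "t_mor G I M f \<zero>\<^bsub>tM\<^esub> = \<zero>\<^bsub>tN\<^esub>"
    unfolding t_mor_apply[OF tM_zero_closed] B.tM_simps(1)
    by (auto simp: tM_zero_apply left_hom_zero[OF f] fun_eq_iff)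
  then show ?case by (simp only: B.tM_zero_closed)
next
  case (pure x m)
  then show ?case using left_homD(1)[OF f] by (simp only: t_mor_pure[OF f] B.tM_pure)
next
  case (diff \<phi> \<psi>)
  have "t_mor G I M f (\<phi> \<ominus>\<^bsub>tM\<^esub> \<psi>) = t_mor G I M f \<phi> \<ominus>\<^bsub>tN\<^esub> t_mor G I M f \<psi>"
    unfolding B.tM_diff_eq[OF diff(4)] t_mor_apply[OF tM_diff_closed[OF diff(1,2)]]
  proof (rule restrict_ext)
    fix l assume l: "l \<in> carrier D"
    show "f ((\<phi> \<ominus>\<^bsub>tM\<^esub> \<psi>) l) = t_mor G I M f \<phi> l \<ominus>\<^bsub>N\<^esub> t_mor G I M f \<psi> l"
      unfolding tM_diff_apply[OF diff(2) l] left_hom_diff[OF f tM_val[OF diff(1) l] tM_val[OF diff(2) l]]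
        t_mor_apply[OF diff(1)] t_mor_apply[OF diff(2)] restrict_apply'[OF l] by (rule refl)
  qed
  then show ?case using B.tM_diff_closed[OF diff(3,4)] by (simp only:)
qed

lemma t_mor_rep_hom:
  assumes f: "f \<in> left_hom H M N" shows "t_mor G I M f \<in> rep_hom G tM tN"
  unfolding rep_hom_def left_hom_def
proof (intro CollectI conjI ballI)
  show "t_mor G I M f \<in> carrier tM \<rightarrow>\<^sub>E carrier tN"
    using t_mor_closed[OF f] by (auto simp: t_mor_def)
next
  fix \<phi> \<psi> assume \<phi>: "\<phi> \<in> carrier tM" and \<psi>: "\<psi> \<in> carrier tM"
  have sum: "\<phi> \<oplus>\<^bsub>tM\<^esub> \<psi> \<in> carrier tM" using tM_add[OF \<phi> \<psi>] by (simp only: tM_simps)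
  show "t_mor G I M f (\<phi> \<oplus>\<^bsub>tM\<^esub> \<psi>) = t_mor G I M f \<phi> \<oplus>\<^bsub>tN\<^esub> t_mor G I M f \<psi>"
    unfolding t_mor_apply[OF sum] t_mor_apply[OF \<phi>] t_mor_apply[OF \<psi>] B.tM_simps(2)
    using tM_val[OF \<phi>] tM_val[OF \<psi>] by (auto simp: tM_simps(2) left_homD(2)[OF f] fun_eq_iff)
next
  fix a :: 'k and \<phi> assume \<phi>: "\<phi> \<in> carrier tM"
  show "t_mor G I M f (a \<odot>\<^bsub>tM\<^esub> \<phi>) = a \<odot>\<^bsub>tN\<^esub> t_mor G I M f \<phi>"
    unfolding t_mor_apply[OF tM_scale[OF \<phi>]] t_mor_apply[OF \<phi>] B.tM_simps(3)
    using tM_val[OF \<phi>] by (auto simp: tM_simps(3) left_homD(3)[OF f] scal_closed fun_eq_iff)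
next
  fix g \<phi> assume g: "g \<in> carrier G" and \<phi>: "\<phi> \<in> carrier tM"
  show "t_mor G I M f (act tM g \<phi>) = act tN g (t_mor G I M f \<phi>)"
    unfolding B.act_apply[OF t_mor_closed[OF f \<phi>]] t_mor_apply[OF act_closed[OF \<phi> g]]
    unfolding t_mor_apply[OF \<phi>] act_apply[OF \<phi>]
    by (rule restrict_ext) (simp add: dual_act_D[OF g])
qed

lemma rep_homD:
  assumes "F \<in> rep_hom G tM tN"
  shows "\<phi> \<in> carrier tM \<Longrightarrow> F \<phi> \<in> carrier tN"
    and "\<phi> \<in> carrier tM \<Longrightarrow> \<psi> \<in> carrier tM \<Longrightarrow> F (\<phi> \<oplus>\<^bsub>tM\<^esub> \<psi>) = F \<phi> \<oplus>\<^bsub>tN\<^esub> F \<psi>"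
    and "\<phi> \<in> carrier tM \<Longrightarrow> F (a \<odot>\<^bsub>tM\<^esub> \<phi>) = a \<odot>\<^bsub>tN\<^esub> F \<phi>"
    and "g \<in> carrier G \<Longrightarrow> \<phi> \<in> carrier tM \<Longrightarrow> F (act tM g \<phi>) = act tN g (F \<phi>)"
    and "\<phi> \<notin> carrier tM \<Longrightarrow> F \<phi> = undefined"
  using assms by (auto simp: rep_hom_def left_hom_def ring_of_type_algebra_def PiE_def extensional_def)

lemma rep_hom_zero:
  assumes F: "F \<in> rep_hom G tM tN" shows "F \<zero>\<^bsub>tM\<^esub> = \<zero>\<^bsub>tN\<^esub>"
proof -
  interpret tM: abelian_group tM by (rule tM_group)
  interpret tN: abelian_group tN by (rule B.tM_group)
  have "F \<zero>\<^bsub>tM\<^esub> \<oplus>\<^bsub>tN\<^esub> F \<zero>\<^bsub>tM\<^esub> = F \<zero>\<^bsub>tM\<^esub>"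
    using rep_homD(2)[OF F tM_zero_closed tM_zero_closed] tM.l_zero[OF tM_zero_closed] by (simp only:)
  then show ?thesis
    using tN.add.r_cancel_one'[OF rep_homD(1)[OF F tM_zero_closed] rep_homD(1)[OF F tM_zero_closed]] by simp
qed

lemma rep_hom_diff:
  assumes F: "F \<in> rep_hom G tM tN" and \<phi>: "\<phi> \<in> carrier tM" and \<psi>: "\<psi> \<in> carrier tM"
  shows "F (\<phi> \<ominus>\<^bsub>tM\<^esub> \<psi>) = F \<phi> \<ominus>\<^bsub>tN\<^esub> F \<psi>"
proof -
  interpret tM: abelian_group tM by (rule tM_group)
  interpret tN: abelian_group tN by (rule B.tM_group)
  have n: "\<ominus>\<^bsub>tM\<^esub> \<psi> \<in> carrier tM" by (rule tM.a_inv_closed[OF \<psi>])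
  have "F (\<ominus>\<^bsub>tM\<^esub> \<psi>) \<oplus>\<^bsub>tN\<^esub> F \<psi> = \<zero>\<^bsub>tN\<^esub>"
    unfolding rep_homD(2)[OF F n \<psi>, symmetric] tM.l_neg[OF \<psi>] by (rule rep_hom_zero[OF F])
  then have "\<ominus>\<^bsub>tN\<^esub> F \<psi> = F (\<ominus>\<^bsub>tM\<^esub> \<psi>)"
    by (rule tN.minus_equality[OF _ rep_homD(1)[OF F \<psi>] rep_homD(1)[OF F n]])
  then show ?thesis
    unfolding a_minus_def rep_homD(2)[OF F \<phi> n] by (simp only:)
qed

text \<open>The value of f at m is recovered from t(f) by inserting char_I \<otimes> m and
  evaluating the result at the functional \<open>proj\<close>.\<close>

lemma t_mor_inj: "inj_on (t_mor G I M) (left_hom H M N)"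
proof (rule inj_onI)
  fix f f' assume f: "f \<in> left_hom H M N" and f': "f' \<in> left_hom H M N" and eq: "t_mor G I M f = t_mor G I M f'"
  have d: "delta \<one> \<in> XX" by (simp add: delta_X)
  show "f = f'"
  proof
    fix m show "f m = f' m"
    proof (cases "m \<in> carrier M")
      case True
      have "B.pure (delta \<one>) (f m) = B.pure (delta \<one>) (f' m)"
        using arg_cong[OF eq, of "\<lambda>F. F (pure (delta \<one>) m)"]
        unfolding t_mor_pure[OF f d True] t_mor_pure[OF f' d True] .
      from arg_cong[OF this, of "\<lambda>\<phi>. \<phi> proj"] show ?thesis
        unfolding B.pure_delta_proj[OF left_homD(1)[OF f True]] B.pure_delta_proj[OF left_homD(1)[OF f' True]] .
    next
      case False
      then show ?thesis using left_homD(4)[OF f] left_homD(4)[OF f'] by simp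
    qed
  qed
qed

text \<open>\<open>F\<close> maps I-fixed vectors to I-fixed vectors, so it sends char_I \<otimes> m
  to char_I \<otimes> n for some n, and n is read off by evaluation at \<open>proj\<close>. This n
  is taken as f(m).\<close>

lemma t_mor_surj:
  assumes F: "F \<in> rep_hom G tM tN" shows "F \<in> t_mor G I M ` left_hom H M N"
proof -
  have d: "delta \<one> \<in> XX" by (simp add: delta_X)
  define f where "f = (\<lambda>m\<in>carrier M. F (pure (delta \<one>) m) proj)"
  have fN: "f m \<in> carrier N" if m: "m \<in> carrier M" for m
    using B.tM_val[OF rep_homD(1)[OF F tM_pure[OF d m]] proj_dual] m by (simp add: f_def)
  have F_delta: "F (pure (delta \<one>) m) = B.pure (delta \<one>) (f m)" if m: "m \<in> carrier M" for m
  proof -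
    have "act tN i (F (pure (delta \<one>) m)) = F (pure (delta \<one>) m)" if i: "i \<in> I" for i
      using rep_homD(4)[OF F I_carrier[OF i] tM_pure[OF d m]] unfolding act_pure_delta[OF i m] by (rule sym)
    from B.fixed_eq_pure[OF rep_homD(1)[OF F tM_pure[OF d m]] this] show ?thesis
      using m by (simp add: f_def)
  qed
  \<comment> \<open>Equivariance and k-linearity of \<open>F\<close> extend the formula from char_I
    to all of the universal module.\<close>
  have F_pure: "F (pure x m) = B.pure x (f m)" if x: "x \<in> XX" and m: "m \<in> carrier M" for x m
    using x
  proof (induction rule: X_induct)
    case zero
    show ?case
      unfolding pure_zero[OF m] B.pure_zero[OF fN[OF m]] by (rule rep_hom_zero[OF F])
  next
    case (step a g y)
    note dg = delta_X[OF step(2)]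
    have "F (pure (delta g) m) = act tN g (F (pure (delta \<one>) m))"
      using rep_homD(4)[OF F step(2) tM_pure[OF d m]] step(2) d m
      by (simp add: act_pure translate_delta)
    also have "\<dots> = B.pure (delta g) (f m)"
      using step(2) d fN[OF m] by (simp add: F_delta[OF m] B.act_pure translate_delta)
    finally have "F (pure (delta g) m) = B.pure (delta g) (f m)" .
    then show ?case
      unfolding pure_add[OF X_scale[OF dg] step(1) m] B.pure_add[OF X_scale[OF dg] step(1) fN[OF m]]
        pure_scale[OF dg m] B.pure_scale[OF dg fN[OF m]]
        rep_homD(2)[OF F tM_scale[OF tM_pure[OF dg m]] tM_pure[OF step(1) m]]
        rep_homD(3)[OF F tM_pure[OF dg m]] step(3)
      by (simp only:)
  qed
  have eval: "v = w" if v: "v \<in> carrier N" and w: "w \<in> carrier N" and "B.pure (delta \<one>) v = B.pure (delta \<one>) w" for v w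
    using arg_cong[OF that(3), of "\<lambda>\<phi>. \<phi> proj"]
    unfolding B.pure_delta_proj[OF v] B.pure_delta_proj[OF w] .
  have f: "f \<in> left_hom H M N"
    unfolding left_hom_def
  proof (intro CollectI conjI ballI)
    show "f \<in> carrier M \<rightarrow>\<^sub>E carrier N" using fN by (auto simp: f_def)
  next
    fix m m' assume m: "m \<in> carrier M" and m': "m' \<in> carrier M"
    have "F (pure (delta \<one>) (m \<oplus>\<^bsub>M\<^esub> m')) proj = F (pure (delta \<one>) m) proj \<oplus>\<^bsub>N\<^esub> F (pure (delta \<one>) m') proj"
      unfolding pure_add_right[OF d m m'] rep_homD(2)[OF F tM_pure[OF d m] tM_pure[OF d m']]
      using proj_dual by (simp add: B.tM_simps(2))
    then show "f (m \<oplus>\<^bsub>M\<^esub> m') = f m \<oplus>\<^bsub>N\<^esub> f m'"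
      using m m' by (simp add: f_def)
  next
    fix h m assume h: "h \<in> carrier H" and m: "m \<in> carrier M"
    have hm: "h \<odot>\<^bsub>M\<^esub> m \<in> carrier M" by (rule HM.smult_closed[OF h m])
    have "B.pure (delta \<one>) (f (h \<odot>\<^bsub>M\<^esub> m)) = F (pure (delta \<one>) (h \<odot>\<^bsub>M\<^esub> m))"
      by (rule F_delta[OF hm, symmetric])
    \<comment> \<open>H-linearity of \<open>f\<close> uses the balancing relation on both sides;
      h(char_I) is in general not a multiple of char_I, which is why \<open>F_pure\<close> was shown
      for every x.\<close>
    also have "\<dots> = F (pure (h (delta \<one>)) m)"
      unfolding pure_hecke[OF d h m] by (rule refl)
    also have "\<dots> = B.pure (h (delta \<one>)) (f m)"
      by (rule F_pure[OF hecke_X[OF h d] m])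
    also have "\<dots> = B.pure (delta \<one>) (h \<odot>\<^bsub>N\<^esub> f m)"
      by (rule B.pure_hecke[OF d h fN[OF m]])
    finally show "f (h \<odot>\<^bsub>M\<^esub> m) = h \<odot>\<^bsub>N\<^esub> f m"
      by (rule eval[OF fN[OF hm] B.HM.smult_closed[OF h fN[OF m]]])
  qed
  note tf = t_mor_rep_hom[OF f]
  have eq: "F \<phi> = t_mor G I M f \<phi>" if "\<phi> \<in> carrier tM" for \<phi>
    using that
  proof (induction rule: tM_induct)
    case zero
    show ?case unfolding rep_hom_zero[OF F] rep_hom_zero[OF tf] by (rule refl)
  next
    case (pure x m)
    then show ?case by (simp only: F_pure t_mor_pure[OF f])
  next
    case (diff \<phi> \<psi>)
    then show ?case
      unfolding rep_hom_diff[OF F diff(1,2)] rep_hom_diff[OF tf diff(1,2)] by (simp only:)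
  qed
  have "F = t_mor G I M f"
  proof
    fix \<phi> show "F \<phi> = t_mor G I M f \<phi>"
    proof (cases "\<phi> \<in> carrier tM")
      case False
      then show ?thesis unfolding rep_homD(5)[OF F False] rep_homD(5)[OF tf False] by (simp only:)
    qed (rule eq)
  qed
  then show ?thesis by (rule image_eqI[OF _ f])
qed

theorem t_fully_faithful: "bij_betw (t_mor G I M) (left_hom H M N) (rep_hom G tM tN)"
proof (rule bij_betw_imageI[OF t_mor_inj], rule equalityI)
  show "t_mor G I M ` left_hom H M N \<subseteq> rep_hom G tM tN"
    by (rule image_subsetI) (rule t_mor_rep_hom)
  show "rep_hom G tM tN \<subseteq> t_mor G I M ` left_hom H M N"
    by (rule subsetI) (rule t_mor_surj)
qed

end

section \<open>Indices prime to the characteristic\<close>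

text \<open>One element is picked from each right coset; normality turns lying in the same right
  coset into the condition on r^-1 i, which concerns left cosets.\<close>

lemma (in normal) transversal:
  assumes fin: "finite (rcosets H)"
  shows "\<exists>R\<subseteq>carrier G. finite R \<and> card R = card (rcosets H) \<and> (\<forall>i\<in>carrier G. \<exists>!r. r \<in> R \<and> inv r \<otimes> i \<in> H)"
proof -
  define p where "p C = (SOME i. i \<in> C)" for C :: "'a set"
  have p: "p C \<in> carrier G" "H #> p C = C" if C: "C \<in> rcosets H" for C
  proof -
    obtain a where a: "a \<in> carrier G" "C = H #> a" using C by (auto simp: RCOSETS_def)
    have "p C \<in> C" unfolding p_def a using rcos_self[OF a(1) is_subgroup] by (rule someI)
    then show "p C \<in> carrier G" "H #> p C = C"
      using a elemrcos_carrier[OF is_group] repr_independence[OF _ _ is_subgroup] by auto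
  qed
  have inj: "inj_on p (rcosets H)"
    by (rule inj_on_inverseI[of _ "\<lambda>r. H #> r"]) (rule p)
  have mem: "inv r \<otimes> i \<in> H \<longleftrightarrow> H #> r = H #> i" if "r \<in> carrier G" "i \<in> carrier G" for r i
  proof -
    have "inv r \<otimes> i \<in> H \<longleftrightarrow> i \<in> r <# H"
    proof
      assume "inv r \<otimes> i \<in> H"
      then have "r \<otimes> (inv r \<otimes> i) \<in> r <# H" by (auto simp: l_coset_def)
      then show "i \<in> r <# H" using that by (simp add: m_assoc[symmetric])
    next
      assume "i \<in> r <# H"
      then show "inv r \<otimes> i \<in> H" using that subset by (auto simp: l_coset_def m_assoc[symmetric])
    qed
    also have "\<dots> \<longleftrightarrow> i \<in> H #> r" using coset_eq that by simp
    also have "\<dots> \<longleftrightarrow> H #> r = H #> i"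
      using that repr_independence[OF _ _ is_subgroup, of i r] rcos_self[OF that(2) is_subgroup] by auto
    finally show ?thesis .
  qed
  have "\<exists>!r. r \<in> p ` (rcosets H) \<and> inv r \<otimes> i \<in> H" if i: "i \<in> carrier G" for i
  proof (rule ex1I[of _ "p (H #> i)"])
    have "H #> i \<in> rcosets H" using i by (auto simp: RCOSETS_def)
    then show "p (H #> i) \<in> p ` (rcosets H) \<and> inv (p (H #> i)) \<otimes> i \<in> H"
      using p[of "H #> i"] mem i by auto
  next
    fix r assume "r \<in> p ` (rcosets H) \<and> inv r \<otimes> i \<in> H"
    then show "r = p (H #> i)" using p mem i by auto
  qed
  then show ?thesis
    using fin p(1) card_image[OF inj] by (intro exI[of _ "p ` (rcosets H)"]) auto
qed

text \<open>\<open>sylow_thm\<close> is used with exponent 1, which gives a subgroup of order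
  \<open>l\<close> also when a higher power of \<open>l\<close> divides the order of
  \<open>Q\<close>. By Lagrange each of its elements has trivial \<open>l\<close>-th power.\<close>

lemma cauchy_element:
  assumes "group Q" "finite (carrier Q)" "Factorial_Ring.prime l" "l dvd order Q"
  shows "\<exists>x\<in>carrier Q. x \<noteq> \<one>\<^bsub>Q\<^esub> \<and> x [^]\<^bsub>Q\<^esub> l = \<one>\<^bsub>Q\<^esub>"
proof -
  interpret group Q by fact
  obtain m where "order Q = l ^ 1 * m" using assms(4) by auto
  from sylow_thm[OF assms(3,1) this assms(2)] obtain L where L: "subgroup L Q" "card L = l" by auto
  then have "\<not> L \<subseteq> {\<one>\<^bsub>Q\<^esub>}"
    using card_mono[of "{\<one>\<^bsub>Q\<^esub>}" L] prime_gt_1_nat[OF assms(3)] by auto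
  then obtain x where x: "x \<in> L" "x \<noteq> \<one>\<^bsub>Q\<^esub>" by blast
  have "x [^]\<^bsub>Q\<lparr>carrier := L\<rparr>\<^esub> order (Q\<lparr>carrier := L\<rparr>) = \<one>\<^bsub>Q\<lparr>carrier := L\<rparr>\<^esub>"
    using group.pow_order_eq_1[OF subgroup_imp_group[OF L(1)]] x by simp
  then have "x [^]\<^bsub>Q\<^esub> l = \<one>\<^bsub>Q\<^esub>"
    using nat_pow_consistent[of x l L] by (simp add: order_def L(2))
  then show ?thesis using x subgroup.mem_carrier[OF L(1)] by blast
qed

text \<open>An index that vanishes in k is divisible by the characteristic. Being positive, it rules
  out characteristic 0, so the characteristic is prime and Cauchy gives a class of that order in the
  quotient, against \<open>tors\<close>.\<close>

lemma card_rcosets_unit: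
  assumes N: "normal H Q" and fin: "finite (rcosets\<^bsub>Q\<^esub> H)"
    and tors: "\<And>x. x \<in> carrier Q \<Longrightarrow> Factorial_Ring.prime CHAR('k::field) \<Longrightarrow>
      x [^]\<^bsub>Q\<^esub> CHAR('k) \<in> H \<Longrightarrow> x \<in> H"
  shows "of_nat (card (rcosets\<^bsub>Q\<^esub> H)) \<noteq> (0 :: 'k)"
proof
  interpret normal H Q by fact
  assume "of_nat (card (rcosets\<^bsub>Q\<^esub> H)) = (0 :: 'k)"
  then have dvd: "CHAR('k) dvd card (rcosets\<^bsub>Q\<^esub> H)" by (simp add: of_nat_eq_0_iff_char_dvd)
  have "rcosets\<^bsub>Q\<^esub> H \<noteq> {}" using one_closed by (auto simp: RCOSETS_def)
  then have "card (rcosets\<^bsub>Q\<^esub> H) > 0" using fin by (simp add: card_gt_0_iff)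
  then have "CHAR('k) > 0" using dvd by (intro Nat.gr0I) simp
  then have prime: "Factorial_Ring.prime CHAR('k)" by (rule prime_CHAR_semidom)
  obtain c where c: "c \<in> carrier (Q Mod H)" "c \<noteq> \<one>\<^bsub>Q Mod H\<^esub>" "c [^]\<^bsub>Q Mod H\<^esub> CHAR('k) = \<one>\<^bsub>Q Mod H\<^esub>"
    using cauchy_element[OF factorgroup_is_group _ prime] fin dvd by (auto simp: FactGroup_def order_def)
  obtain x where x: "x \<in> carrier Q" "c = H #>\<^bsub>Q\<^esub> x" using c(1) by (auto simp: carrier_FactGroup)
  have "H #>\<^bsub>Q\<^esub> (x [^]\<^bsub>Q\<^esub> CHAR('k)) = H" using c(3) x by (simp add: FactGroup_pow)
  then have "x [^]\<^bsub>Q\<^esub> CHAR('k) \<in> H" using rcos_self[OF nat_pow_closed[OF x(1)] is_subgroup, of "CHAR('k)"] by simp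
  then have "x \<in> H" using tors[OF x(1) prime] by simp
  then show False using c(2) x coset_join2[OF x(1) is_subgroup] by simp
qed

section \<open>Matrices\<close>

lemma matrix_diff_ldistrib: "A ** (B - C) = A ** B - A ** (C :: 'a::comm_ring_1^'m^'n)"
  and matrix_diff_rdistrib: "(B' - C') ** A' = B' ** A' - C' ** (A' :: 'a^'m^'n)"
  by (simp_all add: vec_eq_iff matrix_matrix_mult_def sum_subtractf left_diff_distrib right_diff_distrib)

lemma matrix_inv_mult:
  assumes "invertible (A :: 'a::semiring_1^'n^'n)"
  shows "A ** matrix_inv A = mat 1" "matrix_inv A ** A = mat 1"
  using someI_ex[OF assms[unfolded invertible_def]] by (simp_all add: matrix_inv_def)

lemma group_GLn: "group (GLn :: ('a::field, 'n::finite) mat monoid)"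
proof (rule groupI)
  fix x :: "('a, 'n) mat" assume "x \<in> carrier GLn"
  then have x: "invertible x" by (simp add: GLn_def)
  show "\<exists>y\<in>carrier GLn. y \<otimes>\<^bsub>GLn\<^esub> x = \<one>\<^bsub>GLn\<^esub>"
    using matrix_inv_mult[OF x] by (intro bexI[of _ "matrix_inv x"]) (auto simp: GLn_def invertible_def)
next
  have "mat 1 ** mat 1 = (mat 1 :: ('a, 'n) mat)" by simp
  then show "\<one>\<^bsub>GLn\<^esub> \<in> carrier (GLn :: ('a, 'n) mat monoid)" unfolding GLn_def invertible_def by auto
qed (simp_all add: GLn_def invertible_mult matrix_mul_assoc)

lemma map_to_ac_mult: "map_matrix to_ac (A ** B) = map_matrix to_ac A ** map_matrix to_ac B"
  by (simp add: vec_eq_iff matrix_matrix_mult_def to_ac_sum)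

lemma map_to_ac_one: "map_matrix to_ac (mat 1) = mat 1"
  by (simp add: vec_eq_iff mat_def)

lemma det_map_to_ac: "det (map_matrix to_ac A) = to_ac (det A)"
  by (simp add: det_def to_ac_sum to_ac_prod)

lemma map_to_ac_inj: "map_matrix to_ac A = map_matrix to_ac B \<Longrightarrow> A = B"
  by (simp add: vec_eq_iff)

text \<open>Invertibility descends from the algebraic closure through the determinant, and
  uniqueness of inverses shows that the inverse over the ground field maps to the inverse over the
  closure.\<close>

lemma rational_points_subgroup:
  assumes S: "subgroup S GLn" shows "subgroup (rational_points S) GLn"
proof (rule group.subgroupI[OF group_GLn])
  interpret GL: group "GLn :: ('a alg_closure, 'b) mat monoid" by (rule group_GLn)
  have inv: "invertible a" if "a \<in> rational_points S" for a
  proof -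
    have "invertible (map_matrix to_ac a)"
      using that subgroup.mem_carrier[OF S] by (auto simp: rational_points_def GLn_def)
    then show ?thesis by (simp add: invertible_det_nz det_map_to_ac)
  qed
  show "rational_points S \<subseteq> carrier GLn" using inv by (auto simp: GLn_def)
  show "rational_points S \<noteq> {}"
  proof -
    have "mat 1 \<in> rational_points S"
      using subgroup.one_closed[OF S] by (simp add: rational_points_def GLn_def map_to_ac_one)
    then show ?thesis by blast
  qed
  fix a assume a: "a \<in> rational_points S"
  show "a \<otimes>\<^bsub>GLn\<^esub> b \<in> rational_points S" if "b \<in> rational_points S" for b
    using a that subgroup.m_closed[OF S] by (simp add: rational_points_def GLn_def map_to_ac_mult)
  have eq: "inv\<^bsub>GLn\<^esub> a = matrix_inv a"
    using inv[OF a] matrix_inv_mult[OF inv[OF a]]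
    by (intro group.inv_equality[OF group_GLn]) (auto simp: GLn_def invertible_def)
  have "map_matrix to_ac (matrix_inv a) = inv\<^bsub>GLn\<^esub> (map_matrix to_ac a)"
  proof (rule GL.inv_equality[symmetric])
    have "map_matrix to_ac (matrix_inv a) ** map_matrix to_ac a = mat 1"
      "map_matrix to_ac a ** map_matrix to_ac (matrix_inv a) = mat 1"
      using matrix_inv_mult[OF inv[OF a]] by (simp_all add: map_to_ac_mult[symmetric] map_to_ac_one)
    then show "map_matrix to_ac (matrix_inv a) \<otimes>\<^bsub>GLn\<^esub> map_matrix to_ac a = \<one>\<^bsub>GLn\<^esub>"
      "map_matrix to_ac a \<in> carrier GLn" "map_matrix to_ac (matrix_inv a) \<in> carrier GLn"
      by (auto simp: GLn_def invertible_def)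
  qed
  then show "inv\<^bsub>GLn\<^esub> a \<in> rational_points S"
    using a subgroup.m_inv_closed[OF S] by (simp add: rational_points_def eq)
qed

text \<open>If \<open>P\<^sub>i = (u - 1)\<^sup>i\<close> and \<open>P\<^sub>i\<^sub>+\<^sub>2 = 0 \<noteq> P\<^sub>i\<^sub>+\<^sub>1\<close>, then \<open>u\<^sup>n P\<^sub>i = P\<^sub>i + n P\<^sub>i\<^sub>+\<^sub>1\<close>.\<close>

lemma unipotent_torsion:
  fixes u :: "('a::field, 'n::finite) mat"
  assumes nil: "(((**) (u - mat 1)) ^^ k) (mat 1) = 0"
    and pow: "u [^]\<^bsub>GLn\<^esub> (l::nat) = mat 1" and l: "of_nat l \<noteq> (0::'a)"
  shows "u = mat 1"
proof -
  define P where "P j = (((**) (u - mat 1)) ^^ j) (mat 1)" for j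
  \<comment> \<open>From here \<open>k\<close> is the exact index of nilpotency. If it is 1 then u =
    1; if it is at least 2, comparing u^l = 1 with the linear growth of u^n (u - 1)^(k-2) in n gives
    l (u - 1)^(k-1) = 0, against minimality.\<close>
  define k where "k = (LEAST k. P k = 0)"
  have k: "P k = 0" unfolding k_def by (rule LeastI) (use nil in \<open>simp only: P_def\<close>)
  have least: "P j \<noteq> 0" if "j < k" for j
    using that unfolding k_def by (rule not_less_Least)
  have P_Suc: "u ** P j = P j + P (Suc j)" for j
    by (simp add: P_def matrix_diff_rdistrib)
  have "P 0 \<noteq> 0" by (simp add: P_def vec_eq_iff mat_def)
  then obtain j where j: "k = Suc j" using k by (cases k) auto
  show ?thesis
  proof (cases j)
    case 0
    then show ?thesis using k j by (simp add: P_def)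
  next
    case (Suc i)
    have fix1: "u ** P (Suc i) = P (Suc i)" using P_Suc[of "Suc i"] k j Suc by simp
    have fixn: "u [^]\<^bsub>GLn\<^esub> n ** P (Suc i) = P (Suc i)" for n :: nat
      by (induction n) (simp_all add: GLn_def matrix_mul_assoc[symmetric] fix1)
    have "(u [^]\<^bsub>GLn\<^esub> n ** P i) $ a $ b = P i $ a $ b + of_nat n * P (Suc i) $ a $ b" for n :: nat and a b
    proof (induction n)
      case (Suc n)
      have "u [^]\<^bsub>GLn\<^esub> Suc n ** P i = u [^]\<^bsub>GLn\<^esub> n ** P i + P (Suc i)"
        using fixn[of n] P_Suc[of i] by (simp add: GLn_def matrix_mul_assoc[symmetric] matrix_add_ldistrib)
      then show ?case using Suc by (simp add: algebra_simps)
    qed (simp add: GLn_def)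
    from this[of l] have "P (Suc i) = 0"
      using l by (simp add: pow vec_eq_iff)
    then show ?thesis using least[of "Suc i"] j Suc by simp
  qed
qed

section \<open>Bounds over a nonarchimedean field\<close>

definition bounded_entries :: "('f \<Rightarrow> real) \<Rightarrow> real \<Rightarrow> ('f::field, 'n::finite) mat \<Rightarrow> bool" where
  "bounded_entries absv c A \<longleftrightarrow> (\<forall>i j. absv (A $ i $ j) \<le> c)"

context nonarch_local_field
begin

abbreviation bnd :: "real \<Rightarrow> ('f, 'n::finite) mat \<Rightarrow> bool" where "bnd \<equiv> bounded_entries absv"

section \<open>The absolute value and the residue map\<close>

lemma absv_0 [simp]: "absv 0 = 0"
  by (simp add: absv_eq_0_iff)

lemma absv_1 [simp]: "absv 1 = 1"
  using absv_mult[of 1 1] absv_eq_0_iff[of 1] by simp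

lemma absv_minus [simp]: "absv (- x) = absv x"
proof -
  have "absv (-1) * absv (-1) = 1" using absv_mult[of "-1" "-1"] by simp
  then have "absv (-1) = 1" using absv_nonneg[of "-1"] by (auto simp: square_eq_1_iff)
  then show ?thesis using absv_mult[of "-1" x] by simp
qed

lemma absv_diff_commute: "absv (x - y) = absv (y - x)"
  using absv_minus[of "x - y"] by simp

lemma absv_add_le: "absv x \<le> c \<Longrightarrow> absv y \<le> c \<Longrightarrow> absv (x + y) \<le> c"
  using absv_add[of x y] by simp

lemma absv_diff_le: "absv x \<le> c \<Longrightarrow> absv y \<le> c \<Longrightarrow> absv (x - y) \<le> c"
  using absv_add_le[of x c "- y"] by simp

lemma absv_sum_le: "0 \<le> c \<Longrightarrow> (\<And>i. i \<in> S \<Longrightarrow> absv (f i) \<le> c) \<Longrightarrow> absv (\<Sum>i\<in>S. f i) \<le> c"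
  by (induction S rule: infinite_finite_induct) (simp_all add: absv_add_le)

lemma absv_power: "absv (x ^ n) = absv x ^ n"
  by (induction n) (simp_all add: absv_mult)

lemma absv_of_nat_le: "absv (of_nat n) \<le> 1"
  by (induction n) (simp_all add: absv_add_le)

lemma res_0 [simp]: "res 0 = 0"
  using res_eq_0_iff[of 0] by simp

lemma res_sum: "(\<And>i. i \<in> S \<Longrightarrow> absv (f i) \<le> 1) \<Longrightarrow> res (\<Sum>i\<in>S. f i) = (\<Sum>i\<in>S. res (f i))"
  by (induction S rule: infinite_finite_induct) (simp_all add: res_add absv_sum_le)

lemma res_diff: "absv x \<le> 1 \<Longrightarrow> absv y \<le> 1 \<Longrightarrow> res (x - y) = res x - res y"
  using res_add[of "x - y" y] by (simp add: absv_diff_le)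

lemma res_of_nat: "res (of_nat n) = of_nat n"
  by (induction n) (simp_all add: res_add absv_of_nat_le res_1)

lemma absv_of_nat_eq_1: "of_nat l \<noteq> (0 :: 'r) \<Longrightarrow> absv (of_nat l) = 1"
  using res_eq_0_iff[of "of_nat l"] absv_of_nat_le[of l] res_of_nat[of l] by force

text \<open>Expansion in powers of \<pi>: x = s + \<pi> y, where s lifts the residue of x and y is
  integral again. Each step multiplies the number of representatives by at most the size of the
  residue field.\<close>

lemma finite_residue_reps: "\<exists>R. finite R \<and> (\<forall>x. absv x \<le> 1 \<longrightarrow> (\<exists>r\<in>R. absv (x - r) \<le> absv (\<pi> ^ m)))"
proof (induction m)
  case 0
  show ?case by (intro exI[of _ "{0}"]) auto
next
  case (Suc m)
  then obtain R where R: "finite R" "\<And>x. absv x \<le> 1 \<Longrightarrow> \<exists>r\<in>R. absv (x - r) \<le> absv (\<pi> ^ m)" by blast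
  define s where "s y = (SOME x. absv x \<le> 1 \<and> res x = y)" for y
  have s: "absv (s y) \<le> 1" "res (s y) = y" for y
  proof -
    have "y \<in> res ` {x. absv x \<le> 1}" unfolding res_surj by simp
    then have "\<exists>x. absv x \<le> 1 \<and> res x = y" by auto
    from someI_ex[OF this] show "absv (s y) \<le> 1" "res (s y) = y" by (simp_all add: s_def)
  qed
  have "\<exists>r\<in>(\<lambda>(y, r). s y + \<pi> * r) ` (UNIV \<times> R). absv (x - r) \<le> absv (\<pi> ^ Suc m)" if x: "absv x \<le> 1" for x
  proof -
    define y where "y = (x - s (res x)) / \<pi>"
    have "res (x - s (res x)) = 0" using x s by (simp add: res_diff)
    then have "absv (x - s (res x)) < 1" using res_eq_0_iff x s by (simp add: absv_diff_le)
    then have le: "absv (x - s (res x)) \<le> absv \<pi>" by (rule prime_element(3))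
    have y: "x - s (res x) = \<pi> * y" using prime_element(1) by (auto simp: y_def)
    have "absv \<pi> * absv y \<le> absv \<pi> * 1" using le unfolding y absv_mult by simp
    then have "absv y \<le> 1" using prime_element(1) mult_le_cancel_left_pos by blast
    then obtain r where r: "r \<in> R" "absv (y - r) \<le> absv (\<pi> ^ m)" using R by blast
    have "x - (s (res x) + \<pi> * r) = \<pi> * (y - r)" using y by (simp add: algebra_simps)
    then have "absv (x - (s (res x) + \<pi> * r)) \<le> absv (\<pi> ^ Suc m)"
      using r(2) prime_element(1) by (simp add: absv_mult)
    then show ?thesis using r(1) by (intro bexI[of _ "s (res x) + \<pi> * r"]) auto
  qed
  then show ?case using R(1) by (intro exI[of _ "(\<lambda>(y, r). s y + \<pi> * r) ` (UNIV \<times> R)"]) auto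
qed

section \<open>The maximum norm of matrices\<close>

lemma bnd_mono: "bnd c A \<Longrightarrow> c \<le> d \<Longrightarrow> bnd d A"
  by (meson bounded_entries_def order_trans)

lemma bnd_nonneg: "bnd c A \<Longrightarrow> 0 \<le> c"
proof -
  assume "bnd c A"
  then have "absv (A $ undefined $ undefined) \<le> c" by (simp add: bounded_entries_def)
  then show "0 \<le> c" by (rule order_trans[OF absv_nonneg])
qed

text \<open>The ultrametric inequality makes the maximum norm submultiplicative, without a factor
  for the size of the matrix.\<close>

lemma bnd_mult: "bnd a A \<Longrightarrow> bnd b B \<Longrightarrow> bnd (a * b) (A ** B)"
proof -
  assume A: "bnd a A" and B: "bnd b B"
  show ?thesis
    unfolding bounded_entries_def matrix_matrix_mult_def
  proof (intro allI, simp, rule absv_sum_le)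
    show "0 \<le> a * b" using bnd_nonneg[OF A] bnd_nonneg[OF B] by simp
    fix i j k
    show "absv (A $ i $ k * B $ k $ j) \<le> a * b"
      unfolding absv_mult using A B bnd_nonneg[OF A] absv_nonneg
      by (intro mult_mono) (simp_all add: bounded_entries_def)
  qed
qed

lemma bnd_add: "bnd c A \<Longrightarrow> bnd c B \<Longrightarrow> bnd c (A + B)"
  and bnd_diff: "bnd c A \<Longrightarrow> bnd c B \<Longrightarrow> bnd c (A - B)"
  and bnd_commute: "bnd c (A - B) \<Longrightarrow> bnd c (B - A)"
  by (simp_all add: bounded_entries_def absv_add_le absv_diff_le) (simp add: absv_diff_commute)

lemma bnd_one: "bnd 1 (mat 1)"
  by (simp add: bounded_entries_def mat_def)

lemma bnd_exists: "\<exists>c>0. bnd c A"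
proof -
  let ?S = "range (\<lambda>(i, j). absv (A $ i $ j))"
  have "absv (A $ i $ j) \<le> max 1 (Max ?S)" for i j
  proof -
    have "absv (A $ i $ j) \<in> ?S" by (rule range_eqI[of _ _ "(i, j)"]) simp
    then have "absv (A $ i $ j) \<le> Max ?S" by (intro Max_ge) simp
    then show ?thesis by simp
  qed
  then show ?thesis by (intro exI[of _ "max 1 (Max ?S)"]) (auto simp: bounded_entries_def)
qed

lemma bnd_attained: "\<exists>c i j. bnd c A \<and> absv (A $ i $ j) = c"
proof -
  let ?S = "range (\<lambda>(i, j). absv (A $ i $ j))"
  have "Max ?S \<in> ?S" by (rule Max_in) auto
  then obtain p where p: "Max ?S = (\<lambda>(i, j). absv (A $ i $ j)) p" by (elim rangeE)
  have "bnd (Max ?S) A"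
    unfolding bounded_entries_def
  proof (intro allI)
    fix i j
    have "absv (A $ i $ j) \<in> ?S" by (rule range_eqI[of _ _ "(i, j)"]) simp
    then show "absv (A $ i $ j) \<le> Max ?S" by (intro Max_ge) simp
  qed
  then show ?thesis using p by (intro exI[of _ "Max ?S"] exI[of _ "fst p"] exI[of _ "snd p"]) (simp add: case_prod_beta)
qed

text \<open>From B = 1 - B (A - 1), a largest entry of B of size c > 1 would satisfy c \<le> c r <
  c.\<close>

lemma bnd_inverse:
  assumes inv: "B ** A = mat 1" and A: "bnd r (A - mat 1)" and r: "r < 1" shows "bnd 1 B"
proof -
  obtain c i j where c: "bnd c B" "absv (B $ i $ j) = c" using bnd_attained by blast
  have "B = mat 1 - B ** (A - mat 1)" using inv by (simp add: matrix_diff_ldistrib)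
  moreover have "bnd (max 1 (c * r)) (mat 1 - B ** (A - mat 1))"
    by (intro bnd_diff bnd_mono[OF bnd_one] bnd_mono[OF bnd_mult[OF c(1) A]]) auto
  ultimately have "bnd (max 1 (c * r)) B" by simp
  then have le: "c \<le> max 1 (c * r)" using c(2) by (auto simp: bounded_entries_def)
  have "c \<le> 1"
  proof (rule ccontr)
    assume "\<not> c \<le> 1"
    then have "c * r < c * 1" using r by (intro mult_strict_left_mono) simp_all
    moreover have "c \<le> 1 \<or> c \<le> c * r" using le by (simp only: le_max_iff_disj)
    ultimately show False using \<open>\<not> c \<le> 1\<close> by linarith
  qed
  then show ?thesis by (rule bnd_mono[OF c(1)])
qed

text \<open>With \<open>Z = A - 1\<close> one has \<open>A\<^sup>l = 1 + l Z + E\<close>, where \<open>E\<close> is smaller than \<open>Z\<close> by a factor \<open>\<pi>\<close>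
  and \<open>l\<close> is a unit.\<close>

lemma near_one_torsion:
  fixes A :: "('f, 'n::finite) mat"
  assumes A: "bnd (absv \<pi>) (A - mat 1)" and pow: "bnd e (A [^]\<^bsub>GLn\<^esub> (l::nat) - mat 1)"
    and l: "of_nat l \<noteq> (0 :: 'r)"
  shows "bnd e (A - mat 1)"
proof -
  define Z where "Z = A - mat 1"
  obtain c i j where c: "bnd c Z" "absv (Z $ i $ j) = c" using bnd_attained by blast
  have c0: "0 \<le> c" using c(2) absv_nonneg by blast
  have cpi: "c \<le> absv \<pi>" using A c(2) by (auto simp: Z_def bounded_entries_def)
  define E where "E n = A [^]\<^bsub>GLn\<^esub> n - mat 1 - map_matrix ((*) (of_nat n)) Z" for n :: nat
  have scale: "bnd d (map_matrix ((*) (of_nat n)) B)" if "bnd d B" for n d and B :: "('f, 'n) mat"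
    unfolding bounded_entries_def
  proof (intro allI)
    fix i j
    have "absv (of_nat n) * absv (B $ i $ j) \<le> absv (B $ i $ j)"
      by (rule mult_left_le_one_le[OF absv_nonneg absv_nonneg absv_of_nat_le])
    also have "\<dots> \<le> d" using that by (simp add: bounded_entries_def)
    finally show "absv (map_matrix ((*) (of_nat n)) B $ i $ j) \<le> d" by (simp add: absv_mult)
  qed
  \<comment> \<open>The recursion is E(n+1) = E(n) + E(n) Z + n Z^2. Each term is at most c times
    the absolute value of \<pi>, because Z is bounded by c, c is at most that absolute value, and
    integers have absolute value at most 1.\<close>
  have E: "bnd (c * absv \<pi>) (E n)" for n
  proof (induction n)
    case 0
    have "E 0 = 0" by (simp add: E_def GLn_def vec_eq_iff)
    then show ?case using c0 absv_nonneg by (simp add: bounded_entries_def)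
  next
    case (Suc n)
    define P where "P = A [^]\<^bsub>GLn\<^esub> n"
    have "E (Suc n) = P ** A - mat 1 - map_matrix ((*) (of_nat (Suc n))) Z"
      by (simp add: E_def GLn_def P_def)
    also have "P ** A = P + P ** Z"
      by (simp add: Z_def matrix_diff_ldistrib)
    also have "P ** Z = E n ** Z + Z + map_matrix ((*) (of_nat n)) Z ** Z"
      by (simp add: E_def P_def matrix_diff_rdistrib)
    also have "P + (E n ** Z + Z + map_matrix ((*) (of_nat n)) Z ** Z) - mat 1 - map_matrix ((*) (of_nat (Suc n))) Z =
        E n + E n ** Z + map_matrix ((*) (of_nat n)) Z ** Z"
      by (simp add: E_def P_def vec_eq_iff algebra_simps)
    finally have "E (Suc n) = E n + E n ** Z + map_matrix ((*) (of_nat n)) Z ** Z" .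
    moreover have "bnd (c * absv \<pi>) (E n ** Z)"
    proof (rule bnd_mono[OF bnd_mult[OF Suc c(1)]])
      have "c \<le> 1" using cpi prime_element by simp
      then show "c * absv \<pi> * c \<le> c * absv \<pi>"
        using c0 absv_nonneg[of \<pi>] by (intro mult_left_le) simp_all
    qed
    moreover have "bnd (c * absv \<pi>) (map_matrix ((*) (of_nat n)) Z ** Z)"
      by (rule bnd_mono[OF bnd_mult[OF scale[OF c(1)] c(1)]]) (rule mult_left_mono[OF cpi c0])
    ultimately show ?case using Suc by (simp add: bnd_add)
  qed
  \<comment> \<open>At an entry where Z attains its norm c, l Z also has size c since l is a unit.
    So c is at most \<open>e\<close> or at most \<open>c * absv \<pi>\<close>, and the second case
    forces c = 0.\<close>
  have "of_nat l * Z $ i $ j = (A [^]\<^bsub>GLn\<^esub> l - mat 1) $ i $ j - E l $ i $ j"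
    by (simp add: E_def)
  moreover have "absv (of_nat l * Z $ i $ j) = c"
    using c(2) absv_of_nat_eq_1[OF l] by (simp add: absv_mult)
  moreover have "absv ((A [^]\<^bsub>GLn\<^esub> l - mat 1) $ i $ j - E l $ i $ j) \<le> max e (c * absv \<pi>)"
    using pow E[of l] by (intro absv_diff_le) (simp_all only: bounded_entries_def max.coboundedI1 max.coboundedI2)
  ultimately have "c \<le> max e (c * absv \<pi>)" by simp
  then have "c \<le> e \<or> c \<le> c * absv \<pi>" by (simp only: le_max_iff_disj)
  moreover have "c * absv \<pi> < c \<or> c = 0" using c0 prime_element by auto
  moreover have "e \<ge> 0"
    by (rule bnd_nonneg[OF pow])
  ultimately have "c \<le> e" by linarith
  then show ?thesis using bnd_mono[OF c(1)] unfolding Z_def by simp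
qed

lemma finite_matrix_reps:
  "\<exists>R. finite R \<and> (\<forall>A :: ('f, 'n::finite) mat. bnd 1 A \<longrightarrow> (\<exists>B\<in>R. bnd (absv (\<pi> ^ m)) (A - B)))"
proof -
  obtain R where R: "finite R" "\<And>x. absv x \<le> 1 \<Longrightarrow> \<exists>r\<in>R. absv (x - r) \<le> absv (\<pi> ^ m)"
    using finite_residue_reps by blast
  let ?R = "(\<lambda>f. \<chi> i j. f (i, j)) ` (UNIV \<rightarrow>\<^sub>E R) :: ('f, 'n) mat set"
  have fin: "finite ?R" using R(1) by (intro finite_imageI finite_PiE) auto
  have "\<exists>B\<in>?R. bnd (absv (\<pi> ^ m)) (A - B)" if A: "bnd 1 A" for A
  proof -
    define q where "q x = (SOME r. r \<in> R \<and> absv (x - r) \<le> absv (\<pi> ^ m))" for x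
    have q: "q x \<in> R" "absv (x - q x) \<le> absv (\<pi> ^ m)" if "absv x \<le> 1" for x
      using someI_ex[OF R(2)[OF that, unfolded Bex_def]] by (auto simp: q_def)
    show ?thesis
    proof (rule bexI)
      show "bnd (absv (\<pi> ^ m)) (A - (\<chi> i j. q (A $ i $ j)))"
        using A q by (simp add: bounded_entries_def)
      show "(\<chi> i j. q (A $ i $ j)) \<in> ?R"
        by (rule image_eqI[of _ _ "\<lambda>(i, j). q (A $ i $ j)"]) (use A q in \<open>auto simp: bounded_entries_def\<close>)
    qed
  qed
  then show ?thesis using fin by blast
qed

lemma mat_metric: "Metric_space S (\<lambda>g h :: ('f, 'n::finite) mat. Max (range (\<lambda>(i, j). absv (g $ i $ j - h $ i $ j))))"
proof
  define d where "d g h = Max (range (\<lambda>(i, j). absv (g $ i $ j - h $ i $ j)))" for g h :: "('f, 'n) mat"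
  have le: "d g h \<le> e \<longleftrightarrow> (\<forall>i j. absv (g $ i $ j - h $ i $ j) \<le> e)" for g h e
    unfolding d_def by (subst Max_le_iff) auto
  have nonneg: "0 \<le> d g h" for g h
  proof -
    have "absv (g $ undefined $ undefined - h $ undefined $ undefined) \<le> d g h"
      using le[of g h "d g h"] by simp
    then show ?thesis by (rule order_trans[OF absv_nonneg])
  qed
  then show "0 \<le> Max (range (\<lambda>(i, j). absv (g $ i $ j - h $ i $ j)))" for g h :: "('f, 'n) mat"
    by (simp add: d_def)
  show "Max (range (\<lambda>(i, j). absv (g $ i $ j - h $ i $ j))) = Max (range (\<lambda>(i, j). absv (h $ i $ j - g $ i $ j)))"
    for g h :: "('f, 'n) mat" by (simp add: absv_diff_commute)
  have "d g h = 0 \<longleftrightarrow> g = h" for g h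
  proof
    assume "d g h = 0"
    then have "absv (g $ i $ j - h $ i $ j) \<le> 0" for i j using le[of g h 0] by simp
    then have "g $ i $ j - h $ i $ j = 0" for i j using absv_nonneg absv_eq_0_iff by (metis order_antisym)
    then show "g = h" by (simp add: vec_eq_iff)
  next
    assume "g = h"
    then have "d g h \<le> 0" using le[of g h 0] by simp
    then show "d g h = 0" using nonneg[of g h] by (rule order_antisym)
  qed
  then show "Max (range (\<lambda>(i, j). absv (g $ i $ j - h $ i $ j))) = 0 \<longleftrightarrow> g = h" for g h :: "('f, 'n) mat"
    by (simp add: d_def)
  have "d g k \<le> d g h + d h k" for g h k
    unfolding le
  proof (intro allI)
    fix i j
    have "absv (g $ i $ j - k $ i $ j) \<le> max (absv (g $ i $ j - h $ i $ j)) (absv (h $ i $ j - k $ i $ j))"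
      using absv_add[of "g $ i $ j - h $ i $ j" "h $ i $ j - k $ i $ j"] by simp
    also have "\<dots> \<le> max (d g h) (d h k)"
      using le[of g h "d g h"] le[of h k "d h k"] by (intro max.mono) auto
    also have "\<dots> \<le> d g h + d h k" using nonneg by (simp add: max_def)
    finally show "absv (g $ i $ j - k $ i $ j) \<le> d g h + d h k" .
  qed
  then show "Max (range (\<lambda>(i, j). absv (g $ i $ j - k $ i $ j))) \<le>
      Max (range (\<lambda>(i, j). absv (g $ i $ j - h $ i $ j))) + Max (range (\<lambda>(i, j). absv (h $ i $ j - k $ i $ j)))"
    for g h k :: "('f, 'n) mat" by (simp add: d_def)
qed

end

section \<open>The pro-\<open>p\<close>-Iwahori subgroup\<close>

context pro_p_iwahori_setting
begin

abbreviation "Gr \<equiv> rational_group GG"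
abbreviation "Iw \<equiv> reduction_preimage absv res GG NN"
abbreviation "Kpts \<equiv> integral_points absv GG"
abbreviation "Km \<equiv> congruence_subgroup absv \<pi> GG"

section \<open>The rational points, the integral points and the congruence subgroups\<close>

lemma GG_subgroup: "subgroup GG GLn"
  using reductive by (simp add: connected_reductive_def conn_alg_group_def alg_group_def)

lemma NN_subgroup: "subgroup NN GLn" and NN_unipotent: "unipotent_set NN"
  using radical by (simp_all add: unipotent_radical_def Let_def conn_alg_group_def alg_group_def)

lemma Gr_simps: "carrier Gr = rational_points GG" "g \<otimes>\<^bsub>Gr\<^esub> h = g ** h" "\<one>\<^bsub>Gr\<^esub> = mat 1"
  by (simp_all add: rational_group_def GLn_def)

lemma Gr_group: "group Gr"
  unfolding rational_group_def
  by (rule group.subgroup_imp_group[OF group_GLn rational_points_subgroup[OF GG_subgroup]])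

lemma Gr_invertible: "g \<in> rational_points GG \<Longrightarrow> invertible g"
  using subgroup.mem_carrier[OF rational_points_subgroup[OF GG_subgroup]] by (fastforce simp: GLn_def)

lemma Gr_inv: assumes g: "g \<in> rational_points GG" shows "inv\<^bsub>Gr\<^esub> g = matrix_inv g"
proof -
  interpret Gr: group Gr by (rule Gr_group)
  have inv: "inv\<^bsub>Gr\<^esub> g ** g = mat 1" using Gr.l_inv[of g] g by (simp add: Gr_simps)
  have "inv\<^bsub>Gr\<^esub> g = (inv\<^bsub>Gr\<^esub> g ** g) ** matrix_inv g"
    by (simp add: matrix_mul_assoc[symmetric] matrix_inv_mult[OF Gr_invertible[OF g]])
  then show ?thesis by (simp add: inv)
qed

lemma rat_closed: "g \<in> rational_points GG \<Longrightarrow> h \<in> rational_points GG \<Longrightarrow> g ** h \<in> rational_points GG"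
  and rat_inv: "g \<in> rational_points GG \<Longrightarrow> matrix_inv g \<in> rational_points GG"
  and rat_one: "mat 1 \<in> rational_points GG"
  and rat_inv_inv: "g \<in> rational_points GG \<Longrightarrow> matrix_inv (matrix_inv g) = g"
  and rat_inv_mult: "g \<in> rational_points GG \<Longrightarrow> h \<in> rational_points GG \<Longrightarrow>
      matrix_inv (g ** h) = matrix_inv h ** matrix_inv g"
  using group.is_monoid[OF Gr_group] monoid.m_closed[of Gr g h] monoid.one_closed[of Gr]
    group.inv_closed[OF Gr_group, of g] group.inv_inv[OF Gr_group, of g] group.inv_mult_group[OF Gr_group, of g h]
  by (simp_all add: Gr_simps Gr_inv)

lemma Kpts_iff: "g \<in> Kpts \<longleftrightarrow> g \<in> rational_points GG \<and> bnd 1 g \<and> bnd 1 (matrix_inv g)"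
  by (auto simp: integral_points_def bounded_entries_def)

lemma bnd_mult_1: "bnd c A \<Longrightarrow> bnd 1 B \<Longrightarrow> bnd c (A ** B)" "bnd 1 A \<Longrightarrow> bnd c B \<Longrightarrow> bnd c (A ** B)"
  using bnd_mult[of c A 1 B] bnd_mult[of 1 A c B] by simp_all

lemma matrix_inv_one: "matrix_inv (mat 1 :: ('f, 'n) mat) = mat 1"
  using matrix_inv_mult(1)[of "mat 1 :: ('f, 'n) mat"] by (auto simp: invertible_def intro: exI[of _ "mat 1"])

lemma Kpts_closed: "g \<in> Kpts \<Longrightarrow> h \<in> Kpts \<Longrightarrow> g ** h \<in> Kpts"
  and Kpts_inv: "g \<in> Kpts \<Longrightarrow> matrix_inv g \<in> Kpts"
  and Kpts_one: "mat 1 \<in> Kpts"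
  by (auto simp: Kpts_iff rat_closed rat_inv rat_one rat_inv_mult rat_inv_inv bnd_mult_1 matrix_inv_one bnd_one)

text \<open>Integrality of the inverse is part of belonging to \<open>Kpts\<close>; the strict bound
  r < 1 supplies it through \<open>bnd_inverse\<close>.\<close>

lemma near_one_Kpts:
  assumes g: "g \<in> rational_points GG" and bnd: "bnd r (g - mat 1)" and r: "r < 1" shows "g \<in> Kpts"
proof -
  have "bnd 1 ((g - mat 1) + mat 1)"
    using bnd_mono[OF bnd, of 1] r by (intro bnd_add bnd_one) simp
  then show ?thesis
    using g bnd_inverse[OF matrix_inv_mult(2)[OF Gr_invertible[OF g]] bnd r] by (simp add: Kpts_iff)
qed

lemma Km_iff: "g \<in> Km m \<longleftrightarrow> g \<in> Kpts \<and> bnd (absv (\<pi> ^ m)) (g - mat 1)"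
  by (auto simp: congruence_subgroup_def bounded_entries_def)

lemma subgroup_GrI:
  assumes "S \<subseteq> rational_points GG" "mat 1 \<in> S" "\<And>g h. g \<in> S \<Longrightarrow> h \<in> S \<Longrightarrow> g ** h \<in> S" "\<And>g. g \<in> S \<Longrightarrow> matrix_inv g \<in> S"
  shows "subgroup S Gr"
  using assms by unfold_locales (auto simp: Gr_simps Gr_inv subset_iff)

lemma Km_subgroup: "subgroup (Km m) Gr"
proof (rule subgroup_GrI)
  show "Km m \<subseteq> rational_points GG" by (auto simp: Km_iff Kpts_iff)
  show "mat 1 \<in> Km m" by (simp add: Km_iff Kpts_one bounded_entries_def absv_nonneg)
  fix g assume g: "g \<in> Km m"
  then have b: "bnd 1 g" "bnd 1 (matrix_inv g)" "g \<in> rational_points GG" by (auto simp: Km_iff Kpts_iff)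
  have "mat 1 - matrix_inv g = matrix_inv g ** (g - mat 1)"
    using matrix_inv_mult[OF Gr_invertible[OF b(3)]] by (simp add: matrix_diff_ldistrib)
  then have "bnd (absv (\<pi> ^ m)) (matrix_inv g - mat 1)"
    using g b by (intro bnd_commute[of _ "mat 1"]) (simp add: Km_iff bnd_mult_1)
  then show "matrix_inv g \<in> Km m" using g by (simp add: Km_iff Kpts_inv)
  show "g ** h \<in> Km m" if h: "h \<in> Km m" for h
  proof -
    have eq: "g ** h - mat 1 = g ** (h - mat 1) + (g - mat 1)" by (simp add: matrix_diff_ldistrib)
    have "bnd (absv (\<pi> ^ m)) (g ** h - mat 1)"
      unfolding eq using g h b(1) by (intro bnd_add bnd_mult_1(2)) (simp_all add: Km_iff)
    then show ?thesis using g h by (simp add: Km_iff Kpts_closed)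
  qed
qed

text \<open>Conjugation fixes 1, so it acts on k - 1 and costs only the norms of g and of its
  inverse.\<close>

lemma conj_bound:
  assumes g: "g \<in> rational_points GG" and "bnd a (matrix_inv g)" "bnd b (k - mat 1)" "bnd c g"
  shows "bnd (a * b * c) (matrix_inv g ** k ** g - mat 1)"
proof -
  have "matrix_inv g ** k ** g - mat 1 = matrix_inv g ** (k - mat 1) ** g"
    using matrix_inv_mult[OF Gr_invertible[OF g]] by (simp add: matrix_diff_ldistrib matrix_diff_rdistrib)
  then show ?thesis using assms by (simp add: bnd_mult)
qed

lemma Km_normal: "i \<in> Kpts \<Longrightarrow> k \<in> Km m \<Longrightarrow> matrix_inv i ** k ** i \<in> Km m"
  using conj_bound[of i 1 "absv (\<pi> ^ m)" k 1] by (simp add: Km_iff Kpts_closed Kpts_inv) (simp add: Kpts_iff)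

lemma Km_mono: "m \<le> n \<Longrightarrow> Km n \<subseteq> Km m"
proof (rule subsetI)
  fix g assume mn: "m \<le> n" and g: "g \<in> Km n"
  have "absv (\<pi> ^ n) \<le> absv (\<pi> ^ m)"
    using power_decreasing[OF mn, of "absv \<pi>"] prime_element by (simp add: absv_power)
  then show "g \<in> Km m" using g bnd_mono[of "absv (\<pi> ^ n)" "g - mat 1"] by (simp add: Km_iff)
qed

section \<open>Reduction to the residue field and torsion in the pro-p-Iwahori subgroup\<close>

lemma map_res_mult: "bnd 1 A \<Longrightarrow> bnd 1 B \<Longrightarrow> map_matrix res (A ** B) = map_matrix res A ** map_matrix res B"
  by (simp add: vec_eq_iff matrix_matrix_mult_def bounded_entries_def res_sum res_mult absv_mult mult_le_one absv_nonneg)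

lemma map_res_one: "map_matrix res (mat 1) = mat 1"
  by (simp add: vec_eq_iff mat_def res_1)

lemma Iw_iff: "g \<in> Iw \<longleftrightarrow> g \<in> Kpts \<and> map_matrix res g \<in> rational_points NN"
  by (simp add: reduction_preimage_def)

lemma Km_res: "m \<ge> 1 \<Longrightarrow> g \<in> Km m \<Longrightarrow> map_matrix res g = mat 1"
proof -
  assume m: "m \<ge> 1" and g: "g \<in> Km m"
  have small: "absv (\<pi> ^ m) < 1"
    using m prime_element power_less_one_iff[of "absv \<pi>" m] by (simp add: absv_power)
  have "res (g $ i $ j) = res ((mat 1 :: ('f, 'n) mat) $ i $ j)" for i j
  proof -
    have le: "absv (g $ i $ j) \<le> 1" "absv ((mat 1 :: ('f, 'n) mat) $ i $ j) \<le> 1"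
      using g bnd_one by (auto simp: Km_iff Kpts_iff bounded_entries_def)
    have "absv (g $ i $ j - (mat 1 :: ('f, 'n) mat) $ i $ j) < 1"
      using g small by (auto simp: Km_iff bounded_entries_def intro: le_less_trans)
    then have "res (g $ i $ j - (mat 1 :: ('f, 'n) mat) $ i $ j) = 0"
      using res_eq_0_iff le by (simp add: absv_diff_le)
    then show ?thesis using res_diff[OF le] by simp
  qed
  then have "map_matrix res g = map_matrix res (mat 1)" by (simp add: vec_eq_iff)
  then show ?thesis by (simp add: map_res_one)
qed

lemma NN_rational: "subgroup (rational_points NN) GLn"
  by (rule rational_points_subgroup[OF NN_subgroup])

lemma Km_Iw: "m \<ge> 1 \<Longrightarrow> Km m \<subseteq> Iw"
  using Km_res subgroup.one_closed[OF NN_rational] by (auto simp: Iw_iff Km_iff GLn_def)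

lemma Iw_subgroup: "subgroup Iw Gr"
proof (rule subgroup_GrI)
  show "Iw \<subseteq> rational_points GG" by (auto simp: Iw_iff Kpts_iff)
  show "mat 1 \<in> Iw" using subgroup.one_closed[OF NN_rational] by (simp add: Iw_iff Kpts_one map_res_one GLn_def)
  fix g assume g: "g \<in> Iw"
  show "g ** h \<in> Iw" if h: "h \<in> Iw" for h
    using g h subgroup.m_closed[OF NN_rational, of "map_matrix res g" "map_matrix res h"]
    by (auto simp: Iw_iff Kpts_closed Kpts_iff map_res_mult GLn_def rat_closed bnd_mult_1 rat_inv_mult)
  have gK: "g \<in> Kpts" "bnd 1 g" "bnd 1 (matrix_inv g)" "g \<in> rational_points GG"
    using g by (auto simp: Iw_iff Kpts_iff)
  have "map_matrix res (matrix_inv g) ** map_matrix res g = mat 1"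
    "map_matrix res g ** map_matrix res (matrix_inv g) = mat 1"
    using gK matrix_inv_mult[OF Gr_invertible[OF gK(4)]] by (simp_all add: map_res_mult[symmetric] map_res_one)
  then have "inv\<^bsub>GLn\<^esub> (map_matrix res g) = map_matrix res (matrix_inv g)"
    by (intro group.inv_equality[OF group_GLn]) (auto simp: GLn_def invertible_def)
  then show "matrix_inv g \<in> Iw"
    using g subgroup.m_inv_closed[OF NN_rational, of "map_matrix res g"] by (simp add: Iw_iff Kpts_inv)
qed

lemma Iw_torsion:
  assumes g: "g \<in> Iw" and pow: "g [^]\<^bsub>GLn\<^esub> (l::nat) \<in> Km m" and m: "m \<ge> 1" and l: "of_nat l \<noteq> (0 :: 'r)"
  shows "g \<in> Km m"
proof -
  have gK: "g \<in> Kpts" using g by (simp add: Iw_iff)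
  have powK: "g [^]\<^bsub>GLn\<^esub> n \<in> Kpts" for n :: nat
    by (induction n) (auto simp: GLn_def Kpts_one Kpts_closed gK)
  let ?u = "map_matrix to_ac (map_matrix res g)"
  have "?u [^]\<^bsub>GLn\<^esub> n = map_matrix to_ac (map_matrix res (g [^]\<^bsub>GLn\<^esub> n))" for n :: nat
  proof (induction n)
    case 0
    show ?case by (simp add: GLn_def map_res_one map_to_ac_one)
  next
    case (Suc n)
    then show ?case
      using powK[of n] gK by (simp add: GLn_def Kpts_iff map_res_mult map_to_ac_mult)
  qed
  then have u_pow: "?u [^]\<^bsub>GLn\<^esub> l = mat 1"
    using Km_res[OF m pow] by (simp add: map_to_ac_one)
  have "?u \<in> NN" using g by (simp add: Iw_iff rational_points_def)
  then obtain k where k: "(((**) (?u - mat 1)) ^^ k) (mat 1) = 0"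
    using NN_unipotent unfolding unipotent_set_def by blast
  have "of_nat l \<noteq> (0 :: 'r alg_closure)"
    using l by (simp add: of_nat_eq_0_iff_char_dvd)
  with k u_pow have "?u = mat 1" by (rule unipotent_torsion)
  then have res_g: "map_matrix res g = mat 1"
    using map_to_ac_inj[of "map_matrix res g" "mat 1"] by (simp add: map_to_ac_one)
  \<comment> \<open>Trivial reduction puts the entries of g - 1 strictly below 1, hence at most at
    the size of the prime element: the starting bound that \<open>near_one_torsion\<close> improves
    to level m.\<close>
  have "bnd (absv \<pi>) (g - mat 1)"
    unfolding bounded_entries_def
  proof (intro allI)
    fix i j
    have le: "absv (g $ i $ j) \<le> 1" "absv ((mat 1 :: ('f, 'n) mat) $ i $ j) \<le> 1"
      using gK bnd_one by (auto simp: Kpts_iff bounded_entries_def)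
    have "res (g $ i $ j) = res ((mat 1 :: ('f, 'n) mat) $ i $ j)"
      using res_g map_res_one by (metis nth_map_matrix)
    then have "res (g $ i $ j - (mat 1 :: ('f, 'n) mat) $ i $ j) = 0" using res_diff[OF le] by simp
    then have "absv (g $ i $ j - (mat 1 :: ('f, 'n) mat) $ i $ j) < 1"
      using res_eq_0_iff le by (simp add: absv_diff_le)
    then show "absv ((g - mat 1) $ i $ j) \<le> absv \<pi>" by (simp add: prime_element)
  qed
  then have "bnd (absv (\<pi> ^ m)) (g - mat 1)"
    by (rule near_one_torsion) (use pow l in \<open>simp_all add: Km_iff\<close>)
  then show ?thesis using gK by (simp add: Km_iff)
qed

section \<open>Smallness of congruence subgroups and the topology of the group\<close>

lemma small_power: "e > 0 \<Longrightarrow> \<exists>n. c * absv (\<pi> ^ Suc n) \<le> e"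
proof -
  assume e: "e > 0"
  have "(\<lambda>n. c * absv \<pi> ^ Suc n) \<longlonglongrightarrow> c * 0"
    using prime_element by (intro tendsto_mult tendsto_const LIMSEQ_Suc LIMSEQ_power_zero) simp
  then have "eventually (\<lambda>n. c * absv \<pi> ^ Suc n < e) sequentially"
    using e by (intro order_tendstoD(2)) auto
  then obtain n where "c * absv \<pi> ^ Suc n < e" by (auto simp: eventually_sequentially)
  then show ?thesis by (intro exI[of _ n]) (simp only: absv_power less_imp_le)
qed

text \<open>The norms of g and its inverse are fixed, so for large n conjugation by g still takes
  K_{n+1} into K_1, which lies in \<open>Iw\<close>.\<close>

lemma conj_Km_Iw:
  assumes g: "g \<in> rational_points GG" shows "\<exists>n. \<forall>k\<in>Km (Suc n). matrix_inv g ** k ** g \<in> Iw"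
proof -
  obtain a where a: "a > 0" "bnd a (matrix_inv g)" using bnd_exists by blast
  obtain c where c: "c > 0" "bnd c g" using bnd_exists by blast
  obtain n where n: "(a * c) * absv (\<pi> ^ Suc n) \<le> absv \<pi>" using small_power[OF prime_element(1)] by blast
  have "matrix_inv g ** k ** g \<in> Iw" if k: "k \<in> Km (Suc n)" for k
  proof -
    have k': "k \<in> rational_points GG" "bnd (absv (\<pi> ^ Suc n)) (k - mat 1)"
      using k unfolding Km_iff Kpts_iff by blast+
    have r: "matrix_inv g ** k ** g \<in> rational_points GG"
      using g k'(1) by (simp only: rat_closed rat_inv)
    have "a * absv (\<pi> ^ Suc n) * c \<le> absv \<pi>"
      using n by (simp only: mult.commute mult.left_commute)
    then have b: "bnd (absv \<pi>) (matrix_inv g ** k ** g - mat 1)"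
      by (rule bnd_mono[OF conj_bound[OF g a(2) k'(2) c(2)]])
    have "matrix_inv g ** k ** g \<in> Km 1"
      using near_one_Kpts[OF r b prime_element(2)] b by (simp add: Km_iff)
    then show ?thesis using Km_Iw[of 1] by auto
  qed
  then show ?thesis by blast
qed

lemma open_stable:
  assumes S: "S \<subseteq> carrier Gr" and stable: "\<And>g k. g \<in> S \<Longrightarrow> k \<in> Km (Suc n) \<Longrightarrow> g \<otimes>\<^bsub>Gr\<^esub> k \<in> S"
  shows "openin (mat_topology absv (carrier Gr)) S"
proof -
  interpret T: Metric_space "carrier Gr" "\<lambda>g h :: ('f, 'n) mat. Max (range (\<lambda>(i, j). absv (g $ i $ j - h $ i $ j)))"
    by (rule mat_metric)
  have pos: "absv (\<pi> ^ Suc n) > 0" and lt1: "absv (\<pi> ^ Suc n) < 1"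
    using prime_element power_less_one_iff[of "absv \<pi>" "Suc n"] by (simp_all add: absv_power del: power_Suc)
  show ?thesis
    unfolding mat_topology_def T.openin_mtopology
  proof (intro conjI S allI impI)
    fix g assume gS: "g \<in> S"
    then have g: "g \<in> rational_points GG" using S by (auto simp: Gr_simps)
    obtain c where c: "c > 0" "bnd c (matrix_inv g)" using bnd_exists by blast
    \<comment> \<open>If h is within this radius of g, then g^-1 h - 1 = g^-1 (h - g) is bounded by
      the absolute value of \<pi>^(n+1); so h is g times an element of K_{n+1} and stays in
      S.\<close>
    define r where "r = absv (\<pi> ^ Suc n) / c"
    have "h \<in> S" if h: "h \<in> T.mball g r" for h
    proof -
      have hr: "h \<in> carrier Gr" and hd: "Max (range (\<lambda>(i, j). absv (g $ i $ j - h $ i $ j))) < r"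
        using h by (simp_all only: T.in_mball)
      then have hr: "h \<in> rational_points GG" by (simp add: Gr_simps)
      have "bnd r (g - h)"
        unfolding bounded_entries_def
      proof (intro allI)
        fix i j
        have "absv (g $ i $ j - h $ i $ j) \<in> range (\<lambda>(i, j). absv (g $ i $ j - h $ i $ j))"
          by (rule range_eqI[of _ _ "(i, j)"]) simp
        then have "absv (g $ i $ j - h $ i $ j) \<le> Max (range (\<lambda>(i, j). absv (g $ i $ j - h $ i $ j)))"
          by (intro Max_ge) simp
        from le_less_trans[OF this hd] show "absv ((g - h) $ i $ j) \<le> r" by simp
      qed
      then have "bnd (c * r) (matrix_inv g ** (h - g))" by (rule bnd_mult[OF c(2) bnd_commute])
      moreover have "matrix_inv g ** (h - g) = matrix_inv g ** h - mat 1"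
        using matrix_inv_mult[OF Gr_invertible[OF g]] by (simp add: matrix_diff_ldistrib)
      ultimately have b: "bnd (absv (\<pi> ^ Suc n)) (matrix_inv g ** h - mat 1)" using c by (simp add: r_def)
      have "matrix_inv g ** h \<in> Km (Suc n)"
        unfolding Km_iff using near_one_Kpts[OF rat_closed[OF rat_inv[OF g] hr] b lt1] b by simp
      then have "g ** (matrix_inv g ** h) \<in> S" using stable[OF gS] by (simp add: Gr_simps)
      then show ?thesis using matrix_inv_mult[OF Gr_invertible[OF g]] by (simp add: matrix_mul_assoc)
    qed
    moreover have "r > 0" using c pos by (simp add: r_def)
    ultimately show "\<exists>r>0. T.mball g r \<subseteq> S" by blast
  qed
qed

section \<open>The index of the congruence subgroups\<close>

lemma Km_transversal:
  assumes char: "CHAR('k::field) \<noteq> CHAR('r)" and m: "m \<ge> 1"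
  shows "\<exists>R\<subseteq>Iw. finite R \<and> (\<forall>i\<in>Iw. \<exists>!r. r \<in> R \<and> matrix_inv r ** i \<in> Km m) \<and> of_nat (card R) \<noteq> (0 :: 'k)"
proof -
  define Q where "Q = Gr\<lparr>carrier := Iw\<rparr>"
  interpret Gr: group Gr by (rule Gr_group)
  interpret Q: group Q unfolding Q_def by (rule Gr.subgroup_imp_group[OF Iw_subgroup])
  have Iw_rat: "i \<in> Iw \<Longrightarrow> i \<in> rational_points GG" and Iw_K: "i \<in> Iw \<Longrightarrow> i \<in> Kpts" for i
    by (auto simp: Iw_iff Kpts_iff)
  have Q_simps: "carrier Q = Iw" "g \<otimes>\<^bsub>Q\<^esub> h = g ** h" "\<one>\<^bsub>Q\<^esub> = mat 1" for g h
    by (simp_all add: Q_def Gr_simps)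
  have Q_inv: "inv\<^bsub>Q\<^esub> g = matrix_inv g" if "g \<in> Iw" for g
    using Gr.m_inv_consistent[OF Iw_subgroup that] Gr_inv[OF Iw_rat[OF that]] by (simp add: Q_def)
  have sub: "subgroup (Km m) Q"
    unfolding Q_def by (rule Gr.subgroup_incl[OF Km_subgroup Iw_subgroup Km_Iw[OF m]])
  have normal: "normal (Km m) Q"
  proof (rule Q.normal_invI[OF sub])
    fix x h assume x: "x \<in> carrier Q" and h: "h \<in> Km m"
    have "matrix_inv (matrix_inv x) ** h ** matrix_inv x \<in> Km m"
      using x h by (intro Km_normal Kpts_inv) (simp_all add: Q_simps Iw_K)
    then show "x \<otimes>\<^bsub>Q\<^esub> h \<otimes>\<^bsub>Q\<^esub> inv\<^bsub>Q\<^esub> x \<in> Km m"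
      using x by (simp add: Q_simps Q_inv rat_inv_inv Iw_rat)
  qed
  \<comment> \<open>Two elements i, j of \<open>Iw\<close> close to the same matrix B modulo \<pi>^m
    lie in one coset, since i j^-1 - 1 = (i - j) j^-1 and j^-1 is integral. There are finitely many
    B; \<open>SOME\<close> picks one element of \<open>Iw\<close> near each B that has any.\<close>
  have fin: "finite (rcosets\<^bsub>Q\<^esub> Km m)"
  proof -
    obtain R :: "('f, 'n) mat set" where R: "finite R" "\<And>A. bnd 1 A \<Longrightarrow> \<exists>B\<in>R. bnd (absv (\<pi> ^ m)) (A - B)"
      using finite_matrix_reps by blast
    have "rcosets\<^bsub>Q\<^esub> Km m \<subseteq> (\<lambda>B. Km m #>\<^bsub>Q\<^esub> (SOME i. i \<in> Iw \<and> bnd (absv (\<pi> ^ m)) (i - B))) ` R"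
    proof
      fix c assume "c \<in> rcosets\<^bsub>Q\<^esub> Km m"
      then obtain i where i: "i \<in> Iw" "c = Km m #>\<^bsub>Q\<^esub> i" by (auto simp: RCOSETS_def Q_simps)
      then obtain B where B: "B \<in> R" "bnd (absv (\<pi> ^ m)) (i - B)" using R(2) by (auto simp: Iw_iff Kpts_iff)
      define j where "j = (SOME i. i \<in> Iw \<and> bnd (absv (\<pi> ^ m)) (i - B))"
      have j: "j \<in> Iw" "bnd (absv (\<pi> ^ m)) (j - B)"
        using someI[of "\<lambda>i. i \<in> Iw \<and> bnd (absv (\<pi> ^ m)) (i - B)" i] i B by (auto simp: j_def)
      have "bnd (absv (\<pi> ^ m)) ((i - B) - (j - B))" by (rule bnd_diff[OF B(2) j(2)])
      then have "bnd (absv (\<pi> ^ m)) ((i - j) ** matrix_inv j)"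
        using Iw_K[OF j(1)] by (intro bnd_mult_1(1)) (simp_all add: Kpts_iff)
      then have "bnd (absv (\<pi> ^ m)) (i ** matrix_inv j - mat 1)"
        using matrix_inv_mult[OF Gr_invertible[OF Iw_rat[OF j(1)]]] by (simp add: matrix_diff_rdistrib)
      then have "i \<otimes>\<^bsub>Q\<^esub> inv\<^bsub>Q\<^esub> j \<in> Km m"
        using i j by (simp add: Q_simps Q_inv Km_iff Kpts_closed Kpts_inv Iw_K)
      then have "i \<in> Km m #>\<^bsub>Q\<^esub> j"
        using i j by (intro subgroup.rcos_module_rev[OF sub Q.is_group]) (simp_all add: Q_simps)
      then have "c = Km m #>\<^bsub>Q\<^esub> j"
        using Q.repr_independence[OF _ _ sub, of i j] i j by (simp add: Q_simps)
      then show "c \<in> (\<lambda>B. Km m #>\<^bsub>Q\<^esub> (SOME i. i \<in> Iw \<and> bnd (absv (\<pi> ^ m)) (i - B))) ` R"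
        using B(1) by (auto simp: j_def)
    qed
    then show ?thesis by (rule finite_subset) (rule finite_imageI[OF R(1)])
  qed
  have pow: "x [^]\<^bsub>Q\<^esub> n = x [^]\<^bsub>GLn\<^esub> n" for x and n :: nat
    by (induction n) (simp_all add: Q_simps GLn_def)
  have "of_nat (card (rcosets\<^bsub>Q\<^esub> Km m)) \<noteq> (0 :: 'k)"
  proof (rule card_rcosets_unit[OF normal fin])
    fix x assume x: "x \<in> carrier Q" "x [^]\<^bsub>Q\<^esub> CHAR('k) \<in> Km m" and l: "Factorial_Ring.prime CHAR('k)"
    have p: "Factorial_Ring.prime CHAR('r)"
      by (rule prime_CHAR_semidom) (rule finite_imp_CHAR_pos, simp)
    \<comment> \<open>Both characteristics are prime here and they differ, so the characteristic of
      k is nonzero in the residue field, as \<open>Iw_torsion\<close> requires.\<close>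
    then have "\<not> CHAR('r) dvd CHAR('k)" using primes_dvd_imp_eq[OF p l] char by auto
    then show "x \<in> Km m"
      using x Iw_torsion[OF _ _ m] by (simp add: Q_simps pow of_nat_eq_0_iff_char_dvd)
  qed
  moreover obtain R where R: "R \<subseteq> Iw" "finite R" "card R = card (rcosets\<^bsub>Q\<^esub> Km m)"
    "\<forall>i\<in>Iw. \<exists>!r. r \<in> R \<and> inv\<^bsub>Q\<^esub> r \<otimes>\<^bsub>Q\<^esub> i \<in> Km m"
    using normal.transversal[OF normal fin] unfolding Q_simps by blast
  moreover have "(r \<in> R \<and> inv\<^bsub>Q\<^esub> r \<otimes>\<^bsub>Q\<^esub> i \<in> Km m) = (r \<in> R \<and> matrix_inv r ** i \<in> Km m)" for r i
    unfolding Q_simps using Q_inv[of r] R(1) by (cases "r \<in> R") auto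
  ultimately show ?thesis by (intro exI[of _ R]) (simp only: simp_thms)
qed

text \<open>Level n of the abstract filtration is K_{n+1}: the filtration must lie inside
  \<open>Iw\<close>, whereas K_0 is the whole group of integral points.\<close>

lemma averaging:
  assumes char: "CHAR('k::field) \<noteq> CHAR('r)"
  shows "averaging_setting TYPE('k) Gr Iw (\<lambda>n. Km (Suc n))"
proof -
  interpret Gr: group Gr by (rule Gr_group)
  have Iw_rat: "i \<in> Iw \<Longrightarrow> i \<in> rational_points GG" for i by (auto simp: Iw_iff Kpts_iff)
  show ?thesis
  proof (intro averaging_setting.intro Gr_group averaging_setting_axioms.intro)
    show "Km (Suc n) \<subseteq> Iw" for n by (rule Km_Iw) simp
    show "Km (Suc n) \<subseteq> Km (Suc m)" if "m \<le> n" for m n using that by (intro Km_mono) simp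
    show "inv\<^bsub>Gr\<^esub> i \<otimes>\<^bsub>Gr\<^esub> k \<otimes>\<^bsub>Gr\<^esub> i \<in> Km (Suc n)" if "i \<in> Iw" "k \<in> Km (Suc n)" for i k n
      using Km_normal[of i k] that by (simp add: Gr_simps Gr_inv Iw_rat) (simp add: Iw_iff)
    show "\<exists>R\<subseteq>Iw. finite R \<and> (\<forall>i\<in>Iw. \<exists>!r. r \<in> R \<and> inv\<^bsub>Gr\<^esub> r \<otimes>\<^bsub>Gr\<^esub> i \<in> Km (Suc n)) \<and> of_nat (card R) \<noteq> (0 :: 'k)" for n
    proof -
      obtain R where R: "R \<subseteq> Iw" "finite R" "\<forall>i\<in>Iw. \<exists>!r. r \<in> R \<and> matrix_inv r ** i \<in> Km (Suc n)" "of_nat (card R) \<noteq> (0 :: 'k)"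
        using Km_transversal[OF char, of "Suc n"] by auto
      have "(r \<in> R \<and> inv\<^bsub>Gr\<^esub> r \<otimes>\<^bsub>Gr\<^esub> i \<in> Km (Suc n)) = (r \<in> R \<and> matrix_inv r ** i \<in> Km (Suc n))" for r i
        unfolding Gr_simps using Gr_inv[OF Iw_rat[of r]] R(1) by (cases "r \<in> R") auto
      then show ?thesis using R by (intro exI[of _ R]) (simp only: simp_thms)
    qed
    show "\<exists>n. \<forall>k\<in>Km (Suc n). inv\<^bsub>Gr\<^esub> g \<otimes>\<^bsub>Gr\<^esub> k \<otimes>\<^bsub>Gr\<^esub> g \<in> Iw" if "g \<in> carrier Gr" for g
      using conj_Km_Iw[of g] that by (simp add: Gr_simps Gr_inv)
  qed (simp_all add: Gr_simps matrix_mul_assoc Iw_subgroup Km_subgroup)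
qed

end

text \<open>The kernel is a set of cosets, so its vanishing says that it consists of the neutral
  coset. The middle conjunct places t(M) in the category Mod^I(G); \<open>M\<close> and
  \<open>N\<close> have independent carrier types in the last one, so that full faithfulness covers
  homomorphisms between modules on different types.\<close>

theorem lemma1p13:
  fixes absv :: "'f::field \<Rightarrow> real" and \<pi> :: 'f and res :: "'f \<Rightarrow> 'r::{field, finite}"
    and GG T :: "('f alg_closure, 'n::finite) mat set"
  assumes "pro_p_iwahori_setting absv \<pi> res GG T \<nu> C x0 BB NN"
    and "G = rational_group GG"
    and "I = reduction_preimage absv res GG NN"
    and "H = (hecke_algebra G I :: (('f, 'n) mat, 'k::field) hecke ring)"
    and "CHAR('k) \<noteq> CHAR('r)"
  shows "(\<forall>m\<ge>1. (Z_mod G I (congruence_subgroup absv \<pi> GG m) ::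
              ((('f, 'n) mat set \<Rightarrow> 'k) \<Rightarrow> (('f, 'n) mat, 'k) hecke) set set) =
            {\<one>\<^bsub>Z_bold_coinv G I (congruence_subgroup absv \<pi> GG m)\<^esub>}) \<and>
         (\<forall>M :: ((('f, 'n) mat, 'k) hecke, 'm) module. left_module H M \<longrightarrow>
            smooth_rep (mat_topology absv (carrier G)) G (t_obj G I M) \<and>
            generated_by_fixed G I (t_obj G I M)) \<and>
         (\<forall>(M :: ((('f, 'n) mat, 'k) hecke, 'm) module) (N :: ((('f, 'n) mat, 'k) hecke, 'm2) module).
            left_module H M \<and> left_module H N \<longrightarrow>
            bij_betw (t_mor G I M) (left_hom H M N) (rep_hom G (t_obj G I M) (t_obj G I N)))"
proof -
  interpret S: pro_p_iwahori_setting absv \<pi> res GG T \<nu> C x0 BB NN by fact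
  let ?K = "\<lambda>n. congruence_subgroup absv \<pi> GG (Suc n)"
  have av: "averaging_setting TYPE('k) G I ?K"
    using S.averaging[OF assms(5)] by (simp only: assms(2,3))
  show ?thesis
  proof (intro conjI allI impI)
    fix m :: nat assume "m \<ge> 1"
    then obtain n where "m = Suc n" by (cases m) auto
    then show "(Z_mod G I (congruence_subgroup absv \<pi> GG m) ::
              ((('f, 'n) mat set \<Rightarrow> 'k) \<Rightarrow> (('f, 'n) mat, 'k) hecke) set set) =
            {\<one>\<^bsub>Z_bold_coinv G I (congruence_subgroup absv \<pi> GG m)\<^esub>}"
      using averaging_setting.Z_mod_trivial[OF av] by simp
  next
    fix M :: "((('f, 'n) mat, 'k) hecke, 'm) module" assume "left_module H M"
    then have M: "hecke_module G I ?K M"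
      using av unfolding assms(4) by (intro hecke_module.intro)
    show "smooth_rep (mat_topology absv (carrier G)) G (t_obj G I M)"
    proof (rule hecke_module.tM_smooth[OF M])
      show "openin (mat_topology absv (carrier G)) A"
        if "A \<subseteq> carrier G" "\<And>g k. g \<in> A \<Longrightarrow> k \<in> ?K n \<Longrightarrow> g \<otimes>\<^bsub>G\<^esub> k \<in> A" for A n
        using that unfolding assms(2) by (rule S.open_stable)
    qed
    show "generated_by_fixed G I (t_obj G I M)"
      by (rule hecke_module.tM_generated[OF M])
  next
    fix M :: "((('f, 'n) mat, 'k) hecke, 'm) module" and N :: "((('f, 'n) mat, 'k) hecke, 'm2) module"
    assume "left_module H M \<and> left_module H N"
    then have "hecke_module_pair G I ?K M N"
      using av unfolding assms(4) by (intro hecke_module_pair.intro hecke_module.intro) auto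
    then show "bij_betw (t_mor G I M) (left_hom H M N) (rep_hom G (t_obj G I M) (t_obj G I N))"
      unfolding assms(4) by (rule hecke_module_pair.t_fully_faithful)
  qed
qed

end
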